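(* Let $n\ge2$. As $\omega>0$ grows, the zeros of $\mathcal{S}_n^\omega$ exhibit two regimes. (Burst) For $m=1,\ldots,n-1$ and $m-1\le\omega\le m$ the pattern is as follows. At $\omega=m-1$, $n-m$ zero trajectories burst from the origin into the complex plane at angles which are multiples of $2\pi/(n-m)$; if $n-m$ is odd, one of them does so along the positive ray. As $\omega$ grows, the trajectories sketch a loop, ultimately returning to the origin when $\omega=m$. The trajectory along the positive ray (if it exists) is flattened: at a certain point in $(m-1,m)$ it loops back to the origin, all along positive values. The remaining $m$ zeros of $\mathcal{S}_n^\omega$ live in $(-1,0)$. (Fizzle) Once $\omega>n$, all the zeros of $\mathcal{S}_n^\omega$ are trapped in $(-1,0)$, ultimately tending to $-1$ as $\omega\to\infty$.
   Context: For $\omega\ge0$ and $n\in\{0,1,2,\ldots\}$ the skyburst polynomial $\mathcal{S}_n^\omega$ is the monic polynomial of degree $n$ $$\mathcal{S}_n^\omega(z)=z^n\,{}_2F_1\!\left[\begin{array}{l}-n,-\omega;\\-n-\omega;\end{array}-\frac1z\right]=\sum_{\ell=0}^n\binom{n}{\ell}\frac{(-\omega)_\ell}{(-n-\omega)_\ell}\,z^{n-\ell},$$ where $(a)_\ell=a(a+1)\cdots(a+\ell-1)$, $(a)_0=1$. In particular $\mathcal{S}_n^0(z)=z^n$. (These are the monic orthogonal polynomials on the unit circle for the complex-valued measure $z^{\omega-1}dz$.) A zero trajectory is the path traced in $\mathbb{C}$ by a zero of $\mathcal{S}_n^\omega$ as $\omega$ varies.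
   Formalization: The burst angles are corrected from multiples of 2π/(n-m) to π+2πj/(n-m+1), j=1,…,n-m (for n=3, m=1 the zeros leave at ±π/3), and at the endpoint ω=m-1 one of the remaining m zeros is allowed to be at 0 instead of in (-1,0). *)

theory Defs
  imports "HOL-Analysis.Analysis" "HOL-Computational_Algebra.Polynomial"
begin

definition skyburst :: "nat \<Rightarrow> real \<Rightarrow> complex poly" where
  "skyburst n \<omega> =
     (\<Sum>l\<le>n. monom (of_real (of_nat (n choose l) *
        (pochhammer (- \<omega>) l / pochhammer (- real n - \<omega>) l))) (n - l))"

text \<open>
  The \<open>n\<close> zero trajectories over a parameter set \<open>I\<close>: continuous functions
  \<open>Z 1, \<dots>, Z n\<close> of \<open>\<omega>\<close> that list the zeros of the (monic) skyburst polynomial with multiplicity.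
\<close>

definition zero_trajectories :: "nat \<Rightarrow> real set \<Rightarrow> (nat \<Rightarrow> real \<Rightarrow> complex) \<Rightarrow> bool" where
  "zero_trajectories n I Z \<longleftrightarrow>
     (\<forall>j\<in>{1..n}. continuous_on I (Z j)) \<and>
     (\<forall>\<omega>\<in>I. skyburst n \<omega> = (\<Prod>j=1..n. [:- Z j \<omega>, 1:]))"

definition bursts_from_origin_at_angle :: "(real \<Rightarrow> complex) \<Rightarrow> real \<Rightarrow> real \<Rightarrow> bool" where
  "bursts_from_origin_at_angle g a \<theta> \<longleftrightarrow>
     g a = 0 \<and> (\<forall>\<^sub>F \<omega> in at_right a. g \<omega> \<noteq> 0) \<and>
     ((\<lambda>\<omega>. sgn (g \<omega>)) \<longlongrightarrow> cis \<theta>) (at_right a)"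

definition loop_at_origin :: "(real \<Rightarrow> complex) \<Rightarrow> real \<Rightarrow> real \<Rightarrow> bool" where
  "loop_at_origin g a b \<longleftrightarrow>
     continuous_on {a..b} g \<and> g a = 0 \<and> g b = 0 \<and> (\<forall>\<omega>\<in>{a<..<b}. g \<omega> \<noteq> 0)"

text \<open>
  A flattened loop runs out along the positive ray up to a turning point and then back along the
  same ray to the origin.
\<close>

definition flattened_loop :: "(real \<Rightarrow> complex) \<Rightarrow> real \<Rightarrow> real \<Rightarrow> bool" where
  "flattened_loop g a b \<longleftrightarrow>
     loop_at_origin g a b \<and>
     (\<forall>\<omega>\<in>{a<..<b}. g \<omega> \<in> complex_of_real ` {0<..}) \<and>
     (\<exists>\<tau>\<in>{a<..<b}. strict_mono_on {a..\<tau>} (\<lambda>\<omega>. Re (g \<omega>)) \<and>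
                   strict_antimono_on {\<tau>..b} (\<lambda>\<omega>. Re (g \<omega>)))"

text \<open>
  Direction of the bursting trajectories, \<open>k = n - m\<close> in number. At \<open>\<omega> = m - 1\<close> the origin is a
  zero of multiplicity \<open>k + 1\<close>; for \<open>\<omega> = m - 1 + \<epsilon>\<close> the small zeros satisfy
  \<open>z ^ (k + 1) \<approx> (- 1) ^ (k + 1) * C * \<epsilon>\<close> with \<open>C > 0\<close>, so they leave along \<open>k + 1\<close> equally spaced rays,
  one of which is the negative ray. That one is taken by the zero that joins \<open>(-1, 0)\<close>; the bursting
  trajectories take the other \<open>k\<close>. The spacing is therefore \<open>2 * pi / (k + 1)\<close>, and the angles
  are its multiples counted from the negative ray. The positive ray (\<open>2 * j = k + 1\<close>) is among
  them exactly when \<open>k\<close> is odd.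
\<close>

definition burst_angle :: "nat \<Rightarrow> nat \<Rightarrow> real" where
  "burst_angle k j = pi + real j * (2 * pi / real (k + 1))"

end

theory Submission
  imports Defs "HOL-Computational_Algebra.Polynomial_FPS"
    "HOL-Computational_Algebra.Fundamental_Theorem_Algebra"
begin

text \<open>
  Up to a factor, \<open>skyburst n \<omega>\<close> is \<open>z powr (n - \<omega>)\<close> times the \<open>n\<close>-th derivative of
  \<open>z powr \<omega> * (1 + z) ^ n\<close>. For \<open>\<omega> > n - 1\<close>, Rolle's theorem therefore gives \<open>n\<close> zeros in \<open>(-1, 0)\<close>; for
  integer \<open>\<omega> = p\<close> the polynomial is \<open>z ^ (n - p)\<close> times \<open>skyburst p n\<close>. For non-integer \<open>\<omega>\<close> the
  hypergeometric equation makes all zeros simple, so on \<open>(m - 1, m)\<close> they form \<open>n\<close> disjoint continuous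
  branches, permuted by conjugation; the behaviour at \<open>\<omega> = m - 1\<close> decides which of them are real.

  The turning point is unique because for fixed \<open>x > 0\<close> and odd \<open>n - m\<close> at most two \<open>\<omega>\<close> in \<open>(m - 1, m)\<close>
  have \<open>x\<close> as a zero. Indeed the value at \<open>x\<close> is, up to a non-vanishing factor, the Mellin transform
  of the \<open>m\<close>-th Taylor remainder at \<open>v = 0\<close> of \<open>(v - x) ^ n / (1 + v) ^ (n + 1)\<close>; this remainder changes
  sign at most twice, and the kernel \<open>v powr - \<omega>\<close> is totally positive.
\<close>

subsection \<open>Coefficients and values\<close>

text \<open>The delicate claim is the single turning point. The positive zero is known only
  implicitly, so parameters per level are counted instead of differentiating it. Let
  \<open>f v = (v - x) ^ n / (1 + v) ^ (n + 1)\<close>. Its integral against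
  \<open>v powr (- \<omega> - 1)\<close> diverges at 0; removing the first \<open>m\<close> Taylor
  terms makes it converge for \<open>m - 1 < \<omega> < m\<close> and keeps the analytically
  continued value. The sign changes are controlled because \<open>f\<close> solves a first order
  linear equation that its Taylor polynomial violates only in two adjacent monomials: to the right
  of \<open>x\<close>, the derivative of the quotient of polynomial and \<open>f\<close> changes
  sign once.

  For non-integer \<omega> the points 0 and -1 are barriers, since the values there are nonzero
  multiples of \<open>\<omega> gchoose n\<close> and \<open>(-1) ^ n\<close>. A branch whose limit
  at an end is real and simple equals its own conjugate. At \<open>\<omega> = m - 1\<close> the
  multiple zero is resolved on the scale of the \<open>(n - m + 1)\<close>-th root of
  \<open>\<omega> - (m - 1)\<close>. The origin meets \<open>n - m + 1\<close> branches at the left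
  end and \<open>n - m\<close> at the right; the difference is the branch that enters
  \<open>(-1, 0)\<close>.\<close>

lemma gbinomial_pos_real:
  fixes a :: real
  assumes "a > real n - 1"
  shows "a gchoose n > 0"
  unfolding gbinomial_prod_rev
proof (intro divide_pos_pos prod_pos)
  fix i assume "i \<in> {0..<n}"
  then have "real i \<le> real n - 1" by auto
  then show "0 < a - real i" using assms by linarith
qed auto

text \<open>The rising factorial of length \<open>l + n\<close> from
  \<open>- real n - \<omega>\<close> can be split after \<open>l\<close> or after \<open>n\<close>
  factors; equating the two turns the quotient of rising factorials into one of generalised
  binomials with the same lower index. The parameters at which a coefficient vanishes can then be
  read off.\<close>

lemma coeff_skyburst:
  assumes "\<omega> > -1"
  shows "coeff (skyburst n \<omega>) j =
    of_real (real (n choose j) * ((\<omega> + real j) gchoose n) / ((\<omega> + real n) gchoose n))"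
proof -
  have *: "coeff (skyburst n \<omega>) j = (\<Sum>l\<le>n. if n - l = j then complex_of_real (real (n choose l) *
        (pochhammer (- \<omega>) l / pochhammer (- real n - \<omega>) l)) else 0)"
    unfolding skyburst_def coeff_sum coeff_monom by simp
  show ?thesis
  proof (cases "j \<le> n")
    case False
    then show ?thesis unfolding * by (auto simp: binomial_eq_0 intro!: sum.neutral)
  next
    case True
    define l where "l = n - j"
    have ln: "l \<le> n" and j: "real j = real n - real l" using True by (auto simp: l_def)
    have "coeff (skyburst n \<omega>) j = (\<Sum>l'\<le>n. if l' = l then complex_of_real (real (n choose l') *
        (pochhammer (- \<omega>) l' / pochhammer (- real n - \<omega>) l')) else 0)"
      unfolding * by (rule sum.cong) (use True in \<open>auto simp: l_def\<close>)
    also have "\<dots> = complex_of_real (real (n choose l) *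
        (pochhammer (- \<omega>) l / pochhammer (- real n - \<omega>) l))"
      using ln by simp
    finally have c: "coeff (skyburst n \<omega>) j = complex_of_real (real (n choose l) *
        (pochhammer (- \<omega>) l / pochhammer (- real n - \<omega>) l))" .
    have nz: "pochhammer (- real n - \<omega>) i \<noteq> 0" if "i \<le> n" for i
    proof
      assume "pochhammer (- real n - \<omega>) i = 0"
      then obtain q where "q < i" "- real n - \<omega> = - real q" by (auto simp: pochhammer_eq_0_iff)
      then have "\<omega> = real q - real n" "real q \<le> real n - 1" using that by auto
      then show False using assms by linarith
    qed
    have "pochhammer (- real n - \<omega>) (l + n) =
        pochhammer (- real n - \<omega>) l * pochhammer (- real n - \<omega> + real l) n"
      by (rule pochhammer_product')
    moreover have "pochhammer (- real n - \<omega>) (n + l) =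
        pochhammer (- real n - \<omega>) n * pochhammer (- real n - \<omega> + real n) l"
      by (rule pochhammer_product')
    ultimately have e: "pochhammer (- real n - \<omega>) l * pochhammer (- real n - \<omega> + real l) n =
        pochhammer (- real n - \<omega>) n * pochhammer (- \<omega>) l" by (simp add: add.commute)
    have "pochhammer (- \<omega>) l / pochhammer (- real n - \<omega>) l =
        pochhammer (- (\<omega> + real j)) n / pochhammer (- (\<omega> + real n)) n"
    proof -
      have "- (\<omega> + real j) = - real n - \<omega> + real l" "- (\<omega> + real n) = - real n - \<omega>"
        by (simp_all add: j)
      then show ?thesis using e nz[OF ln] nz[OF order_refl] by (metis frac_eq_eq mult.commute)
    qed
    also have "\<dots> = ((\<omega> + real j) gchoose n) / ((\<omega> + real n) gchoose n)"
      by (simp add: gbinomial_pochhammer)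
    finally show ?thesis unfolding c using binomial_symmetric[OF True] by (simp add: l_def)
  qed
qed

lemma gchoose_shift_pos:
  fixes \<omega> :: real
  assumes "\<omega> > -1"
  shows "(\<omega> + real n) gchoose n > 0"
  by (rule gbinomial_pos_real) (use assms in linarith)

lemma coeff_skyburst_top:
  assumes "\<omega> > -1"
  shows "coeff (skyburst n \<omega>) n = 1" "degree (skyburst n \<omega>) = n" "skyburst n \<omega> \<noteq> 0"
proof -
  show 1: "coeff (skyburst n \<omega>) n = 1"
    using gchoose_shift_pos[OF assms, of n] by (simp add: coeff_skyburst[OF assms])
  show "degree (skyburst n \<omega>) = n"
  proof (rule antisym)
    show "degree (skyburst n \<omega>) \<le> n"
      by (rule degree_le) (auto simp: coeff_skyburst[OF assms])
    show "n \<le> degree (skyburst n \<omega>)" by (rule le_degree) (simp add: 1)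
  qed
  show "skyburst n \<omega> \<noteq> 0" using 1 by auto
qed

lemma poly_skyburst:
  assumes "\<omega> > -1"
  shows "poly (skyburst n \<omega>) z =
    (\<Sum>j\<le>n. of_real (real (n choose j) * ((\<omega> + real j) gchoose n) / ((\<omega> + real n) gchoose n)) * z ^ j)"
  unfolding poly_altdef coeff_skyburst_top(2)[OF assms] coeff_skyburst[OF assms] ..

text \<open>The common denominator is dropped. It is positive for \<open>\<omega> > -1\<close>, so
  real zeros are unchanged, and what remains is polynomial in both \<omega> and
  \<open>x\<close>.\<close>

definition sky_num :: "nat \<Rightarrow> real \<Rightarrow> real \<Rightarrow> real" where
  "sky_num n \<omega> x = (\<Sum>j\<le>n. real (n choose j) * ((\<omega> + real j) gchoose n) * x ^ j)"

lemma poly_skyburst_of_real: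
  assumes "\<omega> > -1"
  shows "poly (skyburst n \<omega>) (of_real x) = of_real (sky_num n \<omega> x / ((\<omega> + real n) gchoose n))"
  unfolding poly_skyburst[OF assms] sky_num_def by (simp add: sum_divide_distrib)

lemma poly_skyburst_of_real_eq_0:
  assumes "\<omega> > -1"
  shows "poly (skyburst n \<omega>) (of_real x) = 0 \<longleftrightarrow> sky_num n \<omega> x = 0"
  using gchoose_shift_pos[OF assms, of n] unfolding poly_skyburst_of_real[OF assms] by simp

lemma poly_skyburst_cnj:
  assumes "\<omega> > -1"
  shows "poly (skyburst n \<omega>) (cnj z) = cnj (poly (skyburst n \<omega>) z)"
  unfolding poly_skyburst[OF assms] by simp

text \<open>This is the \<open>N\<close>-th backward difference at \<open>a\<close> of the
  polynomial \<open>a gchoose r\<close> of degree \<open>r\<close>, hence 0 for \<open>r < N\<close>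
  and 1 for \<open>r = N\<close>.\<close>

definition alt_gbinomial_sum :: "nat \<Rightarrow> real \<Rightarrow> nat \<Rightarrow> real" where
  "alt_gbinomial_sum N a r = (\<Sum>l\<le>N. (-1) ^ l * real (N choose l) * ((a - real l) gchoose r))"

lemma alt_gbinomial_sum_Suc:
  "alt_gbinomial_sum (Suc N) a r = alt_gbinomial_sum N a r - alt_gbinomial_sum N (a - 1) r"
proof -
  have "alt_gbinomial_sum (Suc N) a r = (a gchoose r) +
     (\<Sum>l\<le>N. (-1) ^ Suc l * real (Suc N choose Suc l) * ((a - 1 - real l) gchoose r))"
    unfolding alt_gbinomial_sum_def by (subst sum.atMost_Suc_shift) (simp add: algebra_simps)
  also have "\<dots> = (a gchoose r) +
     (\<Sum>l\<le>N. (-1) ^ Suc l * real (N choose Suc l) * ((a - real (Suc l)) gchoose r)) -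
     alt_gbinomial_sum N (a - 1) r"
    unfolding alt_gbinomial_sum_def
    by (simp add: sum_subtractf[symmetric] sum.distrib[symmetric] algebra_simps)
  also have "(a gchoose r) +
     (\<Sum>l\<le>N. (-1) ^ Suc l * real (N choose Suc l) * ((a - real (Suc l)) gchoose r)) =
     (\<Sum>l\<le>Suc N. (-1) ^ l * real (N choose l) * ((a - real l) gchoose r))"
    by (subst sum.atMost_Suc_shift) simp
  also have "\<dots> = alt_gbinomial_sum N a r" by (simp add: alt_gbinomial_sum_def)
  finally show ?thesis .
qed

lemma alt_gbinomial_sum_Suc_Suc:
  "alt_gbinomial_sum (Suc N) a (Suc r) = alt_gbinomial_sum N (a - 1) r"
  unfolding alt_gbinomial_sum_Suc unfolding alt_gbinomial_sum_def sum_subtractf[symmetric]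
proof (rule sum.cong[OF refl])
  fix l
  have "((a - real l) gchoose Suc r) - ((a - 1 - real l) gchoose Suc r) = ((a - 1 - real l) gchoose r)"
    using gbinomial_Suc_Suc[of "a - 1 - real l" r] by simp
  then show "(-1) ^ l * real (N choose l) * ((a - real l) gchoose Suc r) -
    (-1) ^ l * real (N choose l) * ((a - 1 - real l) gchoose Suc r) =
    (-1) ^ l * real (N choose l) * ((a - 1 - real l) gchoose r)"
    by (metis right_diff_distrib)
qed

lemma alt_gbinomial_sum_eq_0:
  assumes "r < N"
  shows "alt_gbinomial_sum N a r = 0"
  using assms
proof (induction N arbitrary: a r)
  case (Suc N)
  show ?case
  proof (cases r)
    case 0
    then show ?thesis unfolding alt_gbinomial_sum_Suc by (simp add: alt_gbinomial_sum_def)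
  next
    case (Suc q)
    then show ?thesis using Suc.IH[of q] Suc.prems by (simp add: alt_gbinomial_sum_Suc_Suc)
  qed
qed simp

lemma alt_gbinomial_sum_top: "alt_gbinomial_sum N a N = 1"
  by (induction N arbitrary: a) (simp_all add: alt_gbinomial_sum_Suc_Suc, simp add: alt_gbinomial_sum_def)

lemma sky_num_0: "sky_num n \<omega> 0 = (\<omega> gchoose n)"
  unfolding sky_num_def by (subst sum.remove[of _ 0]) (auto intro!: sum.neutral)

lemma gbinomial_eq_0_real_iff:
  "((a::real) gchoose n) = 0 \<longleftrightarrow> (\<exists>i<n. a = real i)"
  unfolding gbinomial_prod_rev by auto

subsection \<open>Zeros for large and for integer parameter\<close>

text \<open>Rolle's theorem between neighbouring points, by removing the largest. Differentiability
  is asked only strictly inside, because \<open>x powr (\<omega> - real j)\<close> may fail to have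
  a derivative at 0.\<close>

lemma rolle_finite_set:
  fixes f f' :: "real \<Rightarrow> real"
  assumes "finite A" "card A = Suc N" "\<And>x. x \<in> A \<Longrightarrow> f x = 0"
    "continuous_on {Min A..Max A} f"
    "\<And>x. Min A < x \<Longrightarrow> x < Max A \<Longrightarrow> (f has_real_derivative f' x) (at x)"
  shows "\<exists>B. finite B \<and> card B = N \<and> B \<subseteq> {Min A<..<Max A} \<and> (\<forall>x\<in>B. f' x = 0)"
  using assms
proof (induction N arbitrary: A)
  case 0
  then show ?case by (intro exI[of _ "{}"]) auto
next
  case (Suc N)
  define M where "M = Max A"
  define A' where "A' = A - {M}"
  define M' where "M' = Max A'"
  have A0: "A \<noteq> {}" using Suc.prems(2) by auto
  have MA: "M \<in> A" using Suc.prems(1) A0 by (simp add: M_def)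
  have fA': "finite A'" "card A' = Suc N" using Suc.prems(1,2) MA by (auto simp: A'_def)
  then have A'0: "A' \<noteq> {}" by auto
  have M'A: "M' \<in> A'" using fA' A'0 by (simp add: M'_def)
  have M'M: "M' < M" using M'A Suc.prems(1) by (auto simp: A'_def M_def order.strict_iff_order)
  have mn: "Min A' = Min A"
  proof (rule antisym)
    show "Min A \<le> Min A'" using A'0 Suc.prems(1) by (intro Min_antimono) (auto simp: A'_def)
    have "Min A \<in> A" using Suc.prems(1) A0 by simp
    moreover have "Min A \<le> M'" using M'A Suc.prems(1) by (auto simp: A'_def)
    then have "Min A \<noteq> M" using M'M by auto
    ultimately have "Min A \<in> A'" by (simp add: A'_def)
    then show "Min A' \<le> Min A" using fA' by simp
  qed
  have mnM': "Min A \<le> M'" using M'A Suc.prems(1) by (auto simp: A'_def)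
  obtain B where B: "finite B" "card B = N" "B \<subseteq> {Min A'<..<Max A'}" "\<forall>x\<in>B. f' x = 0"
  proof -
    have "\<exists>B. finite B \<and> card B = N \<and> B \<subseteq> {Min A'<..<Max A'} \<and> (\<forall>x\<in>B. f' x = 0)"
    proof (rule Suc.IH[OF fA'])
      show "f x = 0" if "x \<in> A'" for x using that Suc.prems(3) by (auto simp: A'_def)
      show "continuous_on {Min A'..Max A'} f"
        by (rule continuous_on_subset[OF Suc.prems(4)]) (use mn M'M in \<open>auto simp: M'_def M_def\<close>)
      show "(f has_real_derivative f' x) (at x)" if "Min A' < x" "x < Max A'" for x
        by (rule Suc.prems(5)) (use that mn M'M in \<open>auto simp: M'_def M_def\<close>)
    qed
    then show ?thesis using that by blast
  qed
  have "\<exists>z>M'. z < M \<and> (f has_real_derivative 0) (at z)"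
  proof (rule Rolle[OF M'M])
    show "f M' = f M" using Suc.prems(3) MA M'A by (auto simp: A'_def)
    show "continuous_on {M'..M} f"
      by (rule continuous_on_subset[OF Suc.prems(4)]) (use mnM' in \<open>auto simp: M_def\<close>)
    show "f differentiable (at x)" if "M' < x" "x < M" for x
      using Suc.prems(5)[of x] that mnM' M_def real_differentiable_def by fastforce
  qed
  then obtain z where z: "M' < z" "z < M" "(f has_real_derivative 0) (at z)" by blast
  have "f' z = 0" using DERIV_unique[OF z(3) Suc.prems(5)] z mnM' by (auto simp: M_def)
  moreover have "z \<notin> B" using B(3) z(1) by (auto simp: M'_def)
  moreover have "insert z B \<subseteq> {Min A<..<Max A}"
    using B(3) z mnM' M'M by (auto simp: mn M'_def M_def)
  ultimately show ?case using B by (intro exI[of _ "insert z B"]) auto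
qed

text \<open>In the variable \<open>x = - z > 0\<close>, \<open>x powr (\<omega> - j)\<close> times
  this polynomial is \<open>1 / fact j\<close> times the \<open>j\<close>-th derivative of
  \<open>x powr \<omega> * (1 - x) ^ n\<close>. The normalisation explains the factor
  \<open>Suc j\<close> when differentiating once more.\<close>

definition rodrigues_factor :: "nat \<Rightarrow> real \<Rightarrow> nat \<Rightarrow> real \<Rightarrow> real" where
  "rodrigues_factor n \<omega> j x = (\<Sum>i\<le>n. (-1) ^ i * real (n choose i) * ((\<omega> + real i) gchoose j) * x ^ i)"

lemma rodrigues_factor_deriv:
  assumes "x > 0"
  shows "((\<lambda>x. x powr (\<omega> - real j) * rodrigues_factor n \<omega> j x) has_real_derivative
     real (Suc j) * (x powr (\<omega> - real (Suc j)) * rodrigues_factor n \<omega> (Suc j) x)) (at x)"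
proof -
  let ?c = "\<lambda>i. (-1) ^ i * real (n choose i) * ((\<omega> + real i) gchoose j)"
  let ?D = "\<Sum>i\<le>n. ?c i * ((\<omega> + real i - real j) * x powr (\<omega> + real i - real j - 1))"
  have s: "((\<lambda>x. \<Sum>i\<le>n. ?c i * x powr (\<omega> + real i - real j)) has_real_derivative ?D) (at x)"
    by (intro DERIV_sum DERIV_cmult has_real_derivative_powr assms)
  have ev: "\<forall>\<^sub>F x in nhds x. (\<Sum>i\<le>n. ?c i * x powr (\<omega> + real i - real j)) =
      x powr (\<omega> - real j) * rodrigues_factor n \<omega> j x"
    using eventually_nhds_in_open[of "{0<..}" x, simplified, OF assms]
  proof eventually_elim
    case (elim y)
    have "y powr (\<omega> + real i - real j) = y powr (\<omega> - real j) * y ^ i" for i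
      using elim by (simp add: powr_add[symmetric] flip: powr_realpow) (simp add: algebra_simps)
    then show ?case unfolding rodrigues_factor_def sum_distrib_left by (simp add: mult_ac)
  qed
  have d: "((\<lambda>x. x powr (\<omega> - real j) * rodrigues_factor n \<omega> j x) has_real_derivative ?D) (at x)"
    using DERIV_cong_ev[OF refl ev refl] s by (rule iffD1)
  have "?D = real (Suc j) * (x powr (\<omega> - real (Suc j)) * rodrigues_factor n \<omega> (Suc j) x)"
    unfolding rodrigues_factor_def sum_distrib_left
  proof (rule sum.cong[OF refl])
    fix i
    have p: "x powr (\<omega> + real i - real j - 1) = x powr (\<omega> - real (Suc j)) * x ^ i"
      using assms by (simp add: powr_add[symmetric] flip: powr_realpow) (simp add: algebra_simps)
    have g: "((\<omega> + real i) gchoose j) * (\<omega> + real i - real j) = real (Suc j) * ((\<omega> + real i) gchoose Suc j)"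
      using gbinomial_absorb_comp[of "\<omega> + real i" j] gbinomial_absorption[of j "\<omega> + real i"]
      by (simp add: mult.commute)
    have e: "?c i * ((\<omega> + real i - real j) * y) = (-1) ^ i * real (n choose i) *
        (((\<omega> + real i) gchoose j) * (\<omega> + real i - real j)) * y" for y
      by (simp only: mult.assoc)
    show "?c i * ((\<omega> + real i - real j) * x powr (\<omega> + real i - real j - 1)) =
      real (Suc j) * (x powr (\<omega> - real (Suc j)) * ((-1) ^ i * real (n choose i) * ((\<omega> + real i) gchoose Suc j) * x ^ i))"
      unfolding e unfolding p g by (simp only: mult_ac)
  qed
  then show ?thesis using d by simp
qed

lemma rodrigues_factor_at_1:
  "rodrigues_factor n \<omega> j 1 = (-1) ^ n * alt_gbinomial_sum n (\<omega> + real n) j"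
proof -
  have "rodrigues_factor n \<omega> j 1 =
      (\<Sum>l\<le>n. (-1) ^ (n - l) * real (n choose (n - l)) * ((\<omega> + real (n - l)) gchoose j))"
    unfolding rodrigues_factor_def by (rule sum.reindex_bij_witness[of _ "\<lambda>l. n - l" "\<lambda>l. n - l"]) auto
  also have "\<dots> = (-1) ^ n * alt_gbinomial_sum n (\<omega> + real n) j"
    unfolding alt_gbinomial_sum_def sum_distrib_left
  proof (rule sum.cong[OF refl])
    fix l assume "l \<in> {..n}"
    then have l: "l \<le> n" by simp
    then have "(-1::real) ^ (n - l) = (-1) ^ n * (-1) ^ l" by (auto simp: minus_one_power_iff)
    then show "(-1) ^ (n - l) * real (n choose (n - l)) * ((\<omega> + real (n - l)) gchoose j) =
      (-1) ^ n * ((-1) ^ l * real (n choose l) * ((\<omega> + real n - real l) gchoose j))"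
      using binomial_symmetric[OF l] l by (simp add: of_nat_diff add_diff_eq)
  qed
  finally show ?thesis .
qed

text \<open>Fewer than \<open>n\<close> derivatives do not exhaust the \<open>n\<close>-fold zero of
  \<open>(1 - x) ^ n\<close>; algebraically, an \<open>n\<close>-th difference annihilates degree
  \<open>j < n\<close>.\<close>

lemma rodrigues_factor_1:
  assumes "j < n"
  shows "rodrigues_factor n \<omega> j 1 = 0"
  unfolding rodrigues_factor_at_1 using alt_gbinomial_sum_eq_0[OF assms] by simp

lemma rodrigues_factor_zeros:
  assumes "\<omega> > real n - 1" "j \<le> n"
  shows "\<exists>B. finite B \<and> card B = j \<and> B \<subseteq> {0<..<1} \<and> (\<forall>x\<in>B. rodrigues_factor n \<omega> j x = 0)"
  using assms(2)
proof (induction j)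
  case 0
  then show ?case by (intro exI[of _ "{}"]) auto
next
  case (Suc j)
  obtain B where B: "finite B" "card B = j" "B \<subseteq> {0<..<1}" "\<forall>x\<in>B. rodrigues_factor n \<omega> j x = 0"
    using Suc by (meson Suc_leD)
  \<comment> \<open>The endpoints supply two further zeros: 1 because \<open>j < n\<close>, and 0
    because the exponent \<open>\<omega> - j\<close> is positive, which is where
    \<open>\<omega> > n - 1\<close> enters. From \<open>j + 2\<close> zeros Rolle yields
    \<open>j + 1\<close>.\<close>
  define A where "A = insert 0 (insert 1 B)"
  have wj: "\<omega> - real j > 0" using Suc.prems assms(1) by linarith
  let ?f = "\<lambda>x. x powr (\<omega> - real j) * rodrigues_factor n \<omega> j x"
  have A: "finite A" "card A = Suc (Suc j)" using B by (auto simp: A_def subset_iff card_insert_if)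
  have mA: "Min A = 0" by (rule Min_eqI) (use A B in \<open>auto simp: A_def subset_iff less_imp_le\<close>)
  have MA: "Max A = 1" by (rule Max_eqI) (use A B in \<open>auto simp: A_def subset_iff less_imp_le\<close>)
  have "\<exists>C. finite C \<and> card C = Suc j \<and> C \<subseteq> {Min A<..<Max A} \<and>
    (\<forall>x\<in>C. real (Suc j) * (x powr (\<omega> - real (Suc j)) * rodrigues_factor n \<omega> (Suc j) x) = 0)"
  proof (rule rolle_finite_set[OF A, of ?f])
    show "?f x = 0" if "x \<in> A" for x
      using that B wj Suc.prems by (auto simp: A_def rodrigues_factor_1)
    show "continuous_on {Min A..Max A} ?f"
      unfolding rodrigues_factor_def using wj mA by (intro continuous_on_mult continuous_on_powr' continuous_intros) auto
    show "(?f has_real_derivative real (Suc j) * (x powr (\<omega> - real (Suc j)) * rodrigues_factor n \<omega> (Suc j) x)) (at x)"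
      if "Min A < x" "x < Max A" for x
      by (rule rodrigues_factor_deriv) (use that mA in simp)
  qed
  then obtain C where C: "finite C" "card C = Suc j" "C \<subseteq> {0<..<1}"
    "\<forall>x\<in>C. real (Suc j) * (x powr (\<omega> - real (Suc j)) * rodrigues_factor n \<omega> (Suc j) x) = 0"
    unfolding mA MA by blast
  have "rodrigues_factor n \<omega> (Suc j) x = 0" if "x \<in> C" for x
    using C(3,4) that by fastforce
  then show ?case using C by blast
qed

lemma sky_num_rodrigues: "sky_num n \<omega> (- x) = rodrigues_factor n \<omega> n x"
  unfolding sky_num_def rodrigues_factor_def by (rule sum.cong) (auto simp: power_minus[of x] mult_ac)

lemma sky_num_minus_one: "sky_num n \<omega> (-1) = (-1) ^ n"
  using sky_num_rodrigues[of n \<omega> 1] by (simp add: rodrigues_factor_at_1 alt_gbinomial_sum_top)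

lemma monic_poly_eq_prod_roots:
  fixes p :: "'a::idom poly"
  assumes "lead_coeff p = 1" "finite A" "card A = degree p" "\<And>a. a \<in> A \<Longrightarrow> poly p a = 0"
  shows "p = (\<Prod>a\<in>A. [:-a, 1:])"
proof (rule poly_eqI_degree_lead_coeff[where n = "degree p" and A = A])
  have "degree (\<Prod>a\<in>A. [:-a, 1:]) = card A"
    by (subst degree_prod_eq_sum_degree) auto
  moreover have "lead_coeff (\<Prod>a\<in>A. [:-a, 1:]) = 1" by (simp add: lead_coeff_prod)
  ultimately show "coeff p (degree p) = coeff (\<Prod>a\<in>A. [:-a, 1:]) (degree p)"
    "degree (\<Prod>a\<in>A. [:-a, 1:]) \<le> degree p" using assms(1,3) by simp_all
  show "poly p z = poly (\<Prod>a\<in>A. [:-a, 1:]) z" if "z \<in> A" for z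
  proof -
    have "poly (\<Prod>a\<in>A. [:-a, 1:]) z = 0"
      unfolding poly_prod using that assms(2) by (auto intro!: prod_zero)
    then show ?thesis using assms(4)[OF that] by simp
  qed
qed (use assms in auto)

lemma skyburst_fizzle:
  assumes "\<omega> > real n - 1" "\<omega> > -1"
  shows "\<exists>A. finite A \<and> card A = n \<and> A \<subseteq> {-1<..<0} \<and> skyburst n \<omega> = (\<Prod>a\<in>A. [:- complex_of_real a, 1:])"
proof -
  obtain B where B: "finite B" "card B = n" "B \<subseteq> {0<..<1}" "\<forall>x\<in>B. rodrigues_factor n \<omega> n x = 0"
    using rodrigues_factor_zeros[OF assms(1), of n] by auto
  define A where "A = uminus ` B"
  have A: "finite A" "card A = n" "A \<subseteq> {-1<..<0}"
    using B by (auto simp: A_def card_image)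
  define C where "C = complex_of_real ` A"
  have "skyburst n \<omega> = (\<Prod>a\<in>C. [:-a, 1:])"
  proof (rule monic_poly_eq_prod_roots)
    show "poly (skyburst n \<omega>) a = 0" if "a \<in> C" for a
      using that B(4) assms(2) by (auto simp: C_def A_def poly_skyburst_of_real_eq_0 sky_num_rodrigues simp flip: of_real_minus)
  qed (use A coeff_skyburst_top[OF assms(2)] in \<open>auto simp: C_def card_image inj_on_def\<close>)
  also have "\<dots> = (\<Prod>a\<in>A. [:- complex_of_real a, 1:])"
    unfolding C_def by (subst prod.reindex) (auto simp: inj_on_def)
  finally show ?thesis using A by blast
qed

text \<open>The coefficients with \<open>p + j < n\<close> vanish; for the others, trinomial
  revision exchanges the roles of \<open>n\<close> and \<open>p\<close>. Since
  \<open>n > p - 1\<close>, \<open>skyburst_fizzle\<close> applies to the second factor and locates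
  the zeros off the origin.\<close>

lemma skyburst_integer:
  assumes "p \<le> n"
  shows "skyburst n (real p) = monom 1 (n - p) * skyburst p (real n)"
proof (rule poly_eqI)
  fix j
  show "coeff (skyburst n (real p)) j = coeff (monom 1 (n - p) * skyburst p (real n)) j"
  proof (cases "j < n - p")
    case True
    then have "(real p + real j) gchoose n = 0"
      unfolding gbinomial_eq_0_real_iff by (intro exI[of _ "p + j"]) auto
    then show ?thesis using True by (simp add: coeff_monom_mult coeff_skyburst)
  next
    case False
    define i where "i = j - (n - p)"
    have j: "j = n - p + i" using False by (simp add: i_def)
    have 1: "(real p + real j) gchoose n = real ((p + j) choose n)"
      by (simp add: binomial_gbinomial)
    have 2: "(real p + real n) gchoose n = real ((p + n) choose n)"
      by (simp add: binomial_gbinomial)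
    have 3: "(real n + real i) gchoose p = real ((n + i) choose p)"
      by (simp add: binomial_gbinomial)
    have 4: "(real n + real p) gchoose p = real ((n + p) choose p)"
      by (simp add: binomial_gbinomial)
    have e5: "p + j = n + i" using assms j by simp
    have e6: "(p + n) choose n = (n + p) choose p"
      using binomial_symmetric[of n "p + n"] by (simp add: add.commute)
    have "(n choose j) * ((n + i) choose n) = (p choose i) * ((n + i) choose p)"
    proof (cases "i \<le> p")
      case True
      have "((n + i) choose n) * (n choose j) = ((n + i) choose j) * (((n + i) - j) choose (n - j))"
        by (rule choose_mult) (use True j assms in auto)
      also have "((n + i) choose j) = ((n + i) choose p)"
        using binomial_symmetric[of j "n + i"] j assms by simp
      also have "((n + i) - j) choose (n - j) = p choose i"
        using binomial_symmetric[OF True] j assms True by simp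
      finally show ?thesis by (simp add: mult.commute)
    next
      case False
      then show ?thesis using j assms by (simp add: binomial_eq_0)
    qed
    then have "real (n choose j) * real ((n + i) choose n) = real (p choose i) * real ((n + i) choose p)"
      by (metis of_nat_mult)
    then have "coeff (skyburst n (real p)) j = coeff (skyburst p (real n)) i"
      unfolding coeff_skyburst[of "real p", simplified] coeff_skyburst[of "real n", simplified] 1 2 3 4 e5 e6
      by (metis of_real_of_nat_eq of_real_mult)
    then show ?thesis using j by (simp add: coeff_monom_mult)
  qed
qed

lemma skyburst_integer_prod:
  assumes "p \<le> n" "n > 0"
  shows "\<exists>A. finite A \<and> card A = p \<and> A \<subseteq> {-1<..<0} \<and>
     skyburst n (real p) = [:0, 1:] ^ (n - p) * (\<Prod>a\<in>A. [:- complex_of_real a, 1:])"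
  using skyburst_fizzle[of p "real n"] skyburst_integer[OF assms(1)] assms
  by (auto simp: monom_altdef)

text \<open>Coefficientwise this is a two-term recurrence, which follows from the absorption
  identities for both binomials.\<close>

lemma skyburst_ode:
  assumes "\<omega> > -1"
  shows "[:0, 1, 1:] * pderiv (pderiv (skyburst n \<omega>)) +
     [:of_real (1 + \<omega> - real n), of_real (\<omega> + 2 - real n):] * pderiv (skyburst n \<omega>) =
     smult (of_real (real n * (\<omega> + 1))) (skyburst n \<omega>)" (is "?L = ?R")
proof (rule poly_eqI)
  fix j
  define c where "c = coeff (skyburst n \<omega>)"
  have rec: "of_nat (Suc j) * (of_nat j + of_real (1 + \<omega> - real n)) * c (Suc j) =
     (of_nat n - of_nat j) * of_real (\<omega> + 1 + real j) * c j"
  proof (cases "j \<le> n")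
    case True
    have a: "real (Suc j) * real (n choose Suc j) = (real n - real j) * real (n choose j)"
    proof (cases "j < n")
      case True
      have "Suc j * (n choose Suc j) = (n - j) * (n choose j)"
        using True by (metis binomial_absorb_comp binomial_absorption less_imp_le_nat)
      then show ?thesis using True by (metis of_nat_diff of_nat_mult less_imp_le_nat)
    next
      case False
      then show ?thesis using \<open>j \<le> n\<close> by simp
    qed
    have b: "(real j + 1 + \<omega> - real n) * ((\<omega> + real (Suc j)) gchoose n) =
       (\<omega> + 1 + real j) * ((\<omega> + real j) gchoose n)"
      using gbinomial_absorb_comp[of "\<omega> + real (Suc j)" n] by (simp add: algebra_simps)
    have "real (Suc j) * (real j + (1 + \<omega> - real n)) * (real (n choose Suc j) * ((\<omega> + real (Suc j)) gchoose n)) =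
      (real (Suc j) * real (n choose Suc j)) * ((real j + 1 + \<omega> - real n) * ((\<omega> + real (Suc j)) gchoose n))"
      by (simp only: mult_ac add.assoc add_diff_eq)
    also have "\<dots> = (real n - real j) * (\<omega> + 1 + real j) * (real (n choose j) * ((\<omega> + real j) gchoose n))"
      unfolding a b by (simp only: mult_ac)
    finally have e: "real (Suc j) * (real j + (1 + \<omega> - real n)) * (real (n choose Suc j) * ((\<omega> + real (Suc j)) gchoose n))
       / ((\<omega> + real n) gchoose n) = (real n - real j) * (\<omega> + 1 + real j) * (real (n choose j) * ((\<omega> + real j) gchoose n)) / ((\<omega> + real n) gchoose n)"
      by simp
    show ?thesis unfolding c_def coeff_skyburst[OF assms]
      using arg_cong[OF e, of complex_of_real] by simp
  next
    case False
    then show ?thesis by (simp add: c_def coeff_skyburst[OF assms] binomial_eq_0)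
  qed
  have "coeff ?L j = of_nat (Suc j) * (of_nat j + of_real (1 + \<omega> - real n)) * c (Suc j) +
     of_nat j * (of_nat j - 1 + of_real (\<omega> + 2 - real n)) * c j"
  proof (cases j)
    case 0
    then show ?thesis by (simp add: coeff_pderiv c_def)
  next
    case (Suc i)
    show ?thesis
    proof (cases i)
      case 0
      then show ?thesis using Suc by (simp add: coeff_pderiv c_def numeral_2_eq_2 numeral_3_eq_3 algebra_simps)
    next
      case (Suc i')
      then show ?thesis using \<open>j = Suc i\<close>
        by (simp add: coeff_pderiv c_def algebra_simps)
    qed
  qed
  also have "\<dots> = of_real (real n * (\<omega> + 1)) * c j"
    unfolding rec by (simp add: algebra_simps)
  finally show "coeff ?L j = coeff ?R j" by (simp add: c_def)
qed

lemma pderiv_nonzero_if_root: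
  fixes p :: "'a::{idom,ring_char_0} poly"
  assumes "p \<noteq> 0" "poly p z = 0"
  shows "pderiv p \<noteq> 0"
proof
  assume "pderiv p = 0"
  then obtain c where "p = [:c:]" by (metis pderiv_eq_0_iff degree_eq_zeroE)
  then show False using assms by simp
qed

text \<open>A zero of multiplicity \<open>r + 1\<close> with \<open>r > 0\<close> has multiplicity
  \<open>r\<close> in the first and \<open>r - 1\<close> in the second derivative. The equation
  writes \<open>z * (1 + z)\<close> times the second derivative through the other two, which forces
  multiplicity at least \<open>r\<close> there, as \<open>z * (1 + z)\<close> is nonzero.\<close>

lemma skyburst_simple_zero:
  assumes "\<omega> > -1" "poly (skyburst n \<omega>) z = 0" "z \<noteq> 0" "z \<noteq> -1"
  shows "poly (pderiv (skyburst n \<omega>)) z \<noteq> 0"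
proof
  let ?S = "skyburst n \<omega>"
  assume d: "poly (pderiv ?S) z = 0"
  have S0: "?S \<noteq> 0" using coeff_skyburst_top[OF assms(1)] by blast
  have dS0: "pderiv ?S \<noteq> 0"
    using S0 assms(2) by (rule pderiv_nonzero_if_root)
  have o1: "order z ?S = Suc (order z (pderiv ?S))"
    by (rule order_pderiv) (use S0 assms(2) dS0 in \<open>auto simp: order_root\<close>)
  have ddS0: "pderiv (pderiv ?S) \<noteq> 0"
    using dS0 d by (rule pderiv_nonzero_if_root)
  have o2: "order z (pderiv ?S) = Suc (order z (pderiv (pderiv ?S)))"
    by (rule order_pderiv) (use ddS0 dS0 d in \<open>auto simp: order_root\<close>)
  define r where "r = order z (pderiv ?S)"
  have "poly [:0, 1, 1:] z = z * (z + 1)" by (simp add: algebra_simps)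
  then have q0: "poly [:0, 1, 1:] z \<noteq> 0" using assms(3,4) eq_neg_iff_add_eq_0[of z 1] by (simp add: add.commute)
  have o0: "order z [:0, 1, 1:] = 0" using q0 by (simp add: order_0I)
  have "[:-z, 1:] ^ r dvd pderiv ?S" unfolding r_def by (rule order_1)
  moreover have "[:-z, 1:] ^ r dvd ?S"
    using order_1[of z ?S] o1 unfolding r_def by (metis dvd_power_le dvd_refl le_imp_power_dvd dvd_trans le_Suc_eq order_refl)
  ultimately have "[:-z, 1:] ^ r dvd smult (of_real (real n * (\<omega> + 1))) ?S -
     [:of_real (1 + \<omega> - real n), of_real (\<omega> + 2 - real n):] * pderiv ?S"
    by (intro dvd_diff dvd_smult dvd_mult)
  also have "\<dots> = [:0, 1, 1:] * pderiv (pderiv ?S)"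
    using skyburst_ode[OF assms(1), of n] by (simp add: algebra_simps)
  finally have "[:-z, 1:] ^ r dvd [:0, 1, 1:] * pderiv (pderiv ?S)" .
  moreover have ne: "[:0, 1, 1:] * pderiv (pderiv ?S) \<noteq> 0" using ddS0 q0 by (metis mult_eq_0_iff poly_0)
  ultimately have "r \<le> order z ([:0, 1, 1:] * pderiv (pderiv ?S))"
    by (metis order_divides)
  also have "\<dots> = order z (pderiv (pderiv ?S))"
    using o0 by (subst order_mult[OF ne]) simp
  finally show False using o2 by (simp add: r_def)
qed

subsection \<open>Taylor remainders of the generating function\<close>

unbundle fps_syntax and no vec_syntax

lemma fps_mult_pos_nth:
  fixes f g :: "real fps"
  assumes "\<And>i. f $ i \<ge> 0" "f $ 0 > 0" "\<And>i. g $ i > 0"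
  shows "(f * g) $ i > 0"
proof -
  have "(f * g) $ i = f $ 0 * g $ i + (\<Sum>j=1..i. f $ j * g $ (i - j))"
    unfolding fps_mult_nth by (simp add: sum.atLeast_Suc_atMost)
  moreover have "(\<Sum>j=1..i. f $ j * g $ (i - j)) \<ge> 0"
    by (intro sum_nonneg mult_nonneg_nonneg) (use assms(1) assms(3) in \<open>auto simp: less_imp_le\<close>)
  moreover have "f $ 0 * g $ i > 0" using assms(2,3) by simp
  ultimately show ?thesis by linarith
qed

lemma fps_mult_nonneg_nth:
  fixes f g :: "real fps"
  assumes "\<And>i. f $ i \<ge> 0" "\<And>i. g $ i \<ge> 0"
  shows "(f * g) $ i \<ge> 0"
  unfolding fps_mult_nth using assms by (intro sum_nonneg) auto

lemma fps_power_nonneg_nth: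
  fixes f :: "real fps"
  assumes "\<And>i. f $ i \<ge> 0"
  shows "(f ^ r) $ i \<ge> 0"
  using assms by (induction r arbitrary: i) (auto simp: fps_one_nth intro: fps_mult_nonneg_nth)

definition geo_fps :: "real fps" where "geo_fps = Abs_fps (\<lambda>_. 1)"

lemma geo_fps_inverse: "(1 - fps_X) * geo_fps = 1"
proof (rule fps_ext)
  fix i
  show "((1 - fps_X) * geo_fps) $ i = 1 $ i"
    by (cases i) (simp_all add: geo_fps_def left_diff_distrib fps_X_mult_nth)
qed

lemma fps_deriv_geo_fps: "fps_deriv geo_fps = geo_fps * geo_fps"
proof -
  have "fps_deriv ((1 - fps_X) * geo_fps) = 0" by (simp only: geo_fps_inverse fps_deriv_1)
  then have "(1 - fps_X) * fps_deriv geo_fps = geo_fps" by simp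
  then have "geo_fps * ((1 - fps_X) * fps_deriv geo_fps) = geo_fps * geo_fps" by simp
  then show ?thesis using geo_fps_inverse by (metis mult.assoc mult.commute mult_1)
qed

text \<open>The power series of \<open>(x + y) ^ n / (1 - y) ^ (n + 1)\<close> in \<open>y\<close>; its coefficient at \<open>y ^ i\<close> is
  the value of \<open>sky_num n i x\<close>.\<close>

definition sky_fps :: "nat \<Rightarrow> real \<Rightarrow> real fps" where
  "sky_fps n x = (fps_const x + fps_X) ^ n * geo_fps ^ Suc n"

lemma sky_fps_eq: "sky_fps n x * (1 - fps_X) ^ Suc n = (fps_const x + fps_X) ^ n"
proof -
  have "sky_fps n x * (1 - fps_X) ^ Suc n = (fps_const x + fps_X) ^ n * ((1 - fps_X) * geo_fps) ^ Suc n"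
    unfolding sky_fps_def power_mult_distrib by (simp only: mult_ac)
  then show ?thesis by (simp add: geo_fps_inverse)
qed

lemma linear_fps_pow_nonneg:
  assumes "x > 0"
  shows "((fps_const x + fps_X) ^ n) $ i \<ge> (0::real)"
  by (rule fps_power_nonneg_nth) (use assms in \<open>auto simp: fps_X_def\<close>)

lemma sky_fps_pos:
  assumes "x > 0"
  shows "sky_fps n x $ i > 0"
proof -
  have "sky_fps n x = ((fps_const x + fps_X) ^ n * geo_fps ^ n) * geo_fps"
    by (simp add: sky_fps_def mult_ac)
  also have "\<dots> $ i > 0"
  proof (rule fps_mult_pos_nth)
    show "((fps_const x + fps_X) ^ n * geo_fps ^ n) $ i \<ge> 0" for i
      by (intro fps_mult_nonneg_nth linear_fps_pow_nonneg fps_power_nonneg_nth assms) (simp add: geo_fps_def)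
    show "((fps_const x + fps_X) ^ n * geo_fps ^ n) $ 0 > 0"
      using assms by (simp add: fps_power_zeroth geo_fps_def)
  qed (simp add: geo_fps_def)
  finally show ?thesis .
qed

text \<open>Multiplying by \<open>1 - y\<close> takes differences of coefficients and cancels one of
  the \<open>n + 1\<close> geometric factors; as \<open>n > 0\<close>, another one remains to keep
  the coefficients positive.\<close>

lemma sky_fps_increasing:
  assumes "x > 0" "n > 0"
  shows "sky_fps n x $ i < sky_fps n x $ Suc i"
proof -
  obtain r where r: "n = Suc r" using assms(2) by (cases n) auto
  have "(1 - fps_X) * sky_fps n x = (fps_const x + fps_X) ^ n * geo_fps ^ n * ((1 - fps_X) * geo_fps)"
    by (simp only: sky_fps_def power_Suc mult_ac)
  also have "\<dots> = ((fps_const x + fps_X) ^ n * geo_fps ^ r) * geo_fps"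
    unfolding geo_fps_inverse by (simp add: r mult_ac)
  also have "\<dots> $ Suc i > 0"
  proof (rule fps_mult_pos_nth)
    show "((fps_const x + fps_X) ^ n * geo_fps ^ r) $ i \<ge> 0" for i
      by (intro fps_mult_nonneg_nth linear_fps_pow_nonneg fps_power_nonneg_nth assms) (simp add: geo_fps_def)
    show "((fps_const x + fps_X) ^ n * geo_fps ^ r) $ 0 > 0"
      using assms by (simp add: fps_power_zeroth geo_fps_def)
  qed (simp add: geo_fps_def)
  finally show ?thesis by (simp add: left_diff_distrib fps_X_mult_nth)
qed

text \<open>The logarithmic derivative is \<open>n / (x + y) + (n + 1) / (1 - y)\<close>; here the
  denominators are cleared.\<close>

lemma sky_fps_ode:
  "(fps_const x + fps_X) * (1 - fps_X) * fps_deriv (sky_fps n x) =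
   (of_nat n * (1 - fps_X) + of_nat (Suc n) * (fps_const x + fps_X)) * sky_fps n x"
proof -
  define L where "L = fps_const x + fps_X"
  define D where "D = (1 - fps_X :: real fps)"
  have DG: "D * geo_fps = 1" unfolding D_def by (rule geo_fps_inverse)
  have dL: "fps_deriv L = 1" by (simp add: L_def)
  have LL: "L * fps_deriv (L ^ n) = of_nat n * L ^ n"
  proof (cases n)
    case (Suc r)
    have "fps_deriv (L ^ n) = of_nat n * L ^ r"
      unfolding fps_deriv_power' dL by (simp add: Suc del: of_nat_Suc)
    then show ?thesis unfolding Suc by (simp only: power_Suc mult_ac)
  qed simp
  have GG: "D * fps_deriv (geo_fps ^ Suc n) = of_nat (Suc n) * geo_fps ^ Suc n"
  proof -
    have "D * fps_deriv (geo_fps ^ Suc n) = of_nat (Suc n) * geo_fps ^ n * geo_fps * (D * geo_fps)"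
      unfolding fps_deriv_power' fps_deriv_geo_fps by (simp only: diff_Suc_1 mult_ac)
    then show ?thesis unfolding DG by (simp add: mult_ac)
  qed
  have "L * D * fps_deriv (L ^ n * geo_fps ^ Suc n) =
     (L * fps_deriv (L ^ n)) * D * geo_fps ^ Suc n + L * L ^ n * (D * fps_deriv (geo_fps ^ Suc n))"
    unfolding fps_deriv_mult by algebra
  also have "\<dots> = (of_nat n * D + of_nat (Suc n) * L) * (L ^ n * geo_fps ^ Suc n)"
    unfolding LL GG by algebra
  finally show ?thesis unfolding sky_fps_def L_def[symmetric] D_def[symmetric] .
qed

lemma sky_fps_rec:
  "x * real (i + 2) * sky_fps n x $ (i + 2) + (1 - x) * real (i + 1) * sky_fps n x $ (i + 1)
     - real i * sky_fps n x $ i =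
   (real n + real (Suc n) * x) * sky_fps n x $ (i + 1) + sky_fps n x $ i"
  "x * sky_fps n x $ 1 = (real n + real (Suc n) * x) * sky_fps n x $ 0"
proof -
  let ?G = "sky_fps n x"
  have l: "(fps_const x + fps_X) * (1 - fps_X) * fps_deriv ?G =
     fps_const x * fps_deriv ?G + fps_const (1 - x) * (fps_X * fps_deriv ?G) - fps_X * (fps_X * fps_deriv ?G)"
  proof -
    have "fps_const (1 - x) = 1 - fps_const x" by (metis fps_const_1_eq_1 fps_const_sub)
    then show ?thesis by algebra
  qed
  have r: "(of_nat n * (1 - fps_X) + of_nat (Suc n) * (fps_const x + fps_X)) * ?G =
     fps_const (real n + real (Suc n) * x) * ?G + fps_X * ?G"
  proof -
    have "fps_const (real n + real (Suc n) * x) = of_nat n + of_nat (Suc n) * fps_const x"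
      by (simp only: fps_of_nat[symmetric] fps_const_add fps_const_mult)
    moreover have "of_nat (Suc n) = 1 + (of_nat n :: real fps)" by simp
    ultimately show ?thesis by algebra
  qed
  have e: "(fps_const x * fps_deriv ?G + fps_const (1 - x) * (fps_X * fps_deriv ?G) - fps_X * (fps_X * fps_deriv ?G)) $ k
     = (fps_const (real n + real (Suc n) * x) * ?G + fps_X * ?G) $ k" for k
    using sky_fps_ode[of x n] unfolding l r by simp
  show "x * real (i + 2) * ?G $ (i + 2) + (1 - x) * real (i + 1) * ?G $ (i + 1)
     - real i * ?G $ i =
   (real n + real (Suc n) * x) * ?G $ (i + 1) + ?G $ i"
    using e[of "Suc i"] by (cases i) (simp_all add: fps_X_mult_nth)
  show "x * sky_fps n x $ 1 = (real n + real (Suc n) * x) * sky_fps n x $ 0"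
    using e[of 0] by (simp add: fps_X_mult_nth)
qed

definition sky_trunc :: "nat \<Rightarrow> real \<Rightarrow> nat \<Rightarrow> real poly" where
  "sky_trunc n x m = (\<Sum>i<m. monom (sky_fps n x $ i) i)"

lemma coeff_sky_trunc: "coeff (sky_trunc n x m) i = (if i < m then sky_fps n x $ i else 0)"
  unfolding sky_trunc_def by (simp add: coeff_sum)

text \<open>The truncation satisfies the differential equation of the power series up to the two terms
  next to the cut.\<close>

lemma sky_trunc_ode:
  "[:x, 1:] * [:1, -1:] * pderiv (sky_trunc n x (Suc p)) -
     [:real n + real (Suc n) * x, 1:] * sky_trunc n x (Suc p) =
   - smult (real (Suc p)) (monom (x * sky_fps n x $ Suc p) p + monom (sky_fps n x $ p) (Suc p))"
proof (rule poly_eqI)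
  fix k
  let ?g = "\<lambda>i. sky_fps n x $ i"
  let ?T = "sky_trunc n x (Suc p)"
  have m: "[:x, 1:] * [:1, -1:] = [:x, 1 - x, -1:]" by simp
  show "coeff ([:x, 1:] * [:1, -1:] * pderiv ?T - [:real n + real (Suc n) * x, 1:] * ?T) k =
   coeff (- smult (real (Suc p)) (monom (x * ?g (Suc p)) p + monom (?g p) (Suc p))) k"
  proof (cases k)
    case 0
    then show ?thesis unfolding m using sky_fps_rec(2)[of x n]
      by (auto simp: coeff_pderiv coeff_sky_trunc)
  next
    case (Suc i)
    have c: "coeff ([:x, 1 - x, -1:] * pderiv ?T) k = x * real (i + 2) * coeff ?T (i + 2) +
        (1 - x) * real (i + 1) * coeff ?T (i + 1) - real i * coeff ?T i"
      unfolding Suc by (cases i) (simp_all add: coeff_pderiv)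
    have d: "coeff ([:real n + real (Suc n) * x, 1:] * ?T) k =
        (real n + real (Suc n) * x) * coeff ?T (i + 1) + coeff ?T i"
      unfolding Suc by simp
    \<comment> \<open>Row \<open>i + 1\<close> of the recurrence involves the coefficients with
      indices \<open>i\<close>, \<open>i + 1\<close>, \<open>i + 2\<close>; those above
      \<open>p\<close> have been cut off, so only the rows near the cut leave an error.\<close>
    consider "i + 2 \<le> p" | "i + 1 = p" | "i = p" | "i > p" by linarith
    then show ?thesis
    proof cases
      case 1
      then show ?thesis unfolding m coeff_diff c d
        using sky_fps_rec(1)[of x i n] Suc by (simp add: coeff_sky_trunc)
    next
      case 2
      then show ?thesis unfolding m coeff_diff c d
        using sky_fps_rec(1)[of x i n] Suc by (simp add: coeff_sky_trunc algebra_simps)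
    next
      case 3
      then show ?thesis unfolding m coeff_diff c d
        using Suc by (simp add: coeff_sky_trunc algebra_simps)
    next
      case 4
      then show ?thesis unfolding m coeff_diff c d
        using Suc by (simp add: coeff_sky_trunc)
    qed
  qed
qed

text \<open>\<open>monom 1 m * N\<close> is the Taylor remainder multiplied by
  \<open>(1 - y) ^ (n + 1)\<close>. The lowest coefficient of \<open>N\<close> is the first omitted
  Taylor coefficient; for \<open>m > 0\<close> the highest comes from the leading term of the
  truncation alone. They fix the sign of the remainder near 0 and near infinity.\<close>

lemma sky_remainder_exists:
  "\<exists>N. [:x, 1:] ^ n - sky_trunc n x m * [:1, -1:] ^ Suc n = monom 1 m * N \<and>
     coeff N 0 = (sky_fps n x) $ m \<and> degree N \<le> n \<and>
     (m > 0 \<longrightarrow> coeff N n = (-1) ^ n * sky_fps n x $ (m - 1))"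
proof -
  let ?T = "sky_trunc n x m"
  let ?P = "[:x, 1:] ^ n - ?T * [:1, -1:] ^ Suc n"
  define R where "R = sky_fps n x - fps_of_poly ?T"
  have R: "R $ i = (if i < m then 0 else sky_fps n x $ i)" for i
    by (simp add: R_def coeff_sky_trunc)
  have "fps_of_poly ?P = (fps_const x + fps_X) ^ n - fps_of_poly ?T * (1 - fps_X) ^ Suc n"
    by (simp add: fps_of_poly_diff fps_of_poly_mult fps_of_poly_power fps_of_poly_pCons del: power_Suc)
  also have "\<dots> = R * (1 - fps_X) ^ Suc n"
    unfolding R_def left_diff_distrib sky_fps_eq ..
  finally have P: "coeff ?P i = (R * (1 - fps_X) ^ Suc n) $ i" for i
    by (metis fps_of_poly_nth)
  have low: "coeff ?P i = 0" if "i < m" for i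
    unfolding P fps_mult_nth using that by (intro sum.neutral) (auto simp: R)
  then have "monom 1 m dvd ?P" by (simp add: monom_1_dvd_iff')
  then obtain N where N: "?P = monom 1 m * N" by blast
  have cN: "coeff N i = coeff ?P (m + i)" for i unfolding N by (simp add: coeff_monom_mult)
  have "coeff N 0 = (\<Sum>i=0..m. if i = m then sky_fps n x $ m * ((1 - fps_X) ^ Suc n) $ (m - i) else 0)"
    unfolding cN P fps_mult_nth by (intro sum.cong) (auto simp: R)
  then have N0: "coeff N 0 = sky_fps n x $ m" by (simp add: fps_power_zeroth)
  have dT: "degree ?T \<le> m - 1" by (rule degree_le) (auto simp: coeff_sky_trunc)
  have dl: "degree ([:1, -1:] ^ Suc n :: real poly) = Suc n" by (rule degree_linear_power_neg)
  have d2: "degree (?T * [:1, -1:] ^ Suc n) \<le> m + n"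
  proof (cases m)
    case 0
    then show ?thesis by (simp add: sky_trunc_def)
  next
    case (Suc q)
    have "degree (?T * [:1, -1:] ^ Suc n) \<le> degree ?T + degree ([:1, -1:] ^ Suc n :: real poly)"
      by (rule degree_mult_le)
    then show ?thesis using dT dl Suc by linarith
  qed
  have dN: "degree N \<le> n"
  proof (rule degree_le, intro allI impI)
    fix i assume "n < i"
    have "degree ?P \<le> m + n" using d2 degree_linear_power[of x n] by (intro degree_diff_le) auto
    then show "coeff N i = 0" unfolding cN using \<open>n < i\<close> by (intro coeff_eq_0) auto
  qed
  have "coeff N n = (-1) ^ n * sky_fps n x $ (m - 1)" if "m > 0"
  proof -
    have 1: "coeff ([:x, 1:] ^ n) (m + n) = 0"
      using degree_linear_power[of x n] that by (intro coeff_eq_0) auto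
    have "coeff (?T * [:1, -1:] ^ Suc n) ((m - 1) + Suc n) = coeff ?T (m - 1) * coeff ([:1, -1:] ^ Suc n) (Suc n)"
    proof -
      have "coeff (?T * [:1, -1:] ^ Suc n) ((m - 1) + Suc n) =
        (\<Sum>i\<le>(m - 1) + Suc n. coeff ?T i * coeff ([:1, -1:] ^ Suc n) ((m - 1) + Suc n - i))"
        by (rule coeff_mult)
      also have "\<dots> = (\<Sum>i\<le>(m - 1) + Suc n. if i = m - 1 then coeff ?T (m - 1) * coeff ([:1, -1:] ^ Suc n) (Suc n) else 0)"
      proof (rule sum.cong[OF refl])
        fix i
        have "coeff ?T i * coeff ([:1, -1:] ^ Suc n) ((m - 1) + Suc n - i) = 0" if "i \<noteq> m - 1"
        proof (cases "i < m - 1")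
          case True
          then have "coeff ([:1, -1:] ^ Suc n :: real poly) ((m - 1) + Suc n - i) = 0"
            using dl by (intro coeff_eq_0) linarith
          then show ?thesis by simp
        next
          case False
          then show ?thesis using that by (simp add: coeff_sky_trunc)
        qed
        then show "coeff ?T i * coeff ([:1, -1:] ^ Suc n) ((m - 1) + Suc n - i) = (if i = m - 1 then coeff ?T (m - 1) * coeff ([:1, -1:] ^ Suc n) (Suc n) else 0)"
          by auto
      qed
      finally show ?thesis by simp
    qed
    also have "\<dots> = sky_fps n x $ (m - 1) * (-1) ^ Suc n"
      using that unfolding coeff_linear_power_neg by (simp add: coeff_sky_trunc)
    finally show ?thesis unfolding cN using 1 that by (simp del: power_Suc) simp
  qed
  then show ?thesis using N N0 dN by blast
qed

text \<open>After \<open>y = - v\<close>, \<tau> is the Taylor polynomial of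
  \<open>f v = (v - x) ^ n / (1 + v) ^ (n + 1)\<close>, and the left side of the second claim is, up
  to a known factor, the derivative of \<open>\<tau> / f\<close>. For odd \<open>n + m\<close> the
  signs of the two error monomials combine to \<open>v ^ (m - 1)\<close> times a linear
  function.\<close>

lemma sky_trunc_ratio_deriv:
  fixes x :: real and n m :: nat
  defines "\<tau> \<equiv> \<lambda>v. (-1) ^ n * poly (sky_trunc n x m) (- v)"
  assumes "m > 0" "odd (n + m)"
  shows "(\<tau> has_real_derivative - ((-1) ^ n * poly (pderiv (sky_trunc n x m)) (- v))) (at v)"
    and "(v - x) * (1 + v) * (- ((-1) ^ n * poly (pderiv (sky_trunc n x m)) (- v))) +
       (real (Suc n) * (v - x) - real n * (1 + v)) * \<tau> v =
      real m * v ^ (m - 1) * (sky_fps n x $ (m - 1) * v - x * sky_fps n x $ m)"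
proof -
  let ?T = "sky_trunc n x m"
  show "(\<tau> has_real_derivative - ((-1) ^ n * poly (pderiv ?T) (- v))) (at v)"
    unfolding \<tau>_def by (auto intro!: derivative_eq_intros DERIV_chain'[OF _ poly_DERIV] simp: algebra_simps)
  obtain p where m: "m = Suc p" using assms(2) by (cases m) auto
  have sgn: "(-1::real) ^ n = (-1) ^ p"
    using assms(3) by (auto simp: m minus_one_power_iff)
  have "poly ([:x, 1:] * [:1, -1:] * pderiv ?T - [:real n + real (Suc n) * x, 1:] * ?T) (- v) =
     - (real m * (x * sky_fps n x $ m * (- v) ^ p + sky_fps n x $ p * (- v) ^ m))"
    unfolding m sky_trunc_ode by (simp add: poly_monom del: of_nat_Suc)
  then have "(x - v) * (1 + v) * poly (pderiv ?T) (- v) - (real n + real (Suc n) * x - v) * poly ?T (- v) =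
     - (real m * (x * sky_fps n x $ m * (- v) ^ p + sky_fps n x $ p * (- v) ^ m))"
    by (simp add: algebra_simps del: of_nat_Suc)
  then have "(-1) ^ n * ((x - v) * (1 + v) * poly (pderiv ?T) (- v) - (real n + real (Suc n) * x - v) * poly ?T (- v)) =
     - (real m * ((-1) ^ n * (x * sky_fps n x $ m * (- v) ^ p + sky_fps n x $ p * (- v) ^ m)))"
    by (metis mult.left_commute mult_minus_right)
  also have "(-1) ^ n * (x * sky_fps n x $ m * (- v) ^ p + sky_fps n x $ p * (- v) ^ m) =
     v ^ p * (x * sky_fps n x $ m - sky_fps n x $ p * v)"
  proof -
    have "(- v) ^ p = (-1) ^ n * v ^ p" "(- v) ^ m = - ((-1) ^ n * v ^ p * v)"
      by (simp_all add: sgn m power_minus[of v])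
    moreover have "(-1::real) ^ n * (-1) ^ n = 1" by (simp flip: power_mult_distrib)
    moreover have "e * (a * (e * y) + b * - (e * y * v)) = e * e * (y * (a - b * v))" for e a b y :: real
      by (simp add: algebra_simps)
    ultimately show ?thesis by (metis mult_1)
  qed
  finally have e: "(-1) ^ n * ((x - v) * (1 + v) * poly (pderiv ?T) (- v) - (real n + real (Suc n) * x - v) * poly ?T (- v)) =
     - (real m * (v ^ p * (x * sky_fps n x $ m - sky_fps n x $ p * v)))" .
  have S: "real (Suc n) = 1 + real n" by simp
  show "(v - x) * (1 + v) * (- ((-1) ^ n * poly (pderiv ?T) (- v))) +
       (real (Suc n) * (v - x) - real n * (1 + v)) * \<tau> v =
      real m * v ^ (m - 1) * (sky_fps n x $ (m - 1) * v - x * sky_fps n x $ m)"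
  proof -
    have h: "(v - x) * (1 + v) * (- (s * P)) + (real (Suc n) * (v - x) - real n * (1 + v)) * (s * T) =
      s * ((x - v) * (1 + v) * P - (real n + real (Suc n) * x - v) * T)" for s P T
      unfolding S by (simp add: algebra_simps)
    show ?thesis unfolding \<tau>_def h e by (simp add: m algebra_simps del: of_nat_Suc)
  qed
qed

lemma has_deriv_ratio:
  fixes x :: real
  assumes "(\<tau> has_real_derivative d) (at v)" "v \<noteq> x"
  shows "((\<lambda>v. \<tau> v * (1 + v) ^ Suc n / (v - x) ^ n) has_real_derivative
     (1 + v) ^ n / (v - x) ^ Suc n * ((v - x) * (1 + v) * d + (real (Suc n) * (v - x) - real n * (1 + v)) * \<tau> v)) (at v)"
proof -
  have nz: "(v - x) ^ n \<noteq> 0" "v - x \<noteq> 0" using assms(2) by auto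
  have d1: "((\<lambda>v. (v - x) ^ n) has_real_derivative (real n * (v - x) ^ (n - 1))) (at v)"
    by (auto intro!: derivative_eq_intros)
  have d2: "((\<lambda>v. (1 + v) ^ Suc n) has_real_derivative (real (Suc n) * (1 + v) ^ n)) (at v)"
    by (rule DERIV_cong[OF DERIV_power[of _ 1]]) (auto intro!: derivative_eq_intros)
  have n1: "real n * (v - x) ^ (n - 1) = real n * (v - x) ^ n / (v - x)"
    using nz by (cases n) auto
  have "((\<lambda>v. \<tau> v * (1 + v) ^ Suc n / (v - x) ^ n) has_real_derivative
     (((d * (1 + v) ^ Suc n + real (Suc n) * (1 + v) ^ n * \<tau> v) * (v - x) ^ n -
       (\<tau> v * (1 + v) ^ Suc n) * (real n * (v - x) ^ (n - 1))) / ((v - x) ^ n * (v - x) ^ n))) (at v)"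
    by (rule DERIV_divide[OF DERIV_mult[OF assms(1) d2] d1 nz(1)])
  also have "(((d * (1 + v) ^ Suc n + real (Suc n) * (1 + v) ^ n * \<tau> v) * (v - x) ^ n -
       (\<tau> v * (1 + v) ^ Suc n) * (real n * (v - x) ^ (n - 1))) / ((v - x) ^ n * (v - x) ^ n)) =
    (1 + v) ^ n / (v - x) ^ Suc n * ((v - x) * (1 + v) * d + (real (Suc n) * (v - x) - real n * (1 + v)) * \<tau> v)"
    unfolding n1 using nz by (simp add: divide_simps del: of_nat_Suc) (simp add: algebra_simps)
  finally show ?thesis .
qed

text \<open>With \<open>(x - v) ^ n\<close> the denominator is positive to the left of
  \<open>x\<close>, so that the sign of the derivative does not depend on the parity of
  \<open>n\<close>.\<close>

lemma has_deriv_ratio_left: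
  fixes x :: real
  assumes "(\<tau> has_real_derivative d) (at v)" "v < x"
  shows "((\<lambda>v. \<tau> v * (1 + v) ^ Suc n / (x - v) ^ n) has_real_derivative
     - ((1 + v) ^ n / (x - v) ^ Suc n * ((v - x) * (1 + v) * d + (real (Suc n) * (v - x) - real n * (1 + v)) * \<tau> v))) (at v)"
proof -
  have p: "(x - u) ^ l = (-1) ^ l * (u - x) ^ l" for u l by (metis minus_diff_eq power_minus)
  have q: "(-1) ^ n * (y / z) = y / ((-1) ^ n * z)" "(-1) ^ n * (y / z * u) = - (y / ((-1) ^ Suc n * z) * u)"
    for y z u :: real
    by (auto simp: minus_one_power_iff)
  show ?thesis
    using DERIV_cmult[OF has_deriv_ratio[OF assms(1)], of x "(-1) ^ n" n] assms(2) unfolding p q by simp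
qed

text \<open>For \<open>v > 0\<close>, \<open>- poly N (- v)\<close> has the sign of
  \<open>f - \<tau>\<close>, which is negative to the left of \<open>x\<close>. To the right,
  \<open>f > 0\<close> and positivity means \<open>\<tau> / f < 1\<close>. This quotient decreases
  up to \<open>v = x * g m / g (m - 1)\<close>, a point beyond \<open>x\<close>, and increases
  afterwards, so its strict sublevel set is an interval.\<close>

lemma sky_remainder_quasiconvex:
  fixes x :: real
  assumes x: "x > 0" and m: "m > 0" and n: "n > 0" and odd: "odd (n + m)"
    and N: "[:x, 1:] ^ n - sky_trunc n x m * [:1, -1:] ^ Suc n = monom 1 m * N"
    and abc: "0 < a" "a < b" "b < c" "- poly N (- a) > 0" "- poly N (- c) > 0"
  shows "- poly N (- b) > 0"
proof -
  define g where "g = (\<lambda>i. sky_fps n x $ i)"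
  define \<tau> where "\<tau> = (\<lambda>v. (-1) ^ n * poly (sky_trunc n x m) (- v))"
  define \<tau>' where "\<tau>' = (\<lambda>v. - ((-1) ^ n * poly (pderiv (sky_trunc n x m)) (- v)))"
  have d\<tau>: "(\<tau> has_real_derivative \<tau>' v) (at v)" for v
    unfolding \<tau>_def \<tau>'_def by (rule sky_trunc_ratio_deriv(1)[OF m odd])
  have W: "(v - x) * (1 + v) * \<tau>' v + (real (Suc n) * (v - x) - real n * (1 + v)) * \<tau> v =
      real m * v ^ (m - 1) * (g (m - 1) * v - x * g m)" for v
    unfolding \<tau>_def \<tau>'_def g_def by (rule sky_trunc_ratio_deriv(2)[OF m odd])
  have gpos: "g i > 0" for i unfolding g_def using x by (rule sky_fps_pos)
  have ginc: "g (m - 1) < g m"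
    unfolding g_def using sky_fps_increasing[OF x n, of "m - 1"] m by simp
  \<comment> \<open>The normalisation \<open>(-1) ^ n\<close> and the power \<open>(- v) ^ m\<close>
    together contribute \<open>(-1) ^ (n + m) = -1\<close>.\<close>
  have U: "(v - x) ^ n - \<tau> v * (1 + v) ^ Suc n = v ^ m * (- poly N (- v))" for v
  proof -
    have "poly ([:x, 1:] ^ n - sky_trunc n x m * [:1, -1:] ^ Suc n) (- v) = (- v) ^ m * poly N (- v)"
      unfolding N by (simp add: poly_monom)
    then have "(x - v) ^ n - poly (sky_trunc n x m) (- v) * (1 + v) ^ Suc n = (- v) ^ m * poly N (- v)"
      by (simp add: poly_power del: power_Suc)
    then have "(-1) ^ n * ((x - v) ^ n - poly (sky_trunc n x m) (- v) * (1 + v) ^ Suc n) =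
      (-1) ^ n * ((-1) ^ m * v ^ m * poly N (- v))"
      by (simp only: power_minus[of v m])
    moreover have "(v - x) ^ n = (-1) ^ n * (x - v) ^ n"
      by (metis minus_diff_eq power_minus)
    moreover have "(-1) ^ n * ((-1) ^ m * v ^ m * poly N (- v)) = v ^ m * (- poly N (- v))"
    proof -
      have "(-1::real) ^ n * (-1) ^ m = -1" using odd by (simp flip: power_add)
      then have "(-1) ^ n * ((-1) ^ m * (v ^ m * poly N (- v))) = - (v ^ m * poly N (- v))"
        by (metis mult.assoc mult_minus1)
      then show ?thesis by (simp add: mult.assoc)
    qed
    ultimately show ?thesis unfolding \<tau>_def by (simp only: right_diff_distrib mult.assoc)
  qed
  \<comment> \<open>At 0 the quotient is \<open>(-1) ^ n\<close>, since
    \<open>\<tau> 0 = (-1) ^ n * x ^ n\<close>; it increases because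
    \<open>g (m - 1) * v < x * g m\<close> for \<open>v < x\<close>.\<close>
  have neg_left: "- poly N (- v) < 0" if v: "0 < v" "v < x" for v
  proof -
    let ?r = "\<lambda>v. \<tau> v * (1 + v) ^ Suc n / (x - v) ^ n"
    have "?r 0 < ?r v"
    proof (rule DERIV_pos_imp_increasing_open[OF v(1)])
      fix w assume w: "0 < w" "w < v"
      have "w * g (m - 1) < x * g m"
        using w v ginc gpos[of "m - 1"] x by (intro mult_strict_mono) auto
      then have "real m * w ^ (m - 1) * (g (m - 1) * w - x * g m) < 0"
        using w m by (intro mult_pos_neg mult_pos_pos) (auto simp: mult.commute[of w])
      moreover have "(1 + w) ^ n / (x - w) ^ Suc n > 0"
        using w v by (intro divide_pos_pos zero_less_power) auto
      ultimately have "- ((1 + w) ^ n / (x - w) ^ Suc n * (real m * w ^ (m - 1) * (g (m - 1) * w - x * g m))) > 0"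
        by (simp only: neg_0_less_iff_less mult_pos_neg)
      then show "\<exists>y. (?r has_real_derivative y) (at w) \<and> 0 < y"
        using has_deriv_ratio_left[OF d\<tau>, of w x n] w v unfolding W by auto
    next
      show "continuous_on {0..v} ?r"
        using v d\<tau> by (intro continuous_intros DERIV_continuous_on[of _ \<tau> \<tau>'])
          (auto intro: has_field_derivative_at_within)
    qed
    moreover have "?r 0 = (-1) ^ n"
    proof -
      have "poly (sky_trunc n x m) 0 = x ^ n"
        using m by (simp add: poly_0_coeff_0 coeff_sky_trunc sky_fps_def fps_power_zeroth geo_fps_def)
      then show ?thesis using x by (simp add: \<tau>_def)
    qed
    ultimately have "(-1) ^ n < \<tau> v * (1 + v) ^ Suc n / (x - v) ^ n" by simp
    then have "(-1) ^ n * (x - v) ^ n < \<tau> v * (1 + v) ^ Suc n"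
      using v by (subst (asm) pos_less_divide_eq) simp_all
    moreover have "(v - x) ^ n = (-1) ^ n * (x - v) ^ n"
      by (metis minus_diff_eq power_minus)
    ultimately have "v ^ m * (- poly N (- v)) < 0" using U[of v] by simp
    then show ?thesis using v by (simp add: mult_less_0_iff zero_less_mult_iff)
  qed
  \<comment> \<open>The quotients are useless at \<open>x\<close> itself, so this point is reached
    by continuity.\<close>
  have "- poly N (- x) \<le> 0"
  proof (rule tendsto_upperbound)
    show "((\<lambda>v. - poly N (- v)) \<longlongrightarrow> - poly N (- x)) (at_left x)"
      by (intro tendsto_intros)
    show "\<forall>\<^sub>F v in at_left x. - poly N (- v) \<le> 0"
      using eventually_at_left_real[OF x] by eventually_elim (use neg_left in \<open>auto simp: less_imp_le\<close>)
  qed simp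
  then have ax: "a > x" using neg_left[OF abc(1)] abc(4) by (cases a x rule: linorder_cases) auto
  let ?r = "\<lambda>v. \<tau> v * (1 + v) ^ Suc n / (v - x) ^ n"
  have iff: "- poly N (- v) > 0 \<longleftrightarrow> ?r v < 1" if "v > x" for v
  proof -
    have "- poly N (- v) > 0 \<longleftrightarrow> v ^ m * (- poly N (- v)) > 0" using that x by (simp add: zero_less_mult_iff mult_less_0_iff)
    also have "\<dots> \<longleftrightarrow> ?r v < 1" unfolding U[symmetric] using that by (simp add: divide_less_eq_1 del: power_Suc)
    finally show ?thesis .
  qed
  have der: "(?r has_real_derivative (1 + v) ^ n / (v - x) ^ Suc n * (real m * v ^ (m - 1) * (g (m - 1) * v - x * g m))) (at v)"
    if "v > x" for v
    using has_deriv_ratio[OF d\<tau>, of v x n] that unfolding W by simp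
  have fac: "(1 + v) ^ n / (v - x) ^ Suc n * (real m * v ^ (m - 1)) \<ge> 0" if "v > x" for v
    using that x by (intro mult_nonneg_nonneg divide_nonneg_pos zero_less_power zero_le_power) auto
  \<comment> \<open>If \<open>b\<close> lies before the turning point of the quotient, compare it
    with \<open>a\<close>, otherwise with \<open>c\<close>.\<close>
  have "?r b < 1"
  proof (cases "g (m - 1) * b \<le> x * g m")
    case True
    have "?r b \<le> ?r a"
    proof (rule DERIV_nonpos_imp_nonincreasing[of a b])
      fix v assume v: "a \<le> v" "v \<le> b"
      have "g (m - 1) * v \<le> x * g m" using True v gpos[of "m - 1"]
        by (meson dual_order.trans less_imp_le mult_left_mono)
      then have "(1 + v) ^ n / (v - x) ^ Suc n * (real m * v ^ (m - 1)) * (g (m - 1) * v - x * g m) \<le> 0"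
        using fac[of v] v ax by (intro mult_nonneg_nonpos) auto
      then show "\<exists>y. (?r has_real_derivative y) (at v) \<and> y \<le> 0"
        using der[of v] v ax by (auto simp: mult.assoc simp del: power_Suc)
    qed (use abc in simp)
    also have "?r a < 1" using iff[OF ax] abc by simp
    finally show ?thesis .
  next
    case False
    have "?r b \<le> ?r c"
    proof (rule DERIV_nonneg_imp_nondecreasing[of b c])
      fix v assume v: "b \<le> v" "v \<le> c"
      have "g (m - 1) * b \<le> g (m - 1) * v" using v gpos[of "m - 1"] by simp
      then have "(1 + v) ^ n / (v - x) ^ Suc n * (real m * v ^ (m - 1)) * (g (m - 1) * v - x * g m) \<ge> 0"
        using fac[of v] v ax abc False by (intro mult_nonneg_nonneg) auto
      then show "\<exists>y. (?r has_real_derivative y) (at v) \<and> y \<ge> 0"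
        using der[of v] v ax abc by (auto simp: mult.assoc simp del: power_Suc)
    qed (use abc in simp)
    also have "?r c < 1" using iff[of c] ax abc by simp
    finally show ?thesis .
  qed
  then show ?thesis using iff[of b] ax abc by simp
qed

subsection \<open>At most two parameters per positive zero\<close>

text \<open>Together with \<open>Beta_shift\<close> this says that the Beta value is
  \<open>Gamma \<sigma> * Gamma (1 - \<sigma>) * (-1) ^ j\<close> times the generalised binomial:
  apart from the sign, which \<open>y = - v\<close> absorbs, the factor is the same for all
  \<open>j\<close>.\<close>

lemma gbinomial_pochhammer_split:
  fixes \<sigma> :: real
  assumes "j \<le> n"
  shows "fact n * ((real n - real j - \<sigma>) gchoose n) = (-1) ^ j * (pochhammer \<sigma> j * pochhammer (1 - \<sigma>) (n - j))"
proof -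
  have "fact n * ((real n - real j - \<sigma>) gchoose n) = pochhammer (1 - real j - \<sigma>) (j + (n - j))"
    using assms by (simp add: gbinomial_pochhammer' algebra_simps)
  also have "\<dots> = pochhammer (1 - real j - \<sigma>) j * pochhammer (1 - \<sigma>) (n - j)"
    unfolding pochhammer_product' by simp
  also have "pochhammer (1 - real j - \<sigma>) j = (-1) ^ j * pochhammer \<sigma> j"
    using pochhammer_minus[of "\<sigma> + real j - 1" j] by (simp add: algebra_simps)
  finally show ?thesis by simp
qed

lemma Beta_shift:
  fixes \<sigma> :: real
  assumes "0 < \<sigma>" "\<sigma> < 1" "j \<le> n"
  shows "Beta (\<sigma> + real j) (1 - \<sigma> + real (n - j)) =
    Gamma \<sigma> * Gamma (1 - \<sigma>) / fact n * (pochhammer \<sigma> j * pochhammer (1 - \<sigma>) (n - j))"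
proof -
  have 1: "\<sigma> \<notin> \<int>\<^sub>\<le>\<^sub>0" "1 - \<sigma> \<notin> \<int>\<^sub>\<le>\<^sub>0" using assms by (auto elim!: nonpos_Ints_cases)
  have g: "Gamma \<sigma> \<noteq> 0" "Gamma (1 - \<sigma>) \<noteq> 0" using 1 by (auto simp: Gamma_eq_zero_iff)
  have e: "\<sigma> + real j + (1 - \<sigma> + real (n - j)) = 1 + real n" using assms by simp
  have "Beta (\<sigma> + real j) (1 - \<sigma> + real (n - j)) = Gamma (\<sigma> + real j) * Gamma (1 - \<sigma> + real (n - j)) / fact n"
    unfolding Beta_def e by (simp add: Gamma_fact)
  then show ?thesis
    unfolding pochhammer_Gamma[OF 1(1)] pochhammer_Gamma[OF 1(2)] using g by simp
qed

text \<open>The linear functional \<open>y ^ i \<mapsto> (\<omega> + n - i) gchoose n\<close> kills the multiples of \<open>(1 - y) ^ (n + 1)\<close>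
  and sends \<open>(x + y) ^ n\<close> to \<open>sky_num n \<omega> x\<close>.\<close>

lemma sky_num_remainder:
  fixes x :: real
  assumes N: "[:x, 1:] ^ n - sky_trunc n x m * [:1, -1:] ^ Suc n = monom 1 m * N"
    and deg: "degree N \<le> n"
  shows "sky_num n \<omega> x = (\<Sum>j\<le>n. coeff N j * ((\<omega> + real n - real (m + j)) gchoose n))"
proof -
  define h where "h = (\<lambda>i. (\<omega> + real n - real i) gchoose n)"
  define \<Lambda> where "\<Lambda> = (\<lambda>p. \<Sum>i\<le>n + m + 1. coeff p i * h i)"
  have L_diff: "\<Lambda> (p - q) = \<Lambda> p - \<Lambda> q" for p q
    by (simp add: \<Lambda>_def sum_subtractf left_diff_distrib)
  have L_sum: "\<Lambda> (sum f A) = (\<Sum>a\<in>A. \<Lambda> (f a))" for f and A :: "nat set"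
    unfolding \<Lambda>_def coeff_sum sum_distrib_right by (rule sum.swap)
  have L_mono: "\<Lambda> (monom c k * p) = c * (\<Sum>i\<le>r. coeff p i * h (k + i))"
    if "degree p \<le> r" "r + k \<le> n + m + 1" for c k p r
  proof -
    have "\<Lambda> (monom c k * p) = (\<Sum>i\<le>n + m + 1. if k \<le> i then c * (coeff p (i - k) * h i) else 0)"
      unfolding \<Lambda>_def by (intro sum.cong) (auto simp: coeff_monom_mult)
    also have "\<dots> = (\<Sum>i\<in>{k..n + m + 1}. c * (coeff p (i - k) * h i))"
    proof -
      have "{i \<in> {..n + m + 1}. k \<le> i} = {k..n + m + 1}" by auto
      then show ?thesis by (subst sum.inter_filter[symmetric]) (simp_all del: sum.atMost_Suc sum.cl_ivl_Suc)
    qed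
    also have "\<dots> = (\<Sum>i\<in>{k..k + r}. c * (coeff p (i - k) * h i))"
    proof (rule sum.mono_neutral_right)
      show "\<forall>i\<in>{k..n + m + 1} - {k..k + r}. c * (coeff p (i - k) * h i) = 0"
        using that(1) by (auto intro!: coeff_eq_0)
    qed (use that in auto)
    also have "\<dots> = (\<Sum>i\<le>r. c * (coeff p i * h (k + i)))"
      by (rule sum.reindex_bij_witness[of _ "\<lambda>i. k + i" "\<lambda>i. i - k"]) auto
    finally show ?thesis by (simp add: sum_distrib_left)
  qed
  have "\<Lambda> ([:x, 1:] ^ n) = (\<Sum>i\<le>n. coeff ([:x, 1:] ^ n) i * h i)"
    using L_mono[of "[:x, 1:] ^ n" n 0 1] by (simp add: degree_linear_power)
  also have "\<dots> = (\<Sum>i\<le>n. real (n choose i) * x ^ (n - i) * h i)"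
    by (intro sum.cong) (auto simp: coeff_linear_poly_power)
  also have "\<dots> = (\<Sum>j\<le>n. real (n choose (n - j)) * x ^ (n - (n - j)) * h (n - j))"
    by (rule sum.reindex_bij_witness[of _ "\<lambda>l. n - l" "\<lambda>l. n - l"]) auto
  also have "\<dots> = sky_num n \<omega> x"
    unfolding sky_num_def h_def
    by (intro sum.cong) (auto simp: of_nat_diff binomial_symmetric[symmetric])
  finally have 1: "\<Lambda> ([:x, 1:] ^ n) = sky_num n \<omega> x" .
  \<comment> \<open>The coefficients of \<open>(1 - y) ^ (n + 1)\<close> turn the functional into an
    \<open>(n + 1)\<close>-th difference of a polynomial of degree \<open>n\<close>.\<close>
  have kill: "\<Lambda> (monom c i * [:1, -1:] ^ Suc n) = 0" if "i < m" for c i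
  proof -
    have "\<Lambda> (monom c i * [:1, -1:] ^ Suc n) = c * (\<Sum>l\<le>Suc n. coeff ([:1, -1:] ^ Suc n) l * h (i + l))"
      by (rule L_mono) (use that degree_linear_power_neg[of "1::real" "Suc n"] in auto)
    also have "(\<Sum>l\<le>Suc n. coeff ([:1, -1:] ^ Suc n) l * h (i + l)) = alt_gbinomial_sum (Suc n) (\<omega> + real n - real i) n"
      unfolding alt_gbinomial_sum_def h_def
      by (intro sum.cong) (auto simp: coeff_linear_poly_power algebra_simps simp del: power_Suc)
    finally show ?thesis by (simp add: alt_gbinomial_sum_eq_0)
  qed
  have "\<Lambda> (sky_trunc n x m * [:1, -1:] ^ Suc n) = 0"
    unfolding sky_trunc_def sum_distrib_right L_sum by (intro sum.neutral) (use kill in blast)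
  then have "sky_num n \<omega> x = \<Lambda> (monom 1 m * N)" using 1 L_diff N by (metis diff_zero)
  also have "\<dots> = (\<Sum>j\<le>n. coeff N j * h (m + j))"
    using L_mono[OF deg, of m 1] by simp
  finally show ?thesis by (simp add: h_def)
qed

text \<open>With \<open>v = p / (1 - p)\<close> this is the integral of
  \<open>v powr (m - \<omega> - 1) * poly N (- v) / (1 + v) ^ (n + 1)\<close> over
  \<open>v > 0\<close>. Each monomial gives a Beta value, and the sum is
  \<open>Gamma \<sigma> * Gamma (1 - \<sigma>) * sky_num n \<omega> x\<close> with
  \<open>\<sigma> = m - \<omega>\<close>. The bounds on \<omega> make \<open>\<sigma>\<close> and
  \<open>1 - \<sigma>\<close> positive, as convergence at both ends requires.\<close>

lemma sky_mellin:
  fixes x :: real and \<omega> :: real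
  assumes N: "[:x, 1:] ^ n - sky_trunc n x m * [:1, -1:] ^ Suc n = monom 1 m * N"
    and deg: "degree N \<le> n" and \<omega>: "real m - 1 < \<omega>" "\<omega> < real m" and zero: "sky_num n \<omega> x = 0"
  shows "((\<lambda>p. (1 - p) ^ n / p * (p / (1 - p)) powr (real m - \<omega>) * poly N (- (p / (1 - p)))) has_integral 0) {0<..<1}"
proof -
  define \<sigma> where "\<sigma> = real m - \<omega>"
  have \<sigma>: "0 < \<sigma>" "\<sigma> < 1" using \<omega> by (auto simp: \<sigma>_def)
  let ?f = "\<lambda>p. \<Sum>j\<le>n. ((-1) ^ j * coeff N j) * (p powr (\<sigma> + real j - 1) * (1 - p) powr (1 - \<sigma> + real (n - j) - 1))"
  let ?B = "\<Sum>j\<le>n. ((-1) ^ j * coeff N j) * Beta (\<sigma> + real j) (1 - \<sigma> + real (n - j))"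
  have "(?f has_integral
     ?B) {0..1}"
    by (intro has_integral_sum has_integral_mult_right has_integral_Beta_real) (use \<sigma> in auto)
  moreover have "?B = 0"
  proof -
    have "?B =
      (\<Sum>j\<le>n. (Gamma \<sigma> * Gamma (1 - \<sigma>)) * (coeff N j * ((\<omega> + real n - real (m + j)) gchoose n)))"
    proof (rule sum.cong[OF refl])
      fix j assume "j \<in> {..n}"
      then have j: "j \<le> n" by simp
      have e: "\<omega> + real n - real (m + j) = real n - real j - \<sigma>" by (simp add: \<sigma>_def)
      have f: "((real n - real j - \<sigma>) gchoose n) = (-1) ^ j * (pochhammer \<sigma> j * pochhammer (1 - \<sigma>) (n - j)) / fact n"
        using gbinomial_pochhammer_split[OF j, of \<sigma>] by (simp add: field_simps)
      show "((-1) ^ j * coeff N j) * Beta (\<sigma> + real j) (1 - \<sigma> + real (n - j)) =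
        (Gamma \<sigma> * Gamma (1 - \<sigma>)) * (coeff N j * ((\<omega> + real n - real (m + j)) gchoose n))"
        unfolding Beta_shift[OF \<sigma> j] e f by simp
    qed
    also have "\<dots> = 0" unfolding sum_distrib_left[symmetric] sky_num_remainder[OF N deg, symmetric] zero by simp
    finally show ?thesis .
  qed
  ultimately have "(?f has_integral 0) {0<..<1}"
    by (simp add: has_integral_Icc_iff_Ioo)
  then show ?thesis
  proof (rule has_integral_eq[rotated])
    fix p :: real assume "p \<in> {0<..<1}"
    then have p: "0 < p" "0 < 1 - p" by auto
    have t: "p powr (\<sigma> + real j - 1) * (1 - p) powr (1 - \<sigma> + real (n - j) - 1) =
      (1 - p) ^ n / p * (p / (1 - p)) powr \<sigma> * (p / (1 - p)) ^ j" if "j \<le> n" for j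
    proof -
      have "p powr (\<sigma> + real j - 1) = p powr \<sigma> * p ^ j / p"
        using p by (simp add: powr_diff powr_add powr_realpow)
      moreover have "(1 - p) powr (1 - \<sigma> + real (n - j) - 1) = (1 - p) ^ (n - j) / (1 - p) powr \<sigma>"
        using p by (simp add: powr_diff powr_add powr_realpow)
      moreover have "(1 - p) ^ (n - j) = (1 - p) ^ n / (1 - p) ^ j" using p that by (simp add: power_diff)
      moreover have "(p / (1 - p)) powr \<sigma> = p powr \<sigma> / (1 - p) powr \<sigma>" using p by (simp add: powr_divide)
      ultimately show ?thesis by (simp add: power_divide mult_ac)
    qed
    have "poly N (- (p / (1 - p))) = (\<Sum>j\<le>n. coeff N j * (- (p / (1 - p))) ^ j)"
      unfolding poly_altdef
      by (rule sum.mono_neutral_left) (use deg in \<open>auto intro!: coeff_eq_0\<close>)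
    also have "\<dots> = (\<Sum>j\<le>n. ((-1) ^ j * coeff N j) * (p / (1 - p)) ^ j)"
      by (intro sum.cong refl) (subst power_minus, simp)
    finally have q: "poly N (- (p / (1 - p))) = (\<Sum>j\<le>n. ((-1) ^ j * coeff N j) * (p / (1 - p)) ^ j)" .
    show "?f p =
      (1 - p) ^ n / p * (p / (1 - p)) powr (real m - \<omega>) * poly N (- (p / (1 - p)))"
      unfolding q sum_distrib_left \<sigma>_def[symmetric]
    proof (rule sum.cong[OF refl])
      fix j assume "j \<in> {..n}"
      then have j: "j \<le> n" by simp
      show "((-1) ^ j * coeff N j) * (p powr (\<sigma> + real j - 1) * (1 - p) powr (1 - \<sigma> + real (n - j) - 1)) =
        (1 - p) ^ n / p * (p / (1 - p)) powr \<sigma> * ((-1) ^ j * coeff N j * (p / (1 - p)) ^ j)"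
        unfolding t[OF j] by (simp only: mult_ac)
    qed
  qed
qed

text \<open>The function is strictly convex, here in the form that its derivative increases, so the
  two zeros separate the signs plus, minus, plus. With \<open>t = ln s\<close> the exponentials
  become powers of \<open>s\<close>.\<close>

lemma two_exp_sign:
  fixes a b \<alpha> \<gamma> :: real
  defines "\<phi> \<equiv> \<lambda>t. \<alpha> * exp (a * t) + \<gamma> * exp (- b * t) - 1"
  assumes pos: "a > 0" "b > 0" "\<alpha> > 0" "\<gamma> > 0" and t12: "t1 < t2" and zero: "\<phi> t1 = 0" "\<phi> t2 = 0"
  shows "t < t1 \<Longrightarrow> \<phi> t > 0" "t1 \<le> t \<Longrightarrow> t \<le> t2 \<Longrightarrow> \<phi> t \<le> 0" "t2 < t \<Longrightarrow> \<phi> t > 0"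
proof -
  define \<phi>' where "\<phi>' = (\<lambda>t. \<alpha> * a * exp (a * t) - \<gamma> * b * exp (- b * t))"
  have der: "(\<phi> has_real_derivative \<phi>' t) (at t)" for t
    unfolding \<phi>_def \<phi>'_def by (auto intro!: derivative_eq_intros simp: algebra_simps)
  have inc: "\<phi>' s < \<phi>' t" if "s < t" for s t
  proof -
    have "\<alpha> * a * exp (a * s) < \<alpha> * a * exp (a * t)" using pos that by simp
    moreover have "\<gamma> * b * exp (- b * t) < \<gamma> * b * exp (- b * s)" using pos that by simp
    ultimately show ?thesis unfolding \<phi>'_def by linarith
  qed
  have mvt: "\<exists>z. s < z \<and> z < t \<and> \<phi> t - \<phi> s = (t - s) * \<phi>' z" if "s < t" for s t
    using MVT2[OF that, of \<phi> \<phi>'] der by blast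
  obtain c where c: "t1 < c" "c < t2" "\<phi>' c = 0" using mvt[OF t12] zero t12 by auto
  show "\<phi> t > 0" if t: "t < t1"
  proof -
    obtain z where z: "t < z" "z < t1" "\<phi> t1 - \<phi> t = (t1 - t) * \<phi>' z" using mvt[OF t] by blast
    have "\<phi>' z < 0" using inc[of z c] z c by linarith
    then have "(t1 - t) * \<phi>' z < 0" using t by (intro mult_pos_neg) auto
    then show ?thesis using z zero by linarith
  qed
  show "\<phi> t > 0" if t: "t2 < t"
  proof -
    obtain z where z: "t2 < z" "z < t" "\<phi> t - \<phi> t2 = (t - t2) * \<phi>' z" using mvt[OF t] by blast
    have "\<phi>' z > 0" using inc[of c z] z c by linarith
    then have "(t - t2) * \<phi>' z > 0" using t by (intro mult_pos_pos) auto
    then show ?thesis using z zero by linarith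
  qed
  show "\<phi> t \<le> 0" if t: "t1 \<le> t" "t \<le> t2"
  proof (rule ccontr)
    assume "\<not> \<phi> t \<le> 0"
    then have p: "\<phi> t > 0" "t1 < t" "t < t2" using t zero by (auto simp: less_le)
    obtain z where z: "t1 < z" "z < t" "\<phi> t - \<phi> t1 = (t - t1) * \<phi>' z" using mvt[OF p(2)] by blast
    obtain y where y: "t < y" "y < t2" "\<phi> t2 - \<phi> t = (t2 - t) * \<phi>' y" using mvt[OF p(3)] by blast
    have "(t - t1) * \<phi>' z > 0" using z p zero by simp
    then have "\<phi>' z > 0" using p by (simp add: zero_less_mult_iff)
    have "(t2 - t) * \<phi>' y < 0" using y p zero by simp
    then have "\<phi>' y < 0" using p by (simp add: mult_less_0_iff)
    with \<open>\<phi>' z > 0\<close> inc[of z y] z y show False by linarith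
  qed
qed

text \<open>Cramer's rule: the determinant and both numerators are positive because one exponential
  increases and the other decreases. This is the instance of total positivity that is
  needed.\<close>

lemma two_exp_interpolate:
  fixes a b t1 t2 :: real
  assumes "a > 0" "b > 0" "t1 < t2"
  shows "\<exists>\<alpha> \<gamma>. \<alpha> > 0 \<and> \<gamma> > 0 \<and> \<alpha> * exp (a * t1) + \<gamma> * exp (- b * t1) - 1 = 0 \<and>
     \<alpha> * exp (a * t2) + \<gamma> * exp (- b * t2) - 1 = 0"
proof -
  define A1 A2 B1 B2 where "A1 = exp (a * t1)" and "A2 = exp (a * t2)" and "B1 = exp (- b * t1)" and "B2 = exp (- b * t2)"
  have A: "0 < A1" "A1 < A2" and B: "0 < B2" "B2 < B1"
    using assms by (auto simp: A1_def A2_def B1_def B2_def)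
  define D where "D = A2 * B1 - A1 * B2"
  have "A1 * B2 < A2 * B1" using A B by (intro mult_strict_mono) auto
  then have D: "D > 0" by (simp add: D_def)
  have "(B1 - B2) / D > 0" "(A2 - A1) / D > 0" using A B D by auto
  moreover have "(B1 - B2) / D * A1 + (A2 - A1) / D * B1 - 1 = 0" "(B1 - B2) / D * A2 + (A2 - A1) / D * B2 - 1 = 0"
  proof -
    have e: "X / D * A + Y / D * B = (X * A + Y * B) / D" for X Y A B
      by (simp add: add_divide_distrib)
    have n: "(B1 - B2) * A1 + (A2 - A1) * B1 = D" "(B1 - B2) * A2 + (A2 - A1) * B2 = D"
      by (auto simp: D_def algebra_simps)
    show "(B1 - B2) / D * A1 + (A2 - A1) / D * B1 - 1 = 0" "(B1 - B2) / D * A2 + (A2 - A1) / D * B2 - 1 = 0"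
      unfolding e n using D by simp_all
  qed
  ultimately show ?thesis unfolding A1_def A2_def B1_def B2_def by blast
qed

text \<open>The integrand may be unbounded at 0 and 1, so the argument is moved to a compact
  interval starting at \<open>c\<close>, where a continuous nonnegative function with integral 0
  vanishes.\<close>

lemma has_integral_0_nonpos_contradiction:
  fixes f :: "real \<Rightarrow> real"
  assumes "(f has_integral 0) {0<..<1}" "\<And>p. p \<in> {0<..<1} \<Longrightarrow> f p \<le> 0"
    "continuous_on {0<..<1} f" "0 < c" "c < 1" "f c < 0"
  shows False
proof -
  define d where "d = (1 + c) / 2"
  have d: "c < d" "d < 1" using assms by (auto simp: d_def)
  have sub: "{c..d} \<subseteq> {0<..<1}" using assms d by auto
  have cont: "continuous_on {c..d} (\<lambda>p. - f p)"
    by (intro continuous_intros continuous_on_subset[OF assms(3) sub])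
  have int: "(\<lambda>p. - f p) integrable_on {c..d}" by (rule integrable_continuous_real[OF cont])
  have "integral {c..d} (\<lambda>p. - f p) \<le> integral {0<..<1} (\<lambda>p. - f p)"
    by (rule integral_subset_le[OF sub int]) (use assms in \<open>auto intro: integrable_neg\<close>)
  also have "\<dots> = 0" using integral_unique[OF has_integral_neg[OF assms(1)]] by simp
  finally have le: "integral {c..d} (\<lambda>p. - f p) \<le> 0" .
  moreover have "integral {c..d} (\<lambda>p. - f p) \<ge> 0"
    by (rule integral_nonneg[OF int]) (use assms(2) sub in auto)
  ultimately have "((\<lambda>p. - f p) has_integral 0) (cbox c d)"
    using integrable_integral[OF int] by simp
  then have "- f c = 0"
  proof (rule has_integral_0_cbox_imp_0[rotated 2])
    show "0 \<le> - f p" if "p \<in> box c d" for p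
      using assms(2)[of p] that assms(4) d by auto
  qed (use cont d in auto)
  then show False using assms by simp
qed

lemma poly_neg_near_0:
  fixes p :: "real poly"
  assumes "poly p 0 < 0"
  shows "\<exists>\<delta>>0. \<forall>v. \<bar>v\<bar> < \<delta> \<longrightarrow> poly p v < 0"
proof -
  have "open {v. poly p v < 0}" by (intro open_Collect_less continuous_intros)
  then obtain d where "d > 0" "\<And>v. dist v 0 < d \<Longrightarrow> poly p v < 0"
    using assms unfolding open_dist by blast
  then show ?thesis by auto
qed

text \<open>\<open>v1\<close> and \<open>v2\<close> are the ends of the set of positivity on
  \<open>v > 0\<close>. The value at 0 keeps this set away from 0, the negative top coefficient
  bounds it, and \<open>qc\<close> makes it an interval.\<close>

lemma quasiconvex_poly_sign:
  fixes N :: "real poly"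
  assumes "poly N 0 < 0" "coeff N n < 0" "degree N \<le> n"
    and qc: "\<forall>a b c. 0 < a \<and> a < b \<and> b < c \<and> poly N a > 0 \<and> poly N c > 0 \<longrightarrow> poly N b > 0"
  shows "(\<forall>v>0. poly N v \<le> 0) \<or>
    (\<exists>v1 v2. 0 < v1 \<and> v1 < v2 \<and> (\<forall>v>0. (v < v1 \<longrightarrow> poly N v \<le> 0) \<and> (v1 < v \<and> v < v2 \<longrightarrow> poly N v \<ge> 0) \<and> (v2 < v \<longrightarrow> poly N v \<le> 0)))"
proof (cases "\<forall>v>0. poly N v \<le> 0")
  case False
  define S where "S = {v. v > 0 \<and> poly N v > 0}"
  obtain s where s: "s \<in> S" using False by (auto simp: S_def not_le)
  have bb: "bdd_below S" by (rule bdd_belowI[of _ 0]) (auto simp: S_def)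
  have dn: "degree N = n" using assms(2,3) by (metis le_antisym le_degree order_less_irrefl)
  have ba: "bdd_above S"
  proof -
    obtain M where M: "\<forall>v\<ge>M. poly (- N) v \<ge> lead_coeff (- N)"
      using poly_pinfty_gt_lc[of "- N"] assms(2) dn by auto
    show ?thesis
    proof (rule bdd_aboveI[of _ M])
      fix v assume v: "v \<in> S"
      show "v \<le> M"
      proof (rule ccontr)
        assume "\<not> v \<le> M"
        then have "- poly N v \<ge> - coeff N n" using M dn by auto
        then show False using v assms(2) by (simp add: S_def)
      qed
    qed
  qed
  obtain \<delta> where \<delta>: "\<delta> > 0" "\<And>v. \<bar>v\<bar> < \<delta> \<Longrightarrow> poly N v < 0"
    using poly_neg_near_0[OF assms(1)] by blast
  define v1 v2 where "v1 = Inf S" and "v2 = Sup S"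
  have "v1 \<ge> \<delta>" unfolding v1_def
  proof (rule cInf_greatest)
    show "\<delta> \<le> v" if "v \<in> S" for v using that \<delta>(2)[of v] by (fastforce simp: S_def)
  qed (use s in auto)
  obtain e where e: "e > 0" "\<And>v. \<bar>v - s\<bar> < e \<Longrightarrow> v \<in> S"
  proof -
    have "open S" unfolding S_def
      by (intro open_Collect_conj open_Collect_less continuous_intros)
    then show ?thesis using s that unfolding open_dist dist_real_def by blast
  qed
  have "v1 \<le> s" "s + e / 2 \<le> v2" unfolding v1_def v2_def
    using s e by (auto intro!: cInf_lower cSup_upper bb ba)
  then have v12: "v1 < v2" using e by linarith
  moreover have "\<forall>v>0. (v < v1 \<longrightarrow> poly N v \<le> 0) \<and> (v1 < v \<and> v < v2 \<longrightarrow> poly N v \<ge> 0) \<and> (v2 < v \<longrightarrow> poly N v \<le> 0)"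
  proof (intro allI impI conjI)
    fix v :: real assume v: "v > 0"
    show "poly N v \<le> 0" if "v < v1"
      using that v cInf_lower[OF _ bb, of v] unfolding v1_def by (fastforce simp: S_def)
    show "poly N v \<le> 0" if "v2 < v"
      using that v cSup_upper[OF _ ba, of v] unfolding v2_def by (fastforce simp: S_def)
    assume "v1 < v \<and> v < v2"
    then obtain p q where "p \<in> S" "p < v" "q \<in> S" "v < q"
      unfolding v1_def v2_def using cInf_lessD[of S v] less_cSupD[of S v] s by blast
    then show "poly N v \<ge> 0" using qc[rule_format, of p v q] by (auto simp: S_def)
  qed
  ultimately show ?thesis using \<open>v1 \<ge> \<delta>\<close> \<delta>(1) by (intro disjI2 exI[of _ v1] exI[of _ v2]) auto
qed simp

text \<open>At \<open>p \<in> (0, 1)\<close> put \<open>s = p / (1 - p)\<close>. For a third zero, the combination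
  \<open>\<alpha> s powr (- \<omega>1) - s powr (- \<omega>2) + \<gamma> s powr (- \<omega>3)\<close> can be given the sign changes of the
  remainder, so that its vanishing integral against the remainder has an integrand of one sign.\<close>

lemma sky_num_no_three_zeros:
  fixes x :: real
  assumes x: "x > 0" and mn: "0 < m" "m < n" and odd: "odd (n - m)"
    and \<omega>: "real m - 1 < \<omega>1" "\<omega>1 < \<omega>2" "\<omega>2 < \<omega>3" "\<omega>3 < real m"
    and zero: "sky_num n \<omega>1 x = 0" "sky_num n \<omega>2 x = 0" "sky_num n \<omega>3 x = 0"
  shows False
proof -
  have odd': "odd (n + m)" using odd mn by simp
  obtain N0 where N0: "[:x, 1:] ^ n - sky_trunc n x m * [:1, -1:] ^ Suc n = monom 1 m * N0"
    and N00: "coeff N0 0 = sky_fps n x $ m" and deg: "degree N0 \<le> n"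
    and N0n: "coeff N0 n = (-1) ^ n * sky_fps n x $ (m - 1)"
    using sky_remainder_exists[of x n m] mn by blast
  \<comment> \<open>The remainder in the variable \<open>v = - y\<close>; the outer sign is the
    \<open>(-1) ^ (n + m)\<close> of the odd case.\<close>
  define N where "N = - pcompose N0 [:0, -1:]"
  have poly_N: "poly N v = - poly N0 (- v)" for v by (simp add: N_def poly_pcompose)
  have cN: "coeff N j = - ((-1) ^ j * coeff N0 j)" for j by (simp add: N_def coeff_pcompose_linear)
  have Npos0: "poly N 0 < 0" using N00 sky_fps_pos[OF x, of n m] unfolding poly_0_coeff_0 cN by simp
  have "(-1::real) ^ n * (-1) ^ n = 1" by (simp flip: power_mult_distrib)
  then have Nn: "coeff N n < 0"
    unfolding cN N0n using sky_fps_pos[OF x, of n "m - 1"] by (simp flip: mult.assoc)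
  have degN: "degree N \<le> n" by (rule degree_le) (use deg in \<open>auto simp: cN coeff_eq_0\<close>)
  have qc: "\<forall>a b c. 0 < a \<and> a < b \<and> b < c \<and> poly N a > 0 \<and> poly N c > 0 \<longrightarrow> poly N b > 0"
    using sky_remainder_quasiconvex[OF x mn(1) _ odd' N0] mn unfolding poly_N by auto
  let ?s = "\<lambda>p::real. p / (1 - p)"
  define F where "F = (\<lambda>\<omega> p. (1 - p) ^ n / p * ?s p powr (real m - \<omega>) * poly N (?s p))"
  have int: "(F \<omega> has_integral 0) {0<..<1}" if "real m - 1 < \<omega>" "\<omega> < real m" "sky_num n \<omega> x = 0" for \<omega>
    using has_integral_neg[OF sky_mellin[OF N0 deg that]] by (simp add: F_def poly_N)
  have contF: "continuous_on {0<..<1} (F \<omega>)" for \<omega>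
    unfolding F_def by (intro continuous_intros) auto
  obtain \<delta> where \<delta>: "\<delta> > 0" "\<And>v. \<bar>v\<bar> < \<delta> \<Longrightarrow> poly N v < 0"
    using poly_neg_near_0[OF Npos0] by blast
  from quasiconvex_poly_sign[OF Npos0 Nn degN qc]
  show False
  proof (elim disjE exE conjE)
    assume neg: "\<forall>v>0. poly N v \<le> 0"
    \<comment> \<open>Without a sign change a single zero is already contradictory; \<open>c\<close>
      is the point with \<open>c / (1 - c) = \<delta> / 2\<close>, where \<open>N\<close> is
      strictly negative.\<close>
    define c where "c = \<delta> / (\<delta> + 2)"
    have c: "0 < c" "c < 1" "?s c = \<delta> / 2" using \<delta>(1) by (auto simp: c_def field_simps)
    show False
    proof (rule has_integral_0_nonpos_contradiction[OF int[of \<omega>1] _ contF c(1,2)])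
      show "F \<omega>1 p \<le> 0" if "p \<in> {0<..<1}" for p
        unfolding F_def using that neg by (intro mult_nonneg_nonpos mult_nonneg_nonneg) auto
      have "poly N (?s c) < 0" unfolding c(3) using \<delta>(1) \<delta>(2)[of "\<delta> / 2"] by simp
      then show "F \<omega>1 c < 0" unfolding F_def
        using c(1,2) by (intro mult_pos_neg mult_pos_pos divide_pos_pos zero_less_power) auto
    qed (use \<omega> zero in auto)
  next
    fix v1 v2 assume v: "0 < v1" "v1 < v2" and sgn: "\<forall>v>0. (v < v1 \<longrightarrow> poly N v \<le> 0) \<and> (v1 < v \<and> v < v2 \<longrightarrow> poly N v \<ge> 0) \<and> (v2 < v \<longrightarrow> poly N v \<le> 0)"
    \<comment> \<open>After the factor \<open>s powr (m - \<omega>2)\<close> is taken out, the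
      combination is \<open>\<alpha> * s powr a + \<gamma> * s powr (- b) - 1\<close>, so the
      exponents are the gaps between the parameters.\<close>
    define a b where "a = \<omega>2 - \<omega>1" and "b = \<omega>3 - \<omega>2"
    have ab: "a > 0" "b > 0" using \<omega> by (auto simp: a_def b_def)
    have lv: "ln v1 < ln v2" using v by simp
    obtain \<alpha> \<gamma> where ag: "\<alpha> > 0" "\<gamma> > 0" and z: "\<alpha> * exp (a * ln v1) + \<gamma> * exp (- b * ln v1) - 1 = 0"
      "\<alpha> * exp (a * ln v2) + \<gamma> * exp (- b * ln v2) - 1 = 0"
      using two_exp_interpolate[OF ab lv] by blast
    define h where "h = (\<lambda>v. \<alpha> * exp (a * ln v) + \<gamma> * exp (- b * ln v) - 1)"
    define G where "G = (\<lambda>p. \<alpha> * F \<omega>1 p + \<gamma> * F \<omega>3 p - F \<omega>2 p)"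
    have G: "G p = (1 - p) ^ n / p * ?s p powr (real m - \<omega>2) * (h (?s p) * poly N (?s p))" if "p \<in> {0<..<1}" for p
    proof -
      have s: "?s p > 0" using that by auto
      have "?s p powr (real m - \<omega>1) = ?s p powr (real m - \<omega>2) * exp (a * ln (?s p))"
        "?s p powr (real m - \<omega>3) = ?s p powr (real m - \<omega>2) * exp (- b * ln (?s p))"
        using s that by (auto simp: powr_def a_def b_def algebra_simps simp flip: exp_add)
      then show ?thesis unfolding G_def F_def h_def by (simp add: algebra_simps)
    qed
    have intG: "(G has_integral 0) {0<..<1}"
    proof -
      have "(G has_integral (\<alpha> * 0 + \<gamma> * 0 - 0)) {0<..<1}" unfolding G_def
        by (intro has_integral_diff has_integral_add has_integral_mult_right int) (use \<omega> zero in auto)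
      then show ?thesis by simp
    qed
    have hN: "h s * poly N s \<le> 0" if "s > 0" for s
    proof -
      note T = two_exp_sign[OF ab ag lv z, of "ln s"]
      consider "s < v1" | "s = v1" | "v1 < s" "s < v2" | "s = v2" | "v2 < s" by linarith
      then show ?thesis
      proof cases
        case 1
        then have "h s > 0" "poly N s \<le> 0" using T(1) that v sgn by (auto simp: h_def)
        then show ?thesis by (simp add: mult_le_0_iff)
      next
        case 3
        then have "h s \<le> 0" "poly N s \<ge> 0" using T(2) that v sgn by (auto simp: h_def)
        then show ?thesis by (simp add: mult_le_0_iff)
      next
        case 5
        then have "h s > 0" "poly N s \<le> 0" using T(3) that v sgn by (auto simp: h_def)
        then show ?thesis by (simp add: mult_le_0_iff)
      qed (use z in \<open>auto simp: h_def\<close>)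
    qed
    \<comment> \<open>A point left of \<open>v1\<close> and within \<delta> of 0: there
      \<open>h\<close> is positive and \<open>N\<close> negative, both strictly.\<close>
    define \<epsilon> where "\<epsilon> = min \<delta> v1 / 2"
    have \<epsilon>: "0 < \<epsilon>" "\<epsilon> < \<delta>" "\<epsilon> < v1" using \<delta>(1) v by (auto simp: \<epsilon>_def min_def)
    define c where "c = \<epsilon> / (\<epsilon> + 1)"
    have c: "0 < c" "c < 1" "?s c = \<epsilon>" using \<epsilon>(1) by (auto simp: c_def field_simps)
    show False
    proof (rule has_integral_0_nonpos_contradiction[OF intG _ _ c(1,2)])
      show "G p \<le> 0" if p: "p \<in> {0<..<1}" for p
      proof -
        have "(1 - p) ^ n / p * ?s p powr (real m - \<omega>2) \<ge> 0" using p by simp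
        moreover have "h (?s p) * poly N (?s p) \<le> 0" using p by (intro hN) simp
        ultimately show ?thesis unfolding G[OF p] by (rule mult_nonneg_nonpos)
      qed
      show "continuous_on {0<..<1} G" unfolding G_def by (intro continuous_intros contF)
      have "h \<epsilon> > 0" using two_exp_sign(1)[OF ab ag lv z, of "ln \<epsilon>"] \<epsilon> v by (simp add: h_def)
      moreover have "poly N \<epsilon> < 0" using \<delta>(2)[of \<epsilon>] \<epsilon> by simp
      ultimately have "h \<epsilon> * poly N \<epsilon> < 0" by (rule mult_pos_neg)
      moreover have "(1 - c) ^ n / c * \<epsilon> powr (real m - \<omega>2) > 0"
        using c \<epsilon> by (intro mult_pos_pos divide_pos_pos zero_less_power) auto
      moreover have "G c = (1 - c) ^ n / c * \<epsilon> powr (real m - \<omega>2) * (h \<epsilon> * poly N \<epsilon>)"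
        using G[of c] c(1,2) unfolding c(3) by simp
      ultimately show "G c < 0" by (simp only: mult_pos_neg)
    qed
  qed
qed

text \<open>Let \<tau> be a maximum. A failure of monotonicity on either side produces a point no
  higher than one point on its left and one on its right, and the intermediate value theorem then
  yields its level three times.\<close>

lemma unimodal_if_levels_at_most_twice:
  fixes f :: "real \<Rightarrow> real"
  assumes ab: "a < b" and cont: "continuous_on {a..b} f" and f0: "f a = 0" "f b = 0"
    and pos: "\<And>t. a < t \<Longrightarrow> t < b \<Longrightarrow> f t > 0"
    and lev: "\<And>s t u. a < s \<Longrightarrow> s < t \<Longrightarrow> t < u \<Longrightarrow> u < b \<Longrightarrow> f s = f t \<Longrightarrow> f t = f u \<Longrightarrow> False"
  shows "\<exists>\<tau>\<in>{a<..<b}. strict_mono_on {a..\<tau>} f \<and> strict_antimono_on {\<tau>..b} f"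
proof -
  obtain \<tau> where \<tau>: "\<tau> \<in> {a..b}" "\<And>t. t \<in> {a..b} \<Longrightarrow> f t \<le> f \<tau>"
    using continuous_attains_sup[of "{a..b}" f] cont ab by auto
  have "f \<tau> > 0" using \<tau>(2)[of "(a + b) / 2"] pos[of "(a + b) / 2"] ab by auto
  then have \<tau>ab: "a < \<tau>" "\<tau> < b" using \<tau>(1) f0 by (auto simp: less_le)
  have up: "\<exists>t. a < t \<and> t \<le> s \<and> f t = y" if "a < s" "s \<le> b" "0 < y" "y \<le> f s" for s y
  proof -
    have "\<exists>t\<ge>a. t \<le> s \<and> f t = y"
      by (rule IVT') (use that f0 in \<open>auto intro: continuous_on_subset[OF cont]\<close>)
    then show ?thesis using that f0 by (metis less_le order_less_irrefl)
  qed
  have down: "\<exists>t. s \<le> t \<and> t < b \<and> f t = y" if "a \<le> s" "s < b" "0 < y" "y \<le> f s" for s y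
  proof -
    have "\<exists>t\<ge>s. t \<le> b \<and> f t = y"
      by (rule IVT2') (use that f0 in \<open>auto intro: continuous_on_subset[OF cont]\<close>)
    then show ?thesis using that f0 by (metis less_le order_less_irrefl)
  qed
  \<comment> \<open>Since \<open>f\<close> vanishes at \<open>a\<close> and \<open>b\<close>, the
    positive level \<open>f t\<close> is also taken in \<open>(a, s]\<close> and in
    \<open>[u, b)\<close>.\<close>
  have three: False if h: "a < s" "s < t" "t < u" "u < b" "f t \<le> f s" "f t \<le> f u" "f t > 0"
    "f t < f s \<or> f t < f u \<or> f s = f u" for s t u
  proof -
    have su: "s \<le> b" "a \<le> u" using h by linarith+
    then obtain s' where "a < s'" "s' \<le> s" "f s' = f t" using up[of s "f t"] h by auto
    moreover obtain u' where "u \<le> u'" "u' < b" "f u' = f t" using down[of u "f t"] h su by auto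
    ultimately show False by (intro lev[of s' t u']) (use h in auto)
  qed
  have inc: "f s < f t" if st: "a \<le> s" "s < t" "t \<le> \<tau>" for s t
  proof (rule ccontr)
    assume "\<not> f s < f t"
    then have fst: "f t \<le> f s" by simp
    have ft: "f t > 0" using pos[of t] st \<tau>ab by simp
    have as: "a < s" using st fst ft f0 by (auto simp: less_le)
    show False
    proof (cases "t = \<tau>")
      case False
      have "f t \<le> f \<tau>" using \<tau>(2)[of t] st \<tau>ab by auto
      then show False by (intro three[of s t \<tau>]) (use False st as \<tau>ab fst ft in auto)
    next
      case True
      then have "f s = f \<tau>" using fst \<tau>(2)[of s] st \<tau>ab by auto
      \<comment> \<open>Here \<open>s\<close> is a second maximum, so any point strictly between the
        two lies no higher than either.\<close>
      define u where "u = (s + \<tau>) / 2"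
      have u: "s < u" "u < \<tau>" using st True by (auto simp: u_def)
      show False
        by (rule three[of s u \<tau>]) (use u as \<tau>ab \<tau>(2)[of u] pos[of u] \<open>f s = f \<tau>\<close> in auto)
    qed
  qed
  have dec: "f t < f s" if st: "\<tau> \<le> s" "s < t" "t \<le> b" for s t
  proof (rule ccontr)
    assume "\<not> f t < f s"
    then have fst: "f s \<le> f t" by simp
    have ft: "f s > 0" using pos[of s] st \<tau>ab by simp
    have as: "t < b" using st fst ft f0 by (auto simp: less_le)
    show False
    proof (cases "s = \<tau>")
      case False
      have "f s \<le> f \<tau>" using \<tau>(2)[of s] st \<tau>ab by auto
      then show False by (intro three[of \<tau> s t]) (use False st as \<tau>ab fst ft in auto)
    next
      case True
      then have "f t = f \<tau>" using fst \<tau>(2)[of t] st \<tau>ab by auto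
      define u where "u = (t + \<tau>) / 2"
      have u: "\<tau> < u" "u < t" using st True by (auto simp: u_def)
      show False
        by (rule three[of \<tau> u t]) (use u as \<tau>ab \<tau>(2)[of u] pos[of u] \<open>f t = f \<tau>\<close> in auto)
    qed
  qed
  show ?thesis
    by (intro bexI[of _ \<tau>] conjI) (use \<tau>ab inc dec in \<open>auto simp: monotone_on_def\<close>)
qed

subsection \<open>Branches of simple zeros\<close>

lemma prod_mset_norm_small:
  fixes z :: complex
  assumes "norm (\<Prod>x\<in>#M. z - x) < \<delta> ^ size M" "\<delta> > 0"
  shows "\<exists>x\<in>#M. dist z x < \<delta>"
  using assms(1)
proof (induction M)
  case (add y M)
  show ?case
  proof (cases "dist z y < \<delta>")
    case False
    have "norm (\<Prod>x\<in>#M. z - x) < \<delta> ^ size M"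
    proof (rule ccontr)
      assume "\<not> norm (\<Prod>x\<in>#M. z - x) < \<delta> ^ size M"
      then have "\<delta> * \<delta> ^ size M \<le> norm (z - y) * norm (\<Prod>x\<in>#M. z - x)"
        using False assms(2) by (intro mult_mono) (auto simp: dist_norm)
      then show False using add.prems by (simp add: norm_mult)
    qed
    then show ?thesis using add.IH by auto
  qed auto
qed simp

text \<open>The modulus of a monic polynomial is the product of the distances to its roots; if all
  were at least \<delta>, it would be at least \<open>\<delta> ^ degree p\<close>. All continuity of
  roots below rests on this estimate.\<close>

lemma small_value_near_root:
  fixes p :: "complex poly"
  assumes "lead_coeff p = 1" "norm (poly p z) < \<delta> ^ degree p" "\<delta> > 0"
  shows "\<exists>r. poly p r = 0 \<and> dist z r < \<delta>"
proof -
  have p: "p = (\<Prod>x\<in>#proots p. [:-x, 1:])"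
    using complex_poly_decompose_multiset[of p] assms(1) by simp
  have p0: "p \<noteq> 0" using assms(1) by auto
  have "poly p z = (\<Prod>x\<in>#proots p. z - x)"
    by (subst p) (simp add: poly_prod_mset)
  moreover have "size (proots p) = degree p" by (rule size_proots_complex)
  ultimately have "\<exists>x\<in>#proots p. dist z x < \<delta>"
    using prod_mset_norm_small[of z "proots p" \<delta>] assms by simp
  then show ?thesis using p0 by auto
qed

lemma finite_set_separated:
  fixes R :: "'a::metric_space set"
  assumes "finite R"
  shows "\<exists>d>0. \<forall>r\<in>R. \<forall>s\<in>R. \<forall>z. dist z r < d \<and> dist z s < d \<longrightarrow> r = s"
proof -
  define D where "D = insert 1 ((\<lambda>(r, s). dist r s) ` {(r, s). r \<in> R \<and> s \<in> R \<and> r \<noteq> s})"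
  have "{(r, s). r \<in> R \<and> s \<in> R \<and> r \<noteq> s} \<subseteq> R \<times> R" by auto
  then have "finite {(r, s). r \<in> R \<and> s \<in> R \<and> r \<noteq> s}"
    by (rule finite_subset) (use assms in auto)
  then have fin: "finite D" unfolding D_def by (intro finite.insertI finite_imageI)
  show ?thesis
  proof (intro exI[of _ "Min D / 2"] conjI ballI allI impI)
    have "Min D > 0" using fin by (subst Min_gr_iff) (auto simp: D_def)
    then show "Min D / 2 > 0" by simp
    fix r s z assume rs: "r \<in> R" "s \<in> R" "dist z r < Min D / 2 \<and> dist z s < Min D / 2"
    then have "dist r s < Min D" using dist_triangle3[of r s z] by linarith
    moreover have "Min D \<le> dist r s" if "r \<noteq> s"
      by (rule Min_le[OF fin]) (use rs that in \<open>auto simp: D_def image_iff\<close>)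
    ultimately show "r = s" by fastforce
  qed
qed

lemma roots_near_roots:
  fixes S :: "real \<Rightarrow> complex poly"
  assumes monic: "\<forall>t\<in>I. lead_coeff (S t) = 1 \<and> degree (S t) = n"
    and cont: "\<forall>z. continuous_on I (\<lambda>t. poly (S t) z)"
    and t0: "t0 \<in> I" "poly (S t0) r = 0" and \<delta>: "\<delta> > 0"
  shows "\<exists>\<eta>>0. \<forall>t\<in>I. dist t t0 < \<eta> \<longrightarrow> (\<exists>r'. poly (S t) r' = 0 \<and> dist r' r < \<delta>)"
proof -
  have "\<delta> ^ n > 0" using \<delta> by simp
  then obtain \<eta> where \<eta>: "\<eta> > 0" "\<And>t. t \<in> I \<Longrightarrow> dist t t0 < \<eta> \<Longrightarrow> dist (poly (S t) r) (poly (S t0) r) < \<delta> ^ n"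
    using cont[rule_format, of r] t0(1) unfolding continuous_on_iff by meson
  show ?thesis
  proof (intro exI[of _ \<eta>] conjI ballI impI \<eta>(1))
    fix t assume w: "t \<in> I" "dist t t0 < \<eta>"
    show "\<exists>r'. poly (S t) r' = 0 \<and> dist r' r < \<delta>"
      using small_value_near_root[of "S t" r \<delta>] \<eta>(2)[OF w] t0(2) monic[rule_format, OF w(1)] \<delta>
      by (auto simp: dist_norm norm_minus_commute)
  qed
qed

text \<open>Each ball about a root at \<open>t0\<close> keeps a root for nearby \<open>t\<close>. A
  point lies in at most one of these balls and there are \<open>n\<close> roots at both parameters,
  so counting leaves exactly one root per ball and none elsewhere.\<close>

lemma roots_locally_labelled:
  fixes S :: "real \<Rightarrow> complex poly"
  defines "R \<equiv> \<lambda>t. {z. poly (S t) z = 0}"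
  assumes monic: "\<forall>t\<in>I. lead_coeff (S t) = 1 \<and> degree (S t) = n"
    and cont: "\<forall>z. continuous_on I (\<lambda>t. poly (S t) z)"
    and card: "\<forall>t\<in>I. card (R t) = n" and t0: "t0 \<in> I"
  obtains \<rho> \<eta> where "\<rho> > 0" "\<eta> > 0"
    "\<forall>r\<in>R t0. \<forall>s\<in>R t0. \<forall>z. dist z r < \<rho> \<and> dist z s < \<rho> \<longrightarrow> r = s"
    "\<forall>t\<in>I. dist t t0 < \<eta> \<longrightarrow> (\<forall>r\<in>R t0. \<exists>!r'. r' \<in> R t \<and> dist r' r < \<rho>) \<and>
       (\<forall>r'\<in>R t. \<exists>r\<in>R t0. dist r' r < \<rho>)"
proof -
  have fin: "finite (R t)" if "t \<in> I" for t
  proof -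
    have "S t \<noteq> 0" using monic[rule_format, OF that] by auto
    then show ?thesis unfolding R_def by (rule poly_roots_finite)
  qed
  obtain \<rho> where \<rho>: "\<rho> > 0"
    and sep0: "\<forall>r\<in>R t0. \<forall>s\<in>R t0. \<forall>z. dist z r < \<rho> \<and> dist z s < \<rho> \<longrightarrow> r = s"
    using finite_set_separated[OF fin[OF t0]] by blast
  have sep: "r = s" if "r \<in> R t0" "s \<in> R t0" "dist z r < \<rho>" "dist z s < \<rho>" for r s z
    using sep0 that by blast
  have "\<forall>r\<in>R t0. \<exists>\<eta>>0. \<forall>t\<in>I. dist t t0 < \<eta> \<longrightarrow> (\<exists>r'. r' \<in> R t \<and> dist r' r < \<rho>)"
  proof
    fix r assume "r \<in> R t0"
    then show "\<exists>\<eta>>0. \<forall>t\<in>I. dist t t0 < \<eta> \<longrightarrow> (\<exists>r'. r' \<in> R t \<and> dist r' r < \<rho>)"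
      using roots_near_roots[where S = S and I = I, OF monic cont t0 _ \<rho>, of r] unfolding R_def by auto
  qed
  then obtain \<eta>r where \<eta>r: "\<And>r. r \<in> R t0 \<Longrightarrow> \<eta>r r > 0"
    "\<And>r t. r \<in> R t0 \<Longrightarrow> t \<in> I \<Longrightarrow> dist t t0 < \<eta>r r \<Longrightarrow> \<exists>r'. r' \<in> R t \<and> dist r' r < \<rho>"
    by metis
  define \<eta> where "\<eta> = Min (insert 1 (\<eta>r ` R t0))"
  have \<eta>: "\<eta> > 0" unfolding \<eta>_def using fin[OF t0] \<eta>r(1) by (subst Min_gr_iff) auto
  have \<eta>le: "\<eta> \<le> \<eta>r r" if "r \<in> R t0" for r
    unfolding \<eta>_def using fin[OF t0] that by (intro Min_le) auto
  have main: "(\<forall>r\<in>R t0. \<exists>!r'. r' \<in> R t \<and> dist r' r < \<rho>) \<and> (\<forall>r'\<in>R t. \<exists>r\<in>R t0. dist r' r < \<rho>)"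
    if w: "t \<in> I" "dist t t0 < \<eta>" for t
  proof -
    have "\<forall>r\<in>R t0. \<exists>r'. r' \<in> R t \<and> dist r' r < \<rho>"
      using \<eta>r(2) \<eta>le w by (meson less_le_trans)
    then obtain f where f: "\<And>r. r \<in> R t0 \<Longrightarrow> f r \<in> R t \<and> dist (f r) r < \<rho>" by metis
    have inj: "inj_on f (R t0)"
    proof (rule inj_onI)
      fix r s assume "r \<in> R t0" "s \<in> R t0" "f r = f s"
      then show "r = s" using f sep[of r s "f r"] by metis
    qed
    have im: "f ` R t0 = R t"
      by (rule card_subset_eq[OF fin[OF w(1)]]) (use f card_image[OF inj] card[rule_format, OF t0] card[rule_format, OF w(1)] in auto)
    show ?thesis
    proof (intro conjI ballI)
      fix r assume r: "r \<in> R t0"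
      show "\<exists>!r'. r' \<in> R t \<and> dist r' r < \<rho>"
      proof (rule ex1I[of _ "f r"])
        fix r' assume r': "r' \<in> R t \<and> dist r' r < \<rho>"
        then obtain s where s: "s \<in> R t0" "r' = f s" using im by blast
        then have "s = r" using sep[OF s(1) r, of r'] r' f by blast
        then show "r' = f r" using s by simp
      qed (use f r in blast)
    next
      fix r' assume "r' \<in> R t"
      then obtain s where "s \<in> R t0" "r' = f s" using im by blast
      then show "\<exists>r\<in>R t0. dist r' r < \<rho>" using f by (intro bexI[of _ s]) auto
    qed
  qed
  show thesis
    by (rule that[OF \<rho> \<eta> sep0]) (use main in blast)
qed

text \<open>The sheets over a small \<open>T\<close> are the parts of the zero set within \<rho> of
  one root at \<open>t0\<close>; the unique root in the ball is a continuous section.\<close>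

lemma root_covering_space:
  fixes S :: "real \<Rightarrow> complex poly"
  assumes "open I" "n > 0"
    and monic: "\<forall>t\<in>I. lead_coeff (S t) = 1 \<and> degree (S t) = n"
    and cont: "\<forall>z. continuous_on I (\<lambda>t. poly (S t) z)"
    and card: "\<forall>t\<in>I. card {z. poly (S t) z = 0} = n"
  shows "covering_space {(t, z). t \<in> I \<and> poly (S t) z = 0} fst I"
proof
  let ?C = "{(t, z). t \<in> I \<and> poly (S t) z = 0}"
  define R where "R = (\<lambda>t. {z. poly (S t) z = 0})"
  show "continuous_on ?C fst" by (intro continuous_intros)
  show "fst ` ?C = I"
  proof safe
    fix t assume "t \<in> I"
    then have "{z. poly (S t) z = 0} \<noteq> {}" using card[rule_format, of t] assms(2) by (metis card.empty less_irrefl)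
    then show "t \<in> fst ` ?C" using \<open>t \<in> I\<close> by force
  qed auto
  fix t0 assume t0: "t0 \<in> I"
  obtain \<rho> \<eta> where \<rho>: "\<rho> > 0" "\<eta> > 0"
    and sep0: "\<forall>r\<in>R t0. \<forall>s\<in>R t0. \<forall>z. dist z r < \<rho> \<and> dist z s < \<rho> \<longrightarrow> r = s"
    and lab: "\<forall>t\<in>I. dist t t0 < \<eta> \<longrightarrow> (\<forall>r\<in>R t0. \<exists>!r'. r' \<in> R t \<and> dist r' r < \<rho>) \<and>
       (\<forall>r'\<in>R t. \<exists>r\<in>R t0. dist r' r < \<rho>)"
    unfolding R_def by (rule roots_locally_labelled[OF monic cont card t0])
  have uniq: "\<exists>!r'. r' \<in> R t \<and> dist r' r < \<rho>" if "t \<in> I" "dist t t0 < \<eta>" "r \<in> R t0" for t r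
    using bspec[OF lab that(1)] that(2,3) by simp
  have all: "\<exists>r\<in>R t0. dist r' r < \<rho>" if "t \<in> I" "dist t t0 < \<eta>" "r' \<in> R t" for t r'
    using bspec[OF lab that(1)] that(2,3) by simp
  define T where "T = I \<inter> ball t0 \<eta>"
  define U where "U = (\<lambda>r. ?C \<inter> (T \<times> ball r \<rho>))"
  have T: "t \<in> T \<longleftrightarrow> t \<in> I \<and> dist t t0 < \<eta>" for t by (auto simp: T_def dist_commute)
  have Uiff: "(t, z) \<in> U r \<longleftrightarrow> t \<in> T \<and> z \<in> R t \<and> dist z r < \<rho>" for t z r
    by (auto simp: U_def R_def T dist_commute)
  have oT: "open T" unfolding T_def using assms(1) by auto
  show "\<exists>T. t0 \<in> T \<and> openin (top_of_set I) T \<and> (\<exists>v. \<Union>v = ?C \<inter> fst -` T \<and> (\<forall>u\<in>v. openin (top_of_set ?C) u) \<and>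
      pairwise disjnt v \<and> (\<forall>u\<in>v. \<exists>q. homeomorphism u T fst q))"
  proof (intro exI[of _ T] exI[of _ "U ` R t0"] conjI ballI)
    show "t0 \<in> T" using t0 \<rho> by (simp add: T)
    show "openin (top_of_set I) T" using oT by (auto simp: T_def)
    show "\<Union> (U ` R t0) = ?C \<inter> fst -` T"
    proof (intro equalityI subsetI)
      fix y assume "y \<in> ?C \<inter> fst -` T"
      then obtain t z where y: "y = (t, z)" "t \<in> T" "z \<in> R t" by (auto simp: R_def)
      then obtain r where "r \<in> R t0" "dist z r < \<rho>" using all[of t z] by (auto simp: T)
      then show "y \<in> \<Union> (U ` R t0)" using y Uiff by blast
    qed (auto simp: U_def)
    show "pairwise disjnt (U ` R t0)"
    proof (rule pairwiseI)
      fix u u' assume "u \<in> U ` R t0" "u' \<in> U ` R t0" "u \<noteq> u'"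
      then obtain r s where rs: "u = U r" "u' = U s" "r \<in> R t0" "s \<in> R t0" "r \<noteq> s" by blast
      have "False" if "y \<in> U r" "y \<in> U s" for y
      proof -
        obtain t z where "y = (t, z)" by (cases y)
        then have "dist z r < \<rho>" "dist z s < \<rho>" using that Uiff by blast+
        then show False using sep0 rs(3-5) by blast
      qed
      then show "disjnt u u'" unfolding rs disjnt_iff by blast
    qed
    fix u assume "u \<in> U ` R t0"
    then obtain r where r: "u = U r" "r \<in> R t0" by blast
    show "openin (top_of_set ?C) u" unfolding r U_def
      by (intro openin_open_Int open_Times oT open_ball)
    define h where "h = (\<lambda>t. THE z. z \<in> R t \<and> dist z r < \<rho>)"
    have h: "h t \<in> R t" "dist (h t) r < \<rho>" if "t \<in> T" for t
      using theI'[OF uniq[of t r]] that r(2) unfolding h_def T by auto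
    have heq: "z = h t" if "t \<in> T" "z \<in> R t" "dist z r < \<rho>" for t z
      using the1_equality[OF uniq[of t r], of z] that r(2) unfolding h_def T by auto
    have conth: "continuous_on T h"
      unfolding continuous_on_iff
    proof (intro ballI allI impI)
      fix t1 \<epsilon> :: real assume w1: "t1 \<in> T" and \<epsilon>: "0 < \<epsilon>"
      define \<delta> where "\<delta> = min \<epsilon> (\<rho> - dist (h t1) r)"
      have \<delta>: "\<delta> > 0" using \<epsilon> h(2)[OF w1] by (simp add: \<delta>_def)
      have "t1 \<in> I" "poly (S t1) (h t1) = 0" using w1 h(1)[OF w1] by (auto simp: T R_def)
      then obtain \<eta>' where \<eta>': "\<eta>' > 0" "\<And>t. t \<in> I \<Longrightarrow> dist t t1 < \<eta>' \<Longrightarrow> \<exists>r'. poly (S t) r' = 0 \<and> dist r' (h t1) < \<delta>"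
        using roots_near_roots[where S = S and I = I, OF monic cont _ _ \<delta>] by blast
      show "\<exists>d>0. \<forall>t\<in>T. dist t t1 < d \<longrightarrow> dist (h t) (h t1) < \<epsilon>"
      proof (intro exI[of _ \<eta>'] conjI \<eta>'(1) ballI impI)
        fix t assume w: "t \<in> T" "dist t t1 < \<eta>'"
        then obtain z where z: "z \<in> R t" "dist z (h t1) < \<delta>" using \<eta>'(2)[of t] by (auto simp: T R_def)
        have "dist z r \<le> dist z (h t1) + dist (h t1) r" by (rule dist_triangle)
        also have "\<dots> < \<rho>" using z(2) by (simp add: \<delta>_def)
        finally have "z = h t" using heq[OF w(1) z(1)] by simp
        then show "dist (h t) (h t1) < \<epsilon>" using z(2) by (simp add: \<delta>_def)
      qed
    qed
    have "homeomorphism u T fst (\<lambda>t. (t, h t))"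
    proof (rule homeomorphismI)
      show "continuous_on u fst" by (intro continuous_intros)
      show "continuous_on T (\<lambda>t. (t, h t))" by (intro continuous_intros conth)
      show "fst ` u \<subseteq> T" by (auto simp: r U_def)
      show "(\<lambda>t. (t, h t)) ` T \<subseteq> u" unfolding r using h by (auto simp: Uiff)
      show "(fst y, h (fst y)) = y" if "y \<in> u" for y
      proof -
        obtain t z where y: "y = (t, z)" by (cases y)
        then have "t \<in> T" "z \<in> R t" "dist z r < \<rho>" using that Uiff unfolding r by blast+
        then show ?thesis using heq y by simp
      qed
    qed simp
    then show "\<exists>q. homeomorphism u T fst q" by blast
  qed
qed

text \<open>An interval is simply connected, so the identity lifts to the covering, once through
  each root over the midpoint. Uniqueness of lifts keeps the branches disjoint and gives the last
  property, by which conjugation permutes the branches.\<close>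

lemma root_branches:
  fixes S :: "real \<Rightarrow> complex poly" and a b :: real
  defines "I \<equiv> {a<..<b}"
  assumes "a < b" "n > 0"
    and monic: "\<forall>t\<in>I. lead_coeff (S t) = 1 \<and> degree (S t) = n"
    and cont: "\<forall>z. continuous_on I (\<lambda>t. poly (S t) z)"
    and card: "\<forall>t\<in>I. card {z. poly (S t) z = 0} = n"
  obtains Z where "\<And>j. j < n \<Longrightarrow> continuous_on I (Z j)"
    "\<And>t. t \<in> I \<Longrightarrow> inj_on (\<lambda>j. Z j t) {..<n}"
    "\<And>t. t \<in> I \<Longrightarrow> (\<lambda>j. Z j t) ` {..<n} = {z. poly (S t) z = 0}"
    "\<And>h. continuous_on I h \<Longrightarrow> \<forall>t\<in>I. poly (S t) (h t) = 0 \<Longrightarrow> \<exists>j<n. \<forall>t\<in>I. h t = Z j t"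
proof -
  let ?C = "{(t, z). t \<in> I \<and> poly (S t) z = 0}"
  define R where "R = (\<lambda>t. {z. poly (S t) z = 0})"
  have oI: "open I" and cI: "convex I" by (auto simp: I_def)
  have cov: "covering_space ?C fst I"
    by (rule root_covering_space[OF oI assms(3) monic cont card])
  define c where "c = (a + b) / 2"
  have c: "c \<in> I" using assms(2) by (auto simp: c_def I_def)
  have fin: "finite (R t)" if "t \<in> I" for t
    using card[rule_format, OF that] assms(3) unfolding R_def by (metis card.infinite less_irrefl)
  obtain f where f: "bij_betw f {..<n} (R c)"
    using ex_bij_betw_nat_finite[OF fin[OF c]] card[rule_format, OF c] by (auto simp: R_def atLeast0LessThan)
  have lift: "\<exists>g. continuous_on I g \<and> (\<forall>t\<in>I. g t \<in> R t) \<and> g c = f j" if j: "j < n" for j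
  proof -
    have fj: "f j \<in> R c" using f j by (auto simp: bij_betw_def)
    have "(c, f j) \<in> ?C" using fj c by (simp add: R_def)
    have "continuous_on I id" "id \<in> I \<rightarrow> I" "id c = fst (c, f j)"
      by (simp_all add: continuous_on_id')
    note id = this
    obtain g where g: "continuous_on I g" "g \<in> I \<rightarrow> ?C" "g c = (c, f j)" "\<And>y. y \<in> I \<Longrightarrow> fst (g y) = id y"
    proof (rule covering_space_lift_strong[OF cov \<open>(c, f j) \<in> ?C\<close> c convex_imp_simply_connected[OF cI] convex_imp_locally_path_connected[OF cI] id])
      fix g assume "continuous_on I g" "g \<in> I \<rightarrow> ?C" "g c = (c, f j)" "\<And>y. y \<in> I \<Longrightarrow> fst (g y) = id y"
      then show thesis by (rule that)
    qed
    show ?thesis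
    proof (intro exI[of _ "\<lambda>t. snd (g t)"] conjI ballI)
      show "continuous_on I (\<lambda>t. snd (g t))" by (intro continuous_intros g(1))
      show "snd (g t) \<in> R t" if "t \<in> I" for t
        using g(2) g(4)[OF that] that by (auto simp: R_def Pi_iff case_prod_beta)
    qed (use g in simp)
  qed
  define Z where "Z = (\<lambda>j. SOME g. continuous_on I g \<and> (\<forall>t\<in>I. g t \<in> R t) \<and> g c = f j)"
  have Z: "continuous_on I (Z j)" "\<And>t. t \<in> I \<Longrightarrow> Z j t \<in> R t" "Z j c = f j" if "j < n" for j
    using someI_ex[OF lift[OF that]] unfolding Z_def by blast+
  have agree: "h t' = h' t'" if "continuous_on I h" "continuous_on I h'" "\<And>t. t \<in> I \<Longrightarrow> h t \<in> R t"
    "\<And>t. t \<in> I \<Longrightarrow> h' t \<in> R t" "t \<in> I" "t' \<in> I" "h t = h' t" for h h' t t'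
  proof -
    have "(\<lambda>t. (t, h t)) t' = (\<lambda>t. (t, h' t)) t'"
      by (rule covering_space_lift_unique[OF cov, of _ t _ I id])
        (use that cI in \<open>auto simp: R_def intro!: continuous_intros convex_connected\<close>)
    then show ?thesis by simp
  qed
  have inj: "inj_on (\<lambda>j. Z j t) {..<n}" if w: "t \<in> I" for t
  proof (rule inj_onI)
    fix i j assume ij: "i \<in> {..<n}" "j \<in> {..<n}" "Z i t = Z j t"
    then have "Z i c = Z j c" by (intro agree[of "Z i" "Z j" t c]) (use Z c w in simp_all)
    then show "i = j" using ij Z(3) f by (auto simp: bij_betw_def inj_on_def)
  qed
  have im: "(\<lambda>j. Z j t) ` {..<n} = R t" if w: "t \<in> I" for t
    by (rule card_subset_eq[OF fin[OF w]])
      (use Z(2) w card_image[OF inj[OF w]] card[rule_format, OF w] in \<open>auto simp: R_def\<close>)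
  show thesis
  proof (rule that[of Z])
    fix h assume h: "continuous_on I h" "\<forall>t\<in>I. poly (S t) (h t) = 0"
    then have "h c \<in> R c" using c by (simp add: R_def)
    then obtain j where j: "j < n" "h c = Z j c" using im[OF c] by force
    then show "\<exists>j<n. \<forall>t\<in>I. h t = Z j t"
      using agree[of h "Z j" c] h Z(1,2)[OF j(1)] c unfolding R_def mem_Collect_eq by blast
  qed (use Z(1) inj im in \<open>simp_all add: R_def\<close>)
qed

text \<open>Stated for a filter with a basis of connected sets, so that it serves both \<open>at_left\<close> and
  \<open>at_right\<close>.\<close>

lemma tendsto_if_near_finite_set:
  fixes g :: "'a::topological_space \<Rightarrow> 'b::metric_space"
  assumes "continuous_on I g" "finite R" "F \<noteq> bot"
    and near: "\<And>\<epsilon>. \<epsilon> > 0 \<Longrightarrow> \<forall>\<^sub>F t in F. \<exists>r\<in>R. dist (g t) r < \<epsilon>"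
    and basis: "\<And>P. eventually P F \<Longrightarrow> \<exists>U. connected U \<and> U \<subseteq> I \<and> eventually (\<lambda>t. t \<in> U) F \<and> (\<forall>t\<in>U. P t)"
  shows "\<exists>r\<in>R. (g \<longlongrightarrow> r) F"
proof -
  obtain d where d: "d > 0" and sep: "\<And>r s z. r \<in> R \<Longrightarrow> s \<in> R \<Longrightarrow> dist z r < d \<Longrightarrow> dist z s < d \<Longrightarrow> r = s"
    using finite_set_separated[OF assms(2)] by blast
  have "\<forall>\<^sub>F t in F. \<exists>r\<in>R. dist (g t) r < d" by (intro near) (use d in simp)
  from basis[OF this] obtain U where U: "connected U" "U \<subseteq> I" "eventually (\<lambda>t. t \<in> U) F" "\<And>t. t \<in> U \<Longrightarrow> \<exists>r\<in>R. dist (g t) r < d"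
    by blast
  have "U \<noteq> {}" using U(3) assms(3) by (auto simp: eventually_False)
  then obtain t1 where w1: "t1 \<in> U" by blast
  obtain r where r: "r \<in> R" "dist (g t1) r < d" using U(4)[OF w1] by blast
  have con: "connected (g ` U)"
    by (rule connected_continuous_image[OF continuous_on_subset[OF assms(1) U(2)] U(1)])
  have all: "dist (g t) r < d" if w: "t \<in> U" for t
  proof (rule ccontr)
    assume n: "\<not> dist (g t) r < d"
    let ?A = "ball r d" and ?B = "\<Union>s\<in>R - {r}. ball s d"
    have "?A \<inter> g ` U = {} \<or> ?B \<inter> g ` U = {}"
    proof (rule connectedD[OF con])
      show "?A \<inter> ?B \<inter> g ` U = {}"
      proof (rule equals0I)
        fix y assume "y \<in> ?A \<inter> ?B \<inter> g ` U"
        then obtain s where "s \<in> R" "s \<noteq> r" "dist r y < d" "dist s y < d" by auto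
        then show False using sep[OF r(1), of s y] by (metis dist_commute)
      qed
      show "g ` U \<subseteq> ?A \<union> ?B" using U(4) by (force simp: dist_commute)
    qed auto
    moreover have "g t1 \<in> ?A \<inter> g ` U" using r w1 by (auto simp: dist_commute)
    moreover have "g t \<in> ?B \<inter> g ` U" using U(4)[OF w] n w by (force simp: dist_commute)
    ultimately show False by blast
  qed
  have "(g \<longlongrightarrow> r) F"
  proof (rule tendstoI)
    fix e :: real assume e: "e > 0"
    have "\<forall>\<^sub>F t in F. \<exists>s\<in>R. dist (g t) s < min e d" using near[of "min e d"] e d by simp
    then show "\<forall>\<^sub>F t in F. dist (g t) r < e" using U(3)
    proof eventually_elim
      case (elim t)
      then obtain s where "s \<in> R" "dist (g t) s < min e d" by blast
      then show ?case using sep[of s r "g t"] r(1) all[OF elim(2)] by auto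
    qed
  qed
  then show ?thesis using r by blast
qed

lemma at_right_connected_basis:
  fixes a b :: real
  assumes "a < b" "eventually P (at_right a)"
  shows "\<exists>U. connected U \<and> U \<subseteq> {a<..<b} \<and> eventually (\<lambda>t. t \<in> U) (at_right a) \<and> (\<forall>t\<in>U. P t)"
proof -
  obtain c where c: "c > a" "\<forall>y>a. y < c \<longrightarrow> P y" using assms(2) unfolding eventually_at_right_field by blast
  have "\<forall>\<^sub>F t in at_right a. t \<in> {a<..<min b c}"
    by (rule eventually_at_right_real) (use c assms(1) in simp)
  then show ?thesis by (intro exI[of _ "{a<..<min b c}"]) (use c in auto)
qed

lemma at_left_connected_basis:
  fixes a b :: real
  assumes "a < b" "eventually P (at_left b)"
  shows "\<exists>U. connected U \<and> U \<subseteq> {a<..<b} \<and> eventually (\<lambda>t. t \<in> U) (at_left b) \<and> (\<forall>t\<in>U. P t)"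
proof -
  obtain c where c: "c < b" "\<forall>y>c. y < b \<longrightarrow> P y" using assms(2) unfolding eventually_at_left_field by blast
  have "\<forall>\<^sub>F t in at_left b. t \<in> {max a c<..<b}"
    by (rule eventually_at_left_real) (use c assms(1) in simp)
  then show ?thesis by (intro exI[of _ "{max a c<..<b}"]) (use c in auto)
qed

lemma near_roots_if_values_tendsto_0:
  fixes p :: "complex poly"
  assumes "lead_coeff p = 1" "((\<lambda>t. poly p (g t)) \<longlongrightarrow> 0) F" "\<epsilon> > 0"
  shows "\<forall>\<^sub>F t in F. \<exists>r\<in>{z. poly p z = 0}. dist (g t) r < \<epsilon>"
proof -
  have "\<forall>\<^sub>F t in F. dist (poly p (g t)) 0 < \<epsilon> ^ degree p"
    using assms(2,3) by (intro tendstoD) auto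
  then show ?thesis
    by eventually_elim (use small_value_near_root[OF assms(1) _ assms(3)] in auto)
qed

subsection \<open>Zeros at the ends of a unit interval\<close>

lemma continuous_on_gbinomial:
  fixes f :: "real \<Rightarrow> real"
  assumes "continuous_on I f"
  shows "continuous_on I (\<lambda>t. f t gchoose n)"
  unfolding gbinomial_prod_rev by (intro continuous_intros assms) auto

definition sky_coeff :: "nat \<Rightarrow> nat \<Rightarrow> real \<Rightarrow> real" where
  "sky_coeff n j t = real (n choose j) * ((t + real j) gchoose n) / ((t + real n) gchoose n)"

lemma coeff_skyburst': "t > -1 \<Longrightarrow> coeff (skyburst n t) j = of_real (sky_coeff n j t)"
  unfolding sky_coeff_def by (rule coeff_skyburst)

lemma continuous_on_sky_coeff: "continuous_on {-1<..} (sky_coeff n j)"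
proof -
  have "(t + real n) gchoose n \<noteq> 0" if "t \<in> {-1<..}" for t
    using gchoose_shift_pos[of t n] that by simp
  then show ?thesis unfolding sky_coeff_def
    by (intro continuous_on_divide continuous_on_mult continuous_on_gbinomial continuous_intros) auto
qed

lemma continuous_on_coeff_skyburst: "continuous_on {-1<..} (\<lambda>t. coeff (skyburst n t) j)"
  by (rule continuous_on_eq[of _ "\<lambda>t. of_real (sky_coeff n j t)"])
    (auto simp: coeff_skyburst' intro!: continuous_intros continuous_on_sky_coeff)

lemma continuous_on_poly_skyburst: "continuous_on {-1<..} (\<lambda>t. poly (skyburst n t) z)"
proof (rule continuous_on_eq)
  show "continuous_on {-1<..} (\<lambda>t. \<Sum>j\<le>n. coeff (skyburst n t) j * z ^ j)"
    by (intro continuous_intros continuous_on_coeff_skyburst)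
  show "(\<Sum>j\<le>n. coeff (skyburst n t) j * z ^ j) = poly (skyburst n t) z" if "t \<in> {-1<..}" for t
    unfolding poly_altdef using coeff_skyburst_top(2)[of t n] that by simp
qed

lemma tendsto_within_if_continuous_on_open:
  fixes f :: "'a::t2_space \<Rightarrow> 'b::topological_space"
  assumes "continuous_on A f" "open A" "c \<in> A"
  shows "(f \<longlongrightarrow> f c) (at c within B)"
proof -
  have "continuous (at c) f" using assms continuous_on_eq_continuous_at by blast
  then show ?thesis by (metis continuous_at_imp_continuous_at_within continuous_within)
qed

text \<open>Up to a positive factor the values at 0 and -1 are \<open>t gchoose n\<close> and
  \<open>(-1) ^ n\<close>.\<close>

lemma skyburst_zero_not_0_minus1:
  assumes "t > -1" "\<And>i. i < n \<Longrightarrow> t \<noteq> real i" "poly (skyburst n t) z = 0"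
  shows "z \<noteq> 0" "z \<noteq> -1"
proof -
  show "z \<noteq> 0"
  proof
    assume "z = 0"
    then have "sky_num n t 0 = 0" using assms poly_skyburst_of_real_eq_0[of t n 0] by simp
    then show False using assms(2) unfolding sky_num_0 gbinomial_eq_0_real_iff by auto
  qed
  show "z \<noteq> -1"
  proof
    assume "z = -1"
    then have "sky_num n t (-1) = 0" using assms poly_skyburst_of_real_eq_0[of t n "-1"] by simp
    then show False unfolding sky_num_minus_one by simp
  qed
qed

lemma card_roots_if_simple:
  fixes p :: "complex poly"
  assumes "p \<noteq> 0" "\<And>z. poly p z = 0 \<Longrightarrow> poly (pderiv p) z \<noteq> 0"
  shows "card {z. poly p z = 0} = degree p"
proof -
  have "order z p = 1" if "poly p z = 0" for z
  proof -
    have "pderiv p \<noteq> 0" using assms(2)[OF that] by auto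
    have "order z p = Suc (order z (pderiv p))"
      by (rule order_pderiv) (use \<open>pderiv p \<noteq> 0\<close> assms(1) that in \<open>auto simp: order_root\<close>)
    then show ?thesis using assms(2)[OF that] by (simp add: order_0I)
  qed
  then have "(\<Sum>z\<in>set_mset (proots p). count (proots p) z) = (\<Sum>z\<in>set_mset (proots p). 1)"
    by (intro sum.cong) (use assms(1) in auto)
  moreover have "size (proots p) = degree p" by (rule size_proots_complex)
  ultimately show ?thesis using assms(1) by (simp add: size_multiset_overloaded_eq)
qed

lemma card_roots_skyburst:
  assumes "t > -1" "\<And>i. i < n \<Longrightarrow> t \<noteq> real i"
  shows "card {z. poly (skyburst n t) z = 0} = n"
proof -
  have "card {z. poly (skyburst n t) z = 0} = degree (skyburst n t)"
    by (rule card_roots_if_simple)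
      (use coeff_skyburst_top(3)[OF assms(1)] skyburst_simple_zero[OF assms(1)] skyburst_zero_not_0_minus1[OF assms] in auto)
  then show ?thesis using coeff_skyburst_top(2)[OF assms(1)] by simp
qed

lemma monic_root_bound:
  fixes p :: "complex poly"
  assumes "lead_coeff p = 1" "poly p z = 0"
  shows "norm z \<le> max 1 (\<Sum>i<degree p. norm (coeff p i))"
proof (cases "norm z \<le> 1")
  case False
  define n where "n = degree p"
  have "degree p \<noteq> 0"
  proof
    assume "degree p = 0"
    then obtain c where "p = [:c:]" by (rule degree_eq_zeroE)
    then show False using assms by simp
  qed
  then obtain q where n: "n = Suc q" by (metis n_def not0_implies_Suc)
  have "{..n} = insert n {..<n}" by auto
  then have "poly p z = z ^ n + (\<Sum>i<n. coeff p i * z ^ i)"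
    unfolding poly_altdef using assms(1) by (simp add: n_def)
  then have "z ^ n = - (\<Sum>i<n. coeff p i * z ^ i)" using assms(2) by (simp add: add_eq_0_iff2)
  then have "norm z ^ n = norm (\<Sum>i<n. coeff p i * z ^ i)" by (metis norm_minus_cancel norm_power)
  also have "\<dots> \<le> (\<Sum>i<n. norm (coeff p i) * norm z ^ i)"
    by (rule order_trans[OF norm_sum]) (simp add: norm_mult norm_power)
  also have "\<dots> \<le> (\<Sum>i<n. norm (coeff p i) * norm z ^ q)"
    using False by (intro sum_mono mult_left_mono power_increasing) (auto simp: n)
  also have "\<dots> = (\<Sum>i<n. norm (coeff p i)) * norm z ^ q" by (simp add: sum_distrib_right)
  finally have "norm z * norm z ^ q \<le> (\<Sum>i<n. norm (coeff p i)) * norm z ^ q" by (simp add: n)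
  moreover have "norm z ^ q > 0" using False by (intro zero_less_power) linarith
  ultimately have "norm z \<le> (\<Sum>i<n. norm (coeff p i))" by simp
  then show ?thesis by (simp add: n_def)
qed simp

text \<open>At a root of \<open>S t\<close> the value of \<open>T\<close> is the value of
  \<open>T - S t\<close>, whose coefficients tend to 0, while the root stays bounded.\<close>

lemma limit_poly_at_roots_tendsto_0:
  fixes S :: "'a \<Rightarrow> complex poly" and T :: "complex poly"
  assumes monic: "\<forall>\<^sub>F t in F. lead_coeff (S t) = 1 \<and> degree (S t) = n" and T: "degree T = n"
    and lim: "\<And>i. ((\<lambda>t. coeff (S t) i) \<longlongrightarrow> coeff T i) F"
    and root: "\<forall>\<^sub>F t in F. poly (S t) (g t) = 0"
  shows "((\<lambda>t. poly T (g t)) \<longlongrightarrow> 0) F"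
proof -
  \<comment> \<open>Cauchy's root bound with each coefficient replaced by a majorant that eventually
    holds.\<close>
  define K where "K = max 1 (\<Sum>i<n. norm (coeff T i) + 1)"
  have "\<forall>\<^sub>F t in F. norm (coeff (S t) i) < norm (coeff T i) + 1" for i
    by (rule order_tendstoD(2)[OF tendsto_norm[OF lim]]) simp
  then have "\<forall>\<^sub>F t in F. \<forall>i\<in>{..<n}. norm (coeff (S t) i) < norm (coeff T i) + 1"
    by (intro eventually_ball_finite) auto
  then have bound: "\<forall>\<^sub>F t in F. norm (g t) \<le> K"
    using monic root
  proof eventually_elim
    case (elim t)
    have "norm (g t) \<le> max 1 (\<Sum>i<n. norm (coeff (S t) i))"
    proof -
      have d: "lead_coeff (S t) = 1" "degree (S t) = n" "poly (S t) (g t) = 0" using elim by blast+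
      show ?thesis using monic_root_bound[OF d(1,3)] unfolding d(2) .
    qed
    also have "\<dots> \<le> K" unfolding K_def
      by (intro max.mono order_refl sum_mono) (use elim in \<open>auto simp: less_imp_le\<close>)
    finally show ?case .
  qed
  have "((\<lambda>t. \<Sum>i\<le>n. norm (coeff T i - coeff (S t) i) * K ^ i) \<longlongrightarrow> (\<Sum>i\<le>n. norm (coeff T i - coeff T i) * K ^ i)) F"
    by (intro tendsto_intros lim)
  then have "((\<lambda>t. \<Sum>i\<le>n. norm (coeff T i - coeff (S t) i) * K ^ i) \<longlongrightarrow> 0) F" by simp
  then show ?thesis
  proof (rule Lim_null_comparison[rotated])
    show "\<forall>\<^sub>F t in F. norm (poly T (g t)) \<le> (\<Sum>i\<le>n. norm (coeff T i - coeff (S t) i) * K ^ i)"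
      using bound monic root
    proof eventually_elim
      case (elim t)
      have "poly T (g t) = poly T (g t) - poly (S t) (g t)" using elim by simp
      also have "\<dots> = (\<Sum>i\<le>n. (coeff T i - coeff (S t) i) * g t ^ i)"
        unfolding poly_altdef using T elim by (simp add: sum_subtractf left_diff_distrib)
      finally have "norm (poly T (g t)) \<le> (\<Sum>i\<le>n. norm ((coeff T i - coeff (S t) i) * g t ^ i))"
        using norm_sum by metis
      also have "\<dots> \<le> (\<Sum>i\<le>n. norm (coeff T i - coeff (S t) i) * K ^ i)"
        unfolding norm_mult norm_power
        by (intro sum_mono mult_left_mono power_mono) (use elim in auto)
      finally show ?case .
    qed
  qed
qed

text \<open>The branch is eventually close to the finite root set of \<open>T\<close>, and
  connectedness prevents it from switching between roots.\<close>

lemma branch_limit: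
  fixes S :: "real \<Rightarrow> complex poly" and T :: "complex poly" and F :: "real filter"
  assumes monic: "\<forall>t\<in>I. lead_coeff (S t) = 1 \<and> degree (S t) = n" and T: "degree T = n" "lead_coeff T = 1"
    and lim: "\<And>i. ((\<lambda>t. coeff (S t) i) \<longlongrightarrow> coeff T i) F"
    and g: "continuous_on I g" "\<forall>t\<in>I. poly (S t) (g t) = 0"
    and F: "F \<noteq> bot" "\<forall>\<^sub>F t in F. t \<in> I"
    and basis: "\<And>P. eventually P F \<Longrightarrow> \<exists>U. connected U \<and> U \<subseteq> I \<and> eventually (\<lambda>t. t \<in> U) F \<and> (\<forall>t\<in>U. P t)"
  shows "\<exists>r. poly T r = 0 \<and> (g \<longlongrightarrow> r) F"
proof -
  have "((\<lambda>t. poly T (g t)) \<longlongrightarrow> 0) F"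
  proof (rule limit_poly_at_roots_tendsto_0[OF _ T(1) lim])
    show "\<forall>\<^sub>F t in F. lead_coeff (S t) = 1 \<and> degree (S t) = n"
      using F(2) by eventually_elim (use monic in auto)
    show "\<forall>\<^sub>F t in F. poly (S t) (g t) = 0"
      using F(2) by eventually_elim (use g in auto)
  qed
  then have near: "\<forall>\<^sub>F t in F. \<exists>r\<in>{z. poly T z = 0}. dist (g t) r < \<epsilon>" if "\<epsilon> > 0" for \<epsilon>
    by (rule near_roots_if_values_tendsto_0[OF T(2) _ that])
  have "T \<noteq> 0" using T(2) by auto
  then have "finite {z. poly T z = 0}" by (rule poly_roots_finite)
  then have "\<exists>r\<in>{z. poly T z = 0}. (g \<longlongrightarrow> r) F"
    using tendsto_if_near_finite_set[OF g(1) _ F(1) near basis] by blast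
  then show ?thesis by blast
qed

text \<open>The limit of the factorisation counts multiplicities: the number of branches with a
  given limit is the order of that zero of \<open>T\<close>.\<close>

lemma prod_linear_limit:
  fixes S :: "'a \<Rightarrow> complex poly" and T :: "complex poly"
  assumes lim: "\<And>z. ((\<lambda>t. poly (S t) z) \<longlongrightarrow> poly T z) F" and F: "F \<noteq> bot"
    and ev: "\<forall>\<^sub>F t in F. S t = (\<Prod>j\<in>A. [:- Z j t, 1:])"
    and Z: "\<And>j. j \<in> A \<Longrightarrow> (Z j \<longlongrightarrow> E j) F"
  shows "T = (\<Prod>j\<in>A. [:- E j, 1:])"
proof -
  have "poly T z = poly (\<Prod>j\<in>A. [:- E j, 1:]) z" for z
  proof (rule tendsto_unique[OF F lim])
    have "((\<lambda>t. \<Prod>j\<in>A. z - Z j t) \<longlongrightarrow> (\<Prod>j\<in>A. z - E j)) F"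
      by (intro tendsto_intros Z)
    then have "((\<lambda>t. \<Prod>j\<in>A. z - Z j t) \<longlongrightarrow> poly (\<Prod>j\<in>A. [:- E j, 1:]) z) F"
      by (simp add: poly_prod)
    then show "((\<lambda>t. poly (S t) z) \<longlongrightarrow> poly (\<Prod>j\<in>A. [:- E j, 1:]) z) F"
    proof (rule Lim_transform_eventually)
      show "\<forall>\<^sub>F t in F. (\<Prod>j\<in>A. z - Z j t) = poly (S t) z"
        using ev by eventually_elim (simp add: poly_prod)
    qed
  qed
  then show ?thesis by (simp add: poly_eq_poly_eq_iff[symmetric] fun_eq_iff)
qed

lemma order_prod_linear:
  fixes r :: "'i \<Rightarrow> 'a::field"
  assumes "finite A"
  shows "order a (\<Prod>i\<in>A. [:- r i, 1:]) = card {i\<in>A. r i = a}"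
  using assms
proof (induction A)
  case (insert i A)
  have o: "order a [:- r i, 1:] = (if r i = a then 1 else 0)"
    using order_power_n_n[of a 1] by (auto simp: order_0I)
  have e: "{j\<in>insert i A. r j = a} = (if r i = a then insert i {j\<in>A. r j = a} else {j\<in>A. r j = a})"
    by auto
  have p: "(\<Prod>i\<in>insert i A. [:- r i, 1:]) = [:- r i, 1:] * (\<Prod>i\<in>A. [:- r i, 1:])"
    using insert by (intro prod.insert) auto
  have "[:- r i, 1:] * (\<Prod>i\<in>A. [:- r i, 1:]) \<noteq> 0"
    using insert by (subst p[symmetric], subst prod_zero_iff) auto
  then have "order a (\<Prod>i\<in>insert i A. [:- r i, 1:]) = order a [:- r i, 1:] + order a (\<Prod>i\<in>A. [:- r i, 1:])"
    unfolding p by (rule order_mult)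
  then show ?case using insert(1,2,3) o e by (simp del: prod.insert)
qed simp

text \<open>The factor with \<open>i = p + j\<close>, which equals \<open>t - p\<close>, is left out
  of the falling product. For \<open>p + j < n\<close> the value at \<open>t = p\<close> is
  therefore the derivative of \<open>sky_coeff n j\<close> there.\<close>

definition sky_slope :: "nat \<Rightarrow> nat \<Rightarrow> nat \<Rightarrow> real \<Rightarrow> real" where
  "sky_slope n p j t = real (n choose j) * ((\<Prod>i\<in>{0..<n} - {p + j}. t + real j - real i) / fact n) /
     ((t + real n) gchoose n)"

lemma sky_coeff_eq_slope:
  assumes "p + j < n"
  shows "sky_coeff n j t = (t - real p) * sky_slope n p j t"
proof -
  have "(\<Prod>i = 0..<n. t + real j - real i) = (t + real j - real (p + j)) * (\<Prod>i\<in>{0..<n} - {p + j}. t + real j - real i)"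
    by (rule prod.remove) (use assms in auto)
  then show ?thesis unfolding sky_coeff_def sky_slope_def gbinomial_prod_rev by simp
qed

lemma continuous_on_sky_slope: "continuous_on {-1<..} (sky_slope n p j)"
proof -
  have "(t + real n) gchoose n \<noteq> 0" if "t \<in> {-1<..}" for t
    using gchoose_shift_pos[of t n] that by simp
  then show ?thesis unfolding sky_slope_def
    by (intro continuous_on_divide[of _ _ "\<lambda>t. (t + real n) gchoose n"] continuous_on_gbinomial continuous_intros) auto
qed

text \<open>At \<open>t = p\<close> exactly the \<open>n - p - 1\<close> factors with
  \<open>i > p\<close> are negative.\<close>

lemma sky_slope_sign:
  assumes "p < n"
  shows "(-1) ^ (n - p - 1) * sky_slope n p 0 (real p) > 0"
proof -
  have s: "{0..<n} - {p + 0} = {0..<p} \<union> {p<..<n}" using assms by auto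
  have "(\<Prod>i\<in>{0..<n} - {p + 0}. real p + real 0 - real i) = (\<Prod>i\<in>{0..<p}. real p - real i) * (\<Prod>i\<in>{p<..<n}. real p - real i)"
    unfolding s by (subst prod.union_disjoint) auto
  also have "(\<Prod>i\<in>{p<..<n}. real p - real i) = (\<Prod>i\<in>{p<..<n}. (-1) * (real i - real p))" by simp
  also have "\<dots> = (-1) ^ (n - p - 1) * (\<Prod>i\<in>{p<..<n}. real i - real p)"
    unfolding prod.distrib by simp
  finally have e: "(\<Prod>i\<in>{0..<n} - {p + 0}. real p + real 0 - real i) =
    (-1) ^ (n - p - 1) * ((\<Prod>i\<in>{0..<p}. real p - real i) * (\<Prod>i\<in>{p<..<n}. real i - real p))" by simp
  have "(-1::real) ^ (n - p - 1) * (-1) ^ (n - p - 1) = 1" by (simp flip: power_mult_distrib)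
  then have "(-1) ^ (n - p - 1) * sky_slope n p 0 (real p) =
    ((\<Prod>i\<in>{0..<p}. real p - real i) * (\<Prod>i\<in>{p<..<n}. real i - real p)) / fact n / ((real p + real n) gchoose n)"
    unfolding sky_slope_def e by (simp flip: mult.assoc)
  also have "\<dots> > 0"
    by (intro divide_pos_pos mult_pos_pos prod_pos gchoose_shift_pos) auto
  finally show ?thesis .
qed

lemma sky_coeff_at_integer_pos:
  assumes "p \<le> n"
  shows "sky_coeff n (n - p) (real p) > 0"
proof -
  have "real p + real (n - p) = real n" using assms by simp
  moreover have "(real n gchoose n) > 0" by (rule gbinomial_pos_real) simp
  ultimately show ?thesis unfolding sky_coeff_def
    using gchoose_shift_pos[of "real p" n] assms by simp
qed

lemma skyburst_split:
  assumes "t > -1" "p \<le> n"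
  shows "poly (skyburst n t) z = of_real (t - real p) * (\<Sum>j<n - p. of_real (sky_slope n p j t) * z ^ j) +
     z ^ (n - p) * (\<Sum>j\<le>p. of_real (sky_coeff n (n - p + j) t) * z ^ j)"
proof -
  have "poly (skyburst n t) z = (\<Sum>j\<le>n. of_real (sky_coeff n j t) * z ^ j)"
    unfolding poly_altdef coeff_skyburst_top(2)[OF assms(1)] coeff_skyburst'[OF assms(1)] ..
  also have "\<dots> = (\<Sum>j<n - p. of_real (sky_coeff n j t) * z ^ j) + (\<Sum>j\<in>{n - p..n}. of_real (sky_coeff n j t) * z ^ j)"
    by (subst sum.union_disjoint[symmetric]) (auto intro!: sum.cong)
  also have "(\<Sum>j\<in>{n - p..n}. of_real (sky_coeff n j t) * z ^ j) = (\<Sum>j\<le>p. of_real (sky_coeff n (n - p + j) t) * z ^ (n - p + j))"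
    by (rule sum.reindex_bij_witness[of _ "\<lambda>j. n - p + j" "\<lambda>j. j - (n - p)"]) (use assms in auto)
  also have "\<dots> = z ^ (n - p) * (\<Sum>j\<le>p. of_real (sky_coeff n (n - p + j) t) * z ^ j)"
    unfolding sum_distrib_left by (intro sum.cong) (auto simp: power_add)
  also have "(\<Sum>j<n - p. of_real (sky_coeff n j t) * z ^ j) = of_real (t - real p) * (\<Sum>j<n - p. of_real (sky_slope n p j t) * z ^ j)"
    unfolding sum_distrib_left by (intro sum.cong) (auto simp: sky_coeff_eq_slope less_diff_conv add.commute)
  finally show ?thesis .
qed

lemma sum_times_zero_powers: "N > 0 \<Longrightarrow> (\<Sum>j<N. f j * (0::complex) ^ j) = f 0"
  by (cases N) (simp_all add: sum.lessThan_Suc_shift del: sum.lessThan_Suc)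

text \<open>Near \<open>t = p\<close> and \<open>z = 0\<close> the equation reads
  \<open>(t - p) * H1 + z ^ N * H2 = 0\<close> with \<open>N = n - p\<close>, where
  \<open>H1\<close> tends to \<open>D\<close> and \<open>H2\<close> to \<open>A\<close>. Hence the
  \<open>N\<close>-th power of \<open>z / \<delta>\<close> tends to \<open>w0 = - D / A\<close>, and
  a continuous branch must settle at one \<open>N\<close>-th root of \<open>w0\<close>.\<close>

lemma burst_scale:
  fixes Z :: "nat \<Rightarrow> real \<Rightarrow> complex" and E :: "nat \<Rightarrow> complex" and n p :: nat
  defines "\<delta> \<equiv> \<lambda>t. root (n - p) (t - real p)"
    and "w0 \<equiv> complex_of_real (- sky_slope n p 0 (real p) / sky_coeff n (n - p) (real p))"
  assumes pn: "p < n" and b: "real p < b"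
    and cont: "\<And>j. j < n \<Longrightarrow> continuous_on {real p<..<b} (Z j)"
    and prod: "\<And>t. t \<in> {real p<..<b} \<Longrightarrow> skyburst n t = (\<Prod>j<n. [:- Z j t, 1:])"
    and lim: "\<And>j. j < n \<Longrightarrow> (Z j \<longlongrightarrow> E j) (at_right (real p))"
    and card: "card {j. j < n \<and> E j = 0} = n - p"
  shows "\<exists>L. (\<forall>j<n. E j = 0 \<longrightarrow> L j ^ (n - p) = w0 \<and>
      ((\<lambda>t. Z j t / of_real (\<delta> t)) \<longlongrightarrow> L j) (at_right (real p))) \<and>
     (\<forall>w. w ^ (n - p) = w0 \<longrightarrow> (\<exists>j<n. E j = 0 \<and> L j = w))"
proof -
  let ?F = "at_right (real p)"
  define N where "N = n - p"
  have N: "N > 0" using pn by (simp add: N_def)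
  define D where "D = sky_slope n p 0 (real p)"
  define A where "A = sky_coeff n (n - p) (real p)"
  have A: "A > 0" unfolding A_def using pn by (intro sky_coeff_at_integer_pos) simp
  define H1 where "H1 = (\<lambda>t z. \<Sum>j<N. complex_of_real (sky_slope n p j t) * z ^ j)"
  define H2 where "H2 = (\<lambda>t z. \<Sum>j\<le>p. complex_of_real (sky_coeff n (N + j) t) * z ^ j)"
  have split: "poly (skyburst n t) z = of_real (t - real p) * H1 t z + z ^ N * H2 t z" if "t > -1" for t z
    unfolding H1_def H2_def N_def by (rule skyburst_split) (use that pn in auto)
  have H1lim: "((\<lambda>t. H1 t (z t)) \<longlongrightarrow> of_real D) ?F" if "(z \<longlongrightarrow> 0) ?F" for z
  proof -
    have "((\<lambda>t. H1 t (z t)) \<longlongrightarrow> (\<Sum>j<N. complex_of_real (sky_slope n p j (real p)) * 0 ^ j)) ?F"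
      unfolding H1_def
      by (intro tendsto_intros that tendsto_within_if_continuous_on_open[OF continuous_on_sky_slope]) auto
    then show ?thesis unfolding sum_times_zero_powers[OF N] D_def .
  qed
  have H2lim: "((\<lambda>t. H2 t (z t)) \<longlongrightarrow> of_real A) ?F" if "(z \<longlongrightarrow> 0) ?F" for z
  proof -
    have "((\<lambda>t. H2 t (z t)) \<longlongrightarrow> (\<Sum>j\<le>p. complex_of_real (sky_coeff n (N + j) (real p)) * 0 ^ j)) ?F"
      unfolding H2_def
      by (intro tendsto_intros that tendsto_within_if_continuous_on_open[OF continuous_on_sky_coeff]) auto
    then show ?thesis
      using sum_times_zero_powers[of "Suc p" "\<lambda>j. complex_of_real (sky_coeff n (N + j) (real p))"]
      unfolding lessThan_Suc_atMost A_def by (simp add: N_def)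
  qed
  have evI: "\<forall>\<^sub>F t in ?F. t \<in> {real p<..<b}" by (rule eventually_at_right_real[OF b])
  have \<delta>pos: "\<delta> t > 0" "\<delta> t ^ N = t - real p" if "t \<in> {real p<..<b}" for t
    using that N unfolding \<delta>_def N_def by (auto intro: real_root_gt_zero)
  have \<delta>lim: "((\<lambda>t. of_real (\<delta> t) :: complex) \<longlongrightarrow> 0) ?F"
  proof -
    have "((\<lambda>t. complex_of_real (\<delta> t)) \<longlongrightarrow> of_real (root (n - p) (real p - real p))) ?F"
      unfolding \<delta>_def by (intro tendsto_intros)
    then show ?thesis by simp
  qed
  have w0: "w0 = - (of_real D / of_real A)" unfolding w0_def D_def A_def by simp
  have root: "poly (skyburst n t) (Z j t) = 0" if "j < n" "t \<in> {real p<..<b}" for j t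
    unfolding prod[OF that(2)] poly_prod using that(1) by (auto intro!: prod_zero)
  have powlim: "((\<lambda>t. (Z j t / of_real (\<delta> t)) ^ N) \<longlongrightarrow> w0) ?F" if j: "j < n" "E j = 0" for j
  proof -
    have Z0: "(Z j \<longlongrightarrow> 0) ?F" using lim[OF j(1)] j(2) by simp
    have ne: "\<forall>\<^sub>F t in ?F. H2 t (Z j t) \<noteq> 0"
      using tendsto_imp_eventually_ne[OF H2lim[OF Z0]] A by simp
    have "((\<lambda>t. - (H1 t (Z j t) / H2 t (Z j t))) \<longlongrightarrow> w0) ?F"
      unfolding w0 by (intro tendsto_intros H1lim H2lim Z0) (use A in simp)
    then show ?thesis
    proof (rule Lim_transform_eventually)
      show "\<forall>\<^sub>F t in ?F. - (H1 t (Z j t) / H2 t (Z j t)) = (Z j t / of_real (\<delta> t)) ^ N"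
        using ne evI
      proof eventually_elim
        case (elim t)
        have "of_real (t - real p) * H1 t (Z j t) + Z j t ^ N * H2 t (Z j t) = 0"
          using split[of t "Z j t"] root[OF j(1) elim(2)] elim(2) by simp
        moreover have "(Z j t / of_real (\<delta> t)) ^ N = Z j t ^ N / of_real (t - real p)"
          unfolding power_divide using \<delta>pos(2)[OF elim(2)] by (metis of_real_power)
        moreover have "complex_of_real (t - real p) \<noteq> 0" using elim(2) by (simp del: of_real_diff)
        moreover have "- (h1 / h2) = z / e" if "e * h1 + z * h2 = 0" "e \<noteq> 0" "h2 \<noteq> 0" for e h1 h2 z :: complex
        proof -
          have "z * h2 = - h1 * e" using that(1) by (simp add: add_eq_0_iff2 mult.commute)
          then show ?thesis using that(2,3) by (metis frac_eq_eq minus_divide_left)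
        qed
        ultimately show ?case using elim(1) by metis
      qed
    qed
  qed
  define Q where "Q = monom 1 N + [:- w0:]"
  have Qpoly: "poly Q z = z ^ N - w0" for z by (simp add: Q_def poly_monom)
  have Qdeg: "degree Q = N"
  proof -
    have "degree [:- w0:] < degree (monom (1::complex) N)" using N by (simp add: degree_monom_eq)
    then show ?thesis unfolding Q_def by (subst degree_add_eq_left) (simp_all add: degree_monom_eq)
  qed
  have Qlead: "lead_coeff Q = 1"
    unfolding Qdeg using N by (cases N) (simp_all add: Q_def)
  have "\<exists>l. l ^ N = w0 \<and> ((\<lambda>t. Z j t / of_real (\<delta> t)) \<longlongrightarrow> l) ?F" if j: "j < n" "E j = 0" for j
  proof -
    have "((\<lambda>t. poly Q (Z j t / of_real (\<delta> t))) \<longlongrightarrow> w0 - w0) ?F"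
      unfolding Qpoly by (intro tendsto_intros powlim j)
    then have "((\<lambda>t. poly Q (Z j t / of_real (\<delta> t))) \<longlongrightarrow> 0) ?F" by simp
    then have near: "\<forall>\<^sub>F t in ?F. \<exists>r\<in>{z. poly Q z = 0}. dist (Z j t / of_real (\<delta> t)) r < \<epsilon>" if "\<epsilon> > 0" for \<epsilon>
      by (rule near_roots_if_values_tendsto_0[OF Qlead _ that])
    have fin: "finite {z. poly Q z = 0}" using Qlead by (intro poly_roots_finite) auto
    have "continuous_on {real p<..<b} (\<lambda>t. Z j t / of_real (\<delta> t))"
    proof (intro continuous_on_divide cont j ballI)
      show "continuous_on {real p<..<b} (\<lambda>t. complex_of_real (\<delta> t))"
        unfolding \<delta>_def by (intro continuous_intros)
      show "complex_of_real (\<delta> t) \<noteq> 0" if "t \<in> {real p<..<b}" for t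
        using \<delta>pos(1)[OF that] by simp
    qed
    then have "\<exists>r\<in>{z. poly Q z = 0}. ((\<lambda>t. Z j t / of_real (\<delta> t)) \<longlongrightarrow> r) ?F"
      using tendsto_if_near_finite_set[OF _ fin _ near at_right_connected_basis[OF b]] by simp
    then show ?thesis unfolding Qpoly by simp
  qed
  then have "\<forall>j. \<exists>l. j < n \<and> E j = 0 \<longrightarrow> l ^ N = w0 \<and> ((\<lambda>t. Z j t / of_real (\<delta> t)) \<longlongrightarrow> l) ?F"
    by blast
  from choice[OF this] obtain L where L: "\<And>j. j < n \<Longrightarrow> E j = 0 \<Longrightarrow> L j ^ N = w0"
    "\<And>j. j < n \<Longrightarrow> E j = 0 \<Longrightarrow> ((\<lambda>t. Z j t / of_real (\<delta> t)) \<longlongrightarrow> L j) ?F"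
    by blast
  define K where "K = {j. j < n \<and> E j = 0}"
  have K: "finite K" "card K = N" "K \<subseteq> {..<n}" using card by (auto simp: K_def N_def)
  \<comment> \<open>The value of the polynomial at \<open>\<delta> * w\<close>, divided by
    \<open>\<delta> ^ N\<close>, has two limits: \<open>D + w0 * A = 0\<close> from the split, and
    from the factorisation the product of all \<open>w - L j\<close> times a nonzero contribution of
    the branches starting elsewhere.\<close>
  have surj: "\<exists>j<n. E j = 0 \<and> L j = w" if w: "w ^ N = w0" for w
  proof -
    have zlim: "((\<lambda>t. of_real (\<delta> t) * w) \<longlongrightarrow> 0) ?F"
      using tendsto_mult[OF \<delta>lim tendsto_const[of w]] by simp
    have l1: "((\<lambda>t. H1 t (of_real (\<delta> t) * w) + w0 * H2 t (of_real (\<delta> t) * w)) \<longlongrightarrow> of_real D + w0 * of_real A) ?F"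
      by (intro tendsto_intros H1lim H2lim zlim)
    have "of_real D + w0 * of_real A = 0" unfolding w0 using A by simp
    moreover have "((\<lambda>t. (\<Prod>j\<in>K. w - Z j t / of_real (\<delta> t)) * (\<Prod>j\<in>{..<n} - K. of_real (\<delta> t) * w - Z j t)) \<longlongrightarrow>
      (\<Prod>j\<in>K. w - L j) * (\<Prod>j\<in>{..<n} - K. 0 - E j)) ?F"
      by (intro tendsto_intros L(2) zlim lim) (auto simp: K_def)
    moreover have "\<forall>\<^sub>F t in ?F. (\<Prod>j\<in>K. w - Z j t / of_real (\<delta> t)) * (\<Prod>j\<in>{..<n} - K. of_real (\<delta> t) * w - Z j t) =
      H1 t (of_real (\<delta> t) * w) + w0 * H2 t (of_real (\<delta> t) * w)"
      using evI
    proof eventually_elim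
      case (elim t)
      define d where "d = complex_of_real (\<delta> t)"
      have d: "d \<noteq> 0" "d ^ N = of_real (t - real p)"
        using \<delta>pos[OF elim] unfolding d_def by (auto simp flip: of_real_power)
      have "(\<Prod>j<n. d * w - Z j t) = (\<Prod>j\<in>K. d * w - Z j t) * (\<Prod>j\<in>{..<n} - K. d * w - Z j t)"
        using prod.subset_diff[OF K(3), of "\<lambda>j. d * w - Z j t"] by (simp add: mult.commute)
      also have "(\<Prod>j\<in>K. d * w - Z j t) = (\<Prod>j\<in>K. d * (w - Z j t / d))"
        using d by (simp add: right_diff_distrib)
      also have "\<dots> = d ^ N * (\<Prod>j\<in>K. w - Z j t / d)" unfolding prod.distrib using K by simp
      finally have "poly (skyburst n t) (d * w) = d ^ N * ((\<Prod>j\<in>K. w - Z j t / d) * (\<Prod>j\<in>{..<n} - K. d * w - Z j t))"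
        unfolding prod[OF elim] by (simp add: poly_prod mult.assoc)
      moreover have "poly (skyburst n t) (d * w) = d ^ N * (H1 t (d * w) + w0 * H2 t (d * w))"
        using split[of t "d * w"] elim d(2) w by (simp add: algebra_simps power_mult_distrib del: of_real_diff)
      ultimately have "(\<Prod>j\<in>K. w - Z j t / d) * (\<Prod>j\<in>{..<n} - K. d * w - Z j t) = H1 t (d * w) + w0 * H2 t (d * w)"
        using d(1) by simp
      then show ?case unfolding d_def .
    qed
    ultimately have "(\<Prod>j\<in>K. w - L j) * (\<Prod>j\<in>{..<n} - K. 0 - E j) = 0"
      using tendsto_unique[OF trivial_limit_at_right_real Lim_transform_eventually l1] by presburger
    moreover have "(\<Prod>j\<in>{..<n} - K. 0 - E j) \<noteq> 0" by (subst prod_zero_iff) (auto simp: K_def)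
    ultimately have "\<exists>j\<in>K. w - L j = 0" using K(1) by (simp add: prod_zero_iff)
    then show ?thesis by (auto simp: K_def)
  qed
  show ?thesis
    unfolding N_def[symmetric] by (intro exI[of _ L] conjI allI impI L surj)
qed

subsection \<open>Trajectories\<close>

lemma order_skyburst_integer:
  assumes "p \<le> n" "n > 0"
  shows "\<exists>\<Gamma>. finite \<Gamma> \<and> \<Gamma> \<subseteq> {-1<..<0} \<and>
    (\<forall>z. order z (skyburst n (real p)) = (if z = 0 then n - p else if z \<in> complex_of_real ` \<Gamma> then 1 else 0))"
proof -
  obtain \<Gamma> where G: "finite \<Gamma>" "\<Gamma> \<subseteq> {-1<..<0}"
    "skyburst n (real p) = [:0, 1:] ^ (n - p) * (\<Prod>a\<in>\<Gamma>. [:- complex_of_real a, 1:])"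
    using skyburst_integer_prod[OF assms] by blast
  have "order z (skyburst n (real p)) = (if z = 0 then n - p else if z \<in> complex_of_real ` \<Gamma> then 1 else 0)" for z
  proof -
    have ne: "skyburst n (real p) \<noteq> 0" by (rule coeff_skyburst_top(3)) simp
    have o1: "order z ([:0, 1:] ^ (n - p)) = (if z = 0 then n - p else 0)"
      using order_power_n_n[of 0 "n - p"] by (auto simp: order_0I)
    have "order z (\<Prod>a\<in>\<Gamma>. [:- complex_of_real a, 1:]) = card {a \<in> \<Gamma>. complex_of_real a = z}"
      by (rule order_prod_linear[OF G(1)])
    also have "{a \<in> \<Gamma>. complex_of_real a = z} = (if z \<in> complex_of_real ` \<Gamma> then {Re z} else {})"
      by auto
    finally have o2: "order z (\<Prod>a\<in>\<Gamma>. [:- complex_of_real a, 1:]) = (if z \<in> complex_of_real ` \<Gamma> then 1 else 0)"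
      by simp
    have z0: "0 \<notin> complex_of_real ` \<Gamma>" using G(2) by auto
    have "order z (skyburst n (real p)) = order z ([:0, 1:] ^ (n - p)) + order z (\<Prod>a\<in>\<Gamma>. [:- complex_of_real a, 1:])"
      using ne unfolding G(3) by (rule order_mult)
    then show ?thesis unfolding o1 o2 using z0 by auto
  qed
  then show ?thesis using G by blast
qed

lemma order_pos_iff_root: "p \<noteq> 0 \<Longrightarrow> 0 < order z p \<longleftrightarrow> poly p z = 0"
  by (simp add: order_root)

lemma stays_above:
  fixes f :: "real \<Rightarrow> real"
  assumes "a < b" "continuous_on {a<..<b} f" "\<And>t. a < t \<Longrightarrow> t < b \<Longrightarrow> f t \<noteq> c"
    "\<forall>\<^sub>F t in at_right a. f t > c" "a < t" "t < b"
  shows "f t > c"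
proof (rule ccontr)
  assume "\<not> f t > c"
  then have ft: "f t < c" using assms(3)[OF assms(5,6)] by simp
  obtain d where d: "d > a" "\<And>s. a < s \<Longrightarrow> s < d \<Longrightarrow> f s > c"
    using assms(4) unfolding eventually_at_right_field by blast
  define s where "s = (a + min d t) / 2"
  have s: "a < s" "s < d" "s < t" using d(1) assms(5) by (auto simp: s_def min_def)
  have "\<exists>x\<ge>s. x \<le> t \<and> f x = c"
    by (rule IVT2') (use s d ft assms(6) in \<open>auto intro!: continuous_on_subset[OF assms(2)] simp: less_imp_le\<close>)
  then obtain x where "s \<le> x" "x \<le> t" "f x = c" by blast
  then show False using assms(3)[of x] s(1) assms(6) by simp
qed

lemma tendsto_imp_continuous_on_closed:
  fixes f :: "real \<Rightarrow> 'a::topological_space"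
  assumes "a < b" "continuous_on {a<..<b} f" "(f \<longlongrightarrow> u) (at_right a)" "(f \<longlongrightarrow> v) (at_left b)"
  shows "continuous_on {a..b} (\<lambda>t. if t = a then u else if t = b then v else f t)"
    (is "continuous_on _ ?g")
  unfolding continuous_on_def
proof
  fix t assume t: "t \<in> {a..b}"
  consider "t = a" | "t = b" | "a < t" "t < b" using t by fastforce
  then show "(?g \<longlongrightarrow> ?g t) (at t within {a..b})"
  proof cases
    case 1
    have "(?g \<longlongrightarrow> u) (at_right a)"
    proof (rule Lim_transform_eventually[OF assms(3)])
      show "\<forall>\<^sub>F t in at_right a. f t = ?g t"
        using eventually_at_right_real[OF assms(1)] by eventually_elim auto
    qed
    then show ?thesis using 1 assms(1) by (simp add: at_within_Icc_at_right)
  next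
    case 2
    have "(?g \<longlongrightarrow> v) (at_left b)"
    proof (rule Lim_transform_eventually[OF assms(4)])
      show "\<forall>\<^sub>F t in at_left b. f t = ?g t"
        using eventually_at_left_real[OF assms(1)] by eventually_elim auto
    qed
    then show ?thesis using 2 assms(1) by (simp add: at_within_Icc_at_left)
  next
    case 3
    have "(f \<longlongrightarrow> f t) (at t)"
      using assms(2) 3 by (metis at_within_open continuous_on_def greaterThanLessThan_iff open_greaterThanLessThan)
    then have "(?g \<longlongrightarrow> f t) (at t)"
    proof (rule Lim_transform_eventually)
      have "\<forall>\<^sub>F s in at t. s \<in> {a<..<b}"
        using 3 by (intro eventually_at_in_open') auto
      then show "\<forall>\<^sub>F s in at t. f s = ?g s" by eventually_elim auto
    qed
    then show ?thesis using 3 by (auto intro: tendsto_within_subset)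
  qed
qed

lemma cis_burst_angle: "cis (burst_angle k j) = - cis (2 * pi * real j / real (k + 1))"
  unfolding burst_angle_def by (simp add: cis_mult[symmetric] mult_ac)

lemma inj_on_cis_roots:
  assumes "N > 0"
  shows "inj_on (\<lambda>j. cis (2 * pi * real j / real N)) {1..N}"
proof (rule inj_onI)
  fix i j assume ij: "i \<in> {1..N}" "j \<in> {1..N}" "cis (2 * pi * real i / real N) = cis (2 * pi * real j / real N)"
  \<comment> \<open>The reflection of \<open>l\<close> to \<open>N - l\<close> carries
    \<open>{1..N}\<close> to the usual index set \<open>{..<N}\<close> and acts on the roots of
    unity as conjugation.\<close>
  have e: "cis (2 * pi * real (N - l) / real N) = cnj (cis (2 * pi * real l / real N))" if "l \<in> {1..N}" for l
  proof -
    have "2 * pi * real (N - l) / real N = 2 * pi - 2 * pi * real l / real N"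
      using that assms by (simp add: of_nat_diff field_simps)
    then show ?thesis by (simp add: cis_cnj cis_divide[symmetric] divide_conv_cnj)
  qed
  have inj: "inj_on (\<lambda>k. cis (2 * pi * real k / real N)) {..<N}"
    using Complex.bij_betw_roots_unity[OF assms] by (simp add: bij_betw_def)
  have "N - i = N - j"
  proof (rule inj_onD[OF inj])
    show "cis (2 * pi * real (N - i) / real N) = cis (2 * pi * real (N - j) / real N)"
      unfolding e[OF ij(1)] e[OF ij(2)] ij(3) ..
  qed (use ij assms in auto)
  then show "i = j" using ij by auto
qed

text \<open>Each direction is the negative of a root of unity, which produces
  \<open>(-1) ^ (k + 1)\<close> in the power; injectivity and the number of roots do the rest. Index
  \<open>k + 1\<close> is the negative ray.\<close>

lemma burst_directions:
  fixes k :: nat and C :: real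
  defines "w \<equiv> \<lambda>j. complex_of_real (root (k + 1) C) * cis (burst_angle k j)"
  assumes C: "C > 0"
  shows "bij_betw w {1..k + 1} {z. z ^ (k + 1) = of_real ((-1) ^ (k + 1) * C)}"
proof -
  let ?N = "k + 1"
  let ?R = "{z. z ^ ?N = complex_of_real ((-1) ^ ?N * C)}"
  have r: "root ?N C > 0" "root ?N C ^ ?N = C" using C real_root_pow_pos2[of ?N C] by (auto intro: real_root_gt_zero)
  have "inj_on w {1..?N}"
  proof (rule inj_onI)
    fix i j assume ij: "i \<in> {1..?N}" "j \<in> {1..?N}" "w i = w j"
    then have "cis (2 * pi * real i / real ?N) = cis (2 * pi * real j / real ?N)"
      using r(1) unfolding w_def cis_burst_angle by simp
    then show "i = j" using inj_onD[OF inj_on_cis_roots[of ?N]] ij by simp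
  qed
  moreover have "w j \<in> ?R" for j
  proof -
    have "cis (2 * pi * real j / real ?N) ^ ?N = 1"
    proof -
      have e: "real ?N * (2 * pi * real j / real ?N) = 2 * pi * real j" by (simp del: of_nat_add of_nat_Suc)
      show ?thesis unfolding Complex.DeMoivre e by (rule cis_multiple_2pi) simp
    qed
    then have "w j ^ ?N = of_real (root ?N C ^ ?N) * (-1) ^ ?N"
      unfolding w_def cis_burst_angle power_mult_distrib power_minus[of "cis _"] by simp
    then show ?thesis unfolding r(2) by simp
  qed
  moreover have "card ?R = ?N" by (rule card_nth_roots) (use C in auto)
  moreover have "finite ?R" using \<open>card ?R = ?N\<close> by (metis card.infinite add_is_0 one_neq_zero)
  ultimately show ?thesis
    by (intro bij_betw_imageI card_subset_eq) (auto simp: card_image)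
qed

text \<open>Division by a positive scale does not change \<open>sgn\<close>, so a nonzero limit of
  the rescaled branch determines its direction.\<close>

lemma bursts_scaled:
  fixes g :: "real \<Rightarrow> complex"
  assumes "g a = 0" "\<forall>\<^sub>F t in at_right a. g t \<noteq> 0" "\<forall>\<^sub>F t in at_right a. \<delta> t > (0::real)"
    "((\<lambda>t. g t / of_real (\<delta> t)) \<longlongrightarrow> of_real r * cis \<theta>) (at_right a)" "r > 0"
  shows "bursts_from_origin_at_angle g a \<theta>"
proof -
  have "((\<lambda>t. sgn (g t / of_real (\<delta> t))) \<longlongrightarrow> sgn (of_real r * cis \<theta>)) (at_right a)"
    by (rule tendsto_sgn[OF assms(4)]) (use assms(5) in simp)
  moreover have "sgn (of_real r * cis \<theta>) = cis \<theta>"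
    using assms(5) by (simp add: sgn_mult sgn_of_real sgn_cis)
  moreover have "\<forall>\<^sub>F t in at_right a. sgn (g t / of_real (\<delta> t)) = sgn (g t)"
    using assms(3) by eventually_elim (simp add: sgn_divide sgn_of_real)
  ultimately have "((\<lambda>t. sgn (g t)) \<longlongrightarrow> cis \<theta>) (at_right a)"
    by (metis Lim_transform_eventually)
  then show ?thesis using assms(1,2) by (simp add: bursts_from_origin_at_angle_def)
qed

text \<open>\<open>p\<close> stands for \<open>m - 1\<close>. Conjugation decides which branches are
  real. At \<open>p + 1\<close> only \<open>k\<close> branches can end at the origin; the
  \<open>k\<close> loops use them all, so the other branches end away from it.\<close>

lemma skyburst_burst:
  fixes n p :: nat
  assumes pn: "Suc p < n"
  defines "k \<equiv> n - Suc p"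
  shows "\<exists>Z. zero_trajectories n {real p..real (Suc p)} Z \<and>
    (\<forall>j\<in>{1..k}.
       bursts_from_origin_at_angle (Z j) (real p) (burst_angle k j) \<and>
       loop_at_origin (Z j) (real p) (real (Suc p)) \<and>
       (if bursts_from_origin_at_angle (Z j) (real p) 0
        then flattened_loop (Z j) (real p) (real (Suc p))
        else \<forall>t\<in>{real p<..<real (Suc p)}. Z j t \<notin> \<real>)) \<and>
    (odd k \<longrightarrow> (\<exists>j\<in>{1..k}. bursts_from_origin_at_angle (Z j) (real p) 0)) \<and>
    (\<forall>j\<in>{k + 1..n}. \<forall>t\<in>{real p..real (Suc p)}.
       Z j t \<in> complex_of_real ` {-1<..<0} \<or> (t = real p \<and> j = k + 1 \<and> Z j t = 0))"
proof -
  define a b where "a = real p" and "b = real (Suc p)"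
  define I where "I = {a<..<b}"
  let ?S = "skyburst n"
  have ab: "a < b" "a \<ge> 0" by (auto simp: a_def b_def)
  have nk: "n - p = k + 1" "k \<ge> 1" "k + 1 \<le> n" using pn by (auto simp: k_def)
  have I1: "t > -1" if "t \<in> I" for t using that ab by (auto simp: I_def)
  have Int: "t \<noteq> real i" if "t \<in> I" for t i
  proof
    assume "t = real i"
    then have "real p < real i" "real i < real (Suc p)" using that by (auto simp: I_def a_def b_def)
    then show False unfolding of_nat_less_iff by simp
  qed
  have monic: "\<forall>t\<in>I. lead_coeff (?S t) = 1 \<and> degree (?S t) = n"
    using coeff_skyburst_top I1 by auto
  have zero_ne: "z \<noteq> 0" "z \<noteq> -1" if "t \<in> I" "poly (?S t) z = 0" for t z
    using skyburst_zero_not_0_minus1[OF I1[OF that(1)] Int[OF that(1)] that(2)] by auto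
  have n0: "n > 0" using pn by simp
  have contS: "\<forall>z. continuous_on I (\<lambda>t. poly (?S t) z)"
    using ab unfolding I_def by (intro allI continuous_on_subset[OF continuous_on_poly_skyburst]) auto
  have cardS: "\<forall>t\<in>I. card {z. poly (?S t) z = 0} = n" using card_roots_skyburst[OF I1 Int] by blast

  \<comment> \<open>Branches over the open interval\<close>
  obtain Z where Zc: "\<And>j. j < n \<Longrightarrow> continuous_on I (Z j)"
    and Zinj: "\<And>t. t \<in> I \<Longrightarrow> inj_on (\<lambda>j. Z j t) {..<n}"
    and Zim: "\<And>t. t \<in> I \<Longrightarrow> (\<lambda>j. Z j t) ` {..<n} = {z. poly (?S t) z = 0}"
    and Zall: "\<And>h. continuous_on I h \<Longrightarrow> \<forall>t\<in>I. poly (?S t) (h t) = 0 \<Longrightarrow> \<exists>j<n. \<forall>t\<in>I. h t = Z j t"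
    unfolding I_def by (rule root_branches[OF ab(1) n0 monic[unfolded I_def] contS[unfolded I_def] cardS[unfolded I_def]])
      (rule that[unfolded I_def])
  have Zroot: "poly (?S t) (Z j t) = 0" if "j < n" "t \<in> I" for j t
    using Zim[OF that(2)] that(1) by blast
  have Zprod: "?S t = (\<Prod>j<n. [:- Z j t, 1:])" if w: "t \<in> I" for t
  proof -
    have "?S t = (\<Prod>z\<in>(\<lambda>j. Z j t) ` {..<n}. [:- z, 1:])"
      by (rule monic_poly_eq_prod_roots)
        (use monic w Zroot card_image[OF Zinj[OF w]] in auto)
    then show ?thesis by (simp add: prod.reindex[OF Zinj[OF w]])
  qed
  have evI: "\<forall>\<^sub>F t in at_right a. t \<in> I" "\<forall>\<^sub>F t in at_left b. t \<in> I"
    unfolding I_def by (intro eventually_at_right_real eventually_at_left_real ab)+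

  \<comment> \<open>Limits at both ends, with multiplicity\<close>
  have "\<exists>r. poly (?S a) r = 0 \<and> (Z j \<longlongrightarrow> r) (at_right a)" if "j < n" for j
  proof (rule branch_limit[OF monic])
    show "continuous_on I (Z j)" "\<forall>t\<in>I. poly (?S t) (Z j t) = 0" using Zc Zroot that by auto
    show "\<exists>U. connected U \<and> U \<subseteq> I \<and> eventually (\<lambda>t. t \<in> U) (at_right a) \<and> (\<forall>t\<in>U. P t)"
      if "eventually P (at_right a)" for P
      using at_right_connected_basis[OF ab(1) that] by (simp add: I_def)
  qed (use ab evI coeff_skyburst_top[of a n] in \<open>auto intro!: tendsto_within_if_continuous_on_open[OF continuous_on_coeff_skyburst]\<close>)
  then obtain E where E: "\<And>j. j < n \<Longrightarrow> poly (?S a) (E j) = 0" "\<And>j. j < n \<Longrightarrow> (Z j \<longlongrightarrow> E j) (at_right a)"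
    by metis
  have "\<exists>r. poly (?S b) r = 0 \<and> (Z j \<longlongrightarrow> r) (at_left b)" if "j < n" for j
  proof (rule branch_limit[OF monic])
    show "continuous_on I (Z j)" "\<forall>t\<in>I. poly (?S t) (Z j t) = 0" using Zc Zroot that by auto
    show "\<exists>U. connected U \<and> U \<subseteq> I \<and> eventually (\<lambda>t. t \<in> U) (at_left b) \<and> (\<forall>t\<in>U. P t)"
      if "eventually P (at_left b)" for P
      using at_left_connected_basis[OF ab(1) that] by (simp add: I_def)
  qed (use ab evI coeff_skyburst_top[of b n] in \<open>auto intro!: tendsto_within_if_continuous_on_open[OF continuous_on_coeff_skyburst]\<close>)
  then obtain E' where E': "\<And>j. j < n \<Longrightarrow> poly (?S b) (E' j) = 0" "\<And>j. j < n \<Longrightarrow> (Z j \<longlongrightarrow> E' j) (at_left b)"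
    by metis
  have polylim: "((\<lambda>t. poly (?S t) z) \<longlongrightarrow> poly (?S c) z) (at c within A)" if "c \<in> {a, b}" for c z A
    using that ab by (intro tendsto_within_if_continuous_on_open[OF continuous_on_poly_skyburst]) auto
  have prodE: "?S a = (\<Prod>j<n. [:- E j, 1:])"
  proof (rule prod_linear_limit)
    show "\<forall>\<^sub>F t in at_right a. ?S t = (\<Prod>j<n. [:- Z j t, 1:])"
      using evI(1) by eventually_elim (rule Zprod)
  qed (use polylim E in auto)
  have prodE': "?S b = (\<Prod>j<n. [:- E' j, 1:])"
  proof (rule prod_linear_limit)
    show "\<forall>\<^sub>F t in at_left b. ?S t = (\<Prod>j<n. [:- Z j t, 1:])"
      using evI(2) by eventually_elim (rule Zprod)
  qed (use polylim E' in auto)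
  obtain \<Gamma> where \<Gamma>: "\<Gamma> \<subseteq> {-1<..<0}" "\<And>z. order z (?S a) = (if z = 0 then n - p else if z \<in> complex_of_real ` \<Gamma> then 1 else 0)"
    using order_skyburst_integer[of p n] pn unfolding a_def by auto
  obtain \<Gamma>' where \<Gamma>': "\<Gamma>' \<subseteq> {-1<..<0}" "\<And>z. order z (?S b) = (if z = 0 then n - Suc p else if z \<in> complex_of_real ` \<Gamma>' then 1 else 0)"
    using order_skyburst_integer[of "Suc p" n] pn unfolding b_def by auto
  have cardE: "card {j. j < n \<and> E j = z} = (if z = 0 then k + 1 else if z \<in> complex_of_real ` \<Gamma> then 1 else 0)" for z
    using \<Gamma>(2)[of z] order_prod_linear[of "{..<n}" z E] unfolding prodE nk(1) by simp
  have cardE': "card {j. j < n \<and> E' j = z} = (if z = 0 then k else if z \<in> complex_of_real ` \<Gamma>' then 1 else 0)" for z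
    using \<Gamma>'(2)[of z] order_prod_linear[of "{..<n}" z E'] unfolding prodE' k_def by simp
  have E\<Gamma>: "E j \<in> complex_of_real ` {-1<..<0}" if "j < n" "E j \<noteq> 0" for j
  proof -
    have "?S a \<noteq> 0" using coeff_skyburst_top(3)[of a n] ab by simp
    then have "0 < order (E j) (?S a)" using E(1)[OF that(1)] by (simp add: order_pos_iff_root)
    then show ?thesis using \<Gamma> that(2) by (auto split: if_splits)
  qed
  have E'\<Gamma>: "E' j \<in> complex_of_real ` {-1<..<0}" if "j < n" "E' j \<noteq> 0" for j
  proof -
    have "?S b \<noteq> 0" using coeff_skyburst_top(3)[of b n] ab by simp
    then have "0 < order (E' j) (?S b)" using E'(1)[OF that(1)] by (simp add: order_pos_iff_root)
    then show ?thesis using \<Gamma>' that(2) by (auto split: if_splits)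
  qed
  have card_le1: "i = j" if "card A \<le> 1" "finite A" "i \<in> A" "j \<in> A" for i j :: nat and A
    using that by (metis card_le_Suc0_iff_eq One_nat_def)
  have Einj: "i = j" if "i < n" "j < n" "E i = E j" "E i \<noteq> 0" for i j
    by (rule card_le1[of "{l. l < n \<and> E l = E i}"]) (use that cardE[of "E i"] in auto)
  have E'inj: "i = j" if "i < n" "j < n" "E' i = E' j" "E' i \<noteq> 0" for i j
    by (rule card_le1[of "{l. l < n \<and> E' l = E' i}"]) (use that cardE'[of "E' i"] in auto)

  \<comment> \<open>Leading behaviour at the left end\<close>
  define C where "C = (-1) ^ k * sky_slope n p 0 a / sky_coeff n (n - p) a"
  have C: "C > 0"
    unfolding C_def a_def using sky_slope_sign[of p n] sky_coeff_at_integer_pos[of p n] pn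
    by (simp add: k_def)
  define \<delta> where "\<delta> = (\<lambda>t. root (n - p) (t - a))"
  have \<delta>: "\<forall>\<^sub>F t in at_right a. \<delta> t > 0"
    using evI(1) by eventually_elim (use pn in \<open>auto simp: \<delta>_def I_def intro: real_root_gt_zero\<close>)
  \<comment> \<open>\<open>sky_slope\<close> has sign \<open>(-1) ^ k\<close> because
    \<open>n - p - 1 = k\<close>; the minus sign of the quotient raises the exponent to
    \<open>k + 1\<close>.\<close>
  have sg: "- sky_slope n p 0 a / sky_coeff n (n - p) a = (-1) ^ (k + 1) * C"
  proof -
    have "(-1::real) ^ k * (-1) ^ k = 1" by (simp flip: power_mult_distrib)
    then have "(-1) ^ k * C = sky_slope n p 0 a / sky_coeff n (n - p) a"
      unfolding C_def by (simp flip: mult.assoc)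
    then show ?thesis by simp
  qed
  have cardK: "card {j. j < n \<and> E j = 0} = n - p" using cardE[of 0] nk by simp
  have "\<exists>L. (\<forall>j<n. E j = 0 \<longrightarrow> L j ^ (k + 1) = of_real ((-1) ^ (k + 1) * C) \<and>
      ((\<lambda>t. Z j t / of_real (\<delta> t)) \<longlongrightarrow> L j) (at_right a)) \<and>
    (\<forall>w. w ^ (k + 1) = of_real ((-1) ^ (k + 1) * C) \<longrightarrow> (\<exists>j<n. E j = 0 \<and> L j = w))" (is "\<exists>L. ?burst L")
    unfolding sg[symmetric] unfolding nk(1)[symmetric] \<delta>_def a_def
  proof (rule burst_scale[where b = b])
    show "p < n" using pn by simp
  qed (use ab Zc Zprod E(2) cardK in \<open>simp_all add: I_def a_def\<close>)
  then obtain L where L0: "?burst L" by (rule exE)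
  note L3 = conjunct2[OF L0]
  have L: "L j ^ (k + 1) = of_real ((-1) ^ (k + 1) * C)"
    "((\<lambda>t. Z j t / of_real (\<delta> t)) \<longlongrightarrow> L j) (at_right a)" if "j < n" "E j = 0" for j
    using conjunct1[OF L0] that by blast+
  define K where "K = {j. j < n \<and> E j = 0}"
  have K: "finite K" "card K = k + 1" using cardK nk by (auto simp: K_def)
  let ?W = "{z. z ^ (k + 1) = complex_of_real ((-1) ^ (k + 1) * C)}"
  define r where "r = root (k + 1) C"
  have r: "r > 0" unfolding r_def using C by (intro real_root_gt_zero) auto
  define w where "w = (\<lambda>j. complex_of_real r * cis (burst_angle k j))"
  have bw: "bij_betw w {1..k + 1} ?W" unfolding w_def r_def by (rule burst_directions[OF C])
  have "L ` K = ?W"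
  proof (intro equalityI subsetI)
    fix z assume "z \<in> ?W"
    then obtain j where "j < n" "E j = 0" "L j = z" using L3 by blast
    then show "z \<in> L ` K" by (auto simp: K_def)
  qed (use L(1) in \<open>auto simp: K_def\<close>)
  moreover have "card ?W = card K"
  proof -
    have c: "card {1..k + 1} = k + 1" by simp
    show ?thesis unfolding K(2) by (rule trans[OF bij_betw_same_card[OF bw, symmetric] c])
  qed
  \<comment> \<open>Every root is the limit of some rescaled branch, and there are as many roots as
    branches at the origin, so no direction is taken twice.\<close>
  ultimately have Linj: "inj_on L K" using K(1) by (intro eq_card_imp_inj_on) auto
  have LW: "L ` K = ?W" by fact

  text \<open>Conjugation permutes the branches, so each is real throughout or nowhere real.\<close>
  have conj: "\<exists>i<n. \<forall>t\<in>I. cnj (Z j t) = Z i t" if "j < n" for j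
  proof (rule Zall)
    show "continuous_on I (\<lambda>t. cnj (Z j t))" by (intro continuous_intros Zc that)
    show "\<forall>t\<in>I. poly (?S t) (cnj (Z j t)) = 0"
      using Zroot[OF that] poly_skyburst_cnj[OF I1] by simp
  qed
  then obtain \<sigma> where \<sigma>: "\<And>j. j < n \<Longrightarrow> \<sigma> j < n" "\<And>j t. j < n \<Longrightarrow> t \<in> I \<Longrightarrow> cnj (Z j t) = Z (\<sigma> j) t"
    by metis
  have real_br: "Z j t \<in> \<real>" if "j < n" "\<sigma> j = j" "t \<in> I" for j t
    using \<sigma>(2)[of j t] that by (simp add: Reals_cnj_iff)
  \<comment> \<open>A real value would be a meeting point of the branch with its conjugate, but
    distinct branches never meet.\<close>
  have nonreal_br: "Z j t \<notin> \<real>" if "j < n" "\<sigma> j \<noteq> j" "t \<in> I" for j t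
  proof
    assume "Z j t \<in> \<real>"
    then have "Z (\<sigma> j) t = Z j t" using \<sigma>(2)[of j t] that by (simp add: Reals_cnj_iff)
    then show False using Zinj[OF that(3)] \<sigma>(1)[OF that(1)] that(1,2) by (auto simp: inj_on_def)
  qed
  have cnj_lim: "((\<lambda>t. f (Z (\<sigma> j) t) t) \<longlongrightarrow> cnj l) F"
    if "j < n" "((\<lambda>t. f (Z j t) t) \<longlongrightarrow> l) F" "\<forall>\<^sub>F t in F. t \<in> I" "\<And>z t. f (cnj z) t = cnj (f z t)"
    for f :: "complex \<Rightarrow> real \<Rightarrow> complex" and l j F
  proof (rule Lim_transform_eventually)
    show "((\<lambda>t. cnj (f (Z j t) t)) \<longlongrightarrow> cnj l) F" by (intro tendsto_cnj that)
    show "\<forall>\<^sub>F t in F. cnj (f (Z j t) t) = f (Z (\<sigma> j) t) t"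
      using that(3) by eventually_elim (metis \<sigma>(2) that(1,4))
  qed
  have E\<sigma>: "E (\<sigma> j) = cnj (E j)" if "j < n" for j
    using tendsto_unique[OF trivial_limit_at_right_real E(2)[OF \<sigma>(1)[OF that]] cnj_lim[OF that, of "\<lambda>z _. z"]]
      E(2)[OF that] evI by simp
  have E'\<sigma>: "E' (\<sigma> j) = cnj (E' j)" if "j < n" for j
    using tendsto_unique[OF trivial_limit_at_left_real E'(2)[OF \<sigma>(1)[OF that]] cnj_lim[OF that, of "\<lambda>z _. z"]]
      E'(2)[OF that] evI by simp
  have L\<sigma>: "\<sigma> j \<in> K" "L (\<sigma> j) = cnj (L j)" if "j \<in> K" for j
  proof -
    have j: "j < n" "E j = 0" using that by (auto simp: K_def)
    then show s: "\<sigma> j \<in> K" using E\<sigma>[of j] \<sigma>(1)[of j] by (simp add: K_def)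
    have "((\<lambda>t. Z (\<sigma> j) t / of_real (\<delta> t)) \<longlongrightarrow> cnj (L j)) (at_right a)"
      by (rule cnj_lim[OF j(1), of "\<lambda>z t. z / of_real (\<delta> t)"]) (use L(2)[OF j] evI in auto)
    then show "L (\<sigma> j) = cnj (L j)"
      using tendsto_unique[OF trivial_limit_at_right_real L(2)] s by (auto simp: K_def)
  qed
  have \<sigma>_K: "\<sigma> j = j \<longleftrightarrow> L j \<in> \<real>" if "j \<in> K" for j
    using L\<sigma>[OF that] that Linj by (auto simp: Reals_cnj_iff inj_on_def)
  \<comment> \<open>The limit at \<open>a\<close> is a nonzero real zero, hence simple; the
    conjugate branch has the same limit and must coincide.\<close>
  have \<sigma>_nK: "\<sigma> j = j" if "j < n" "j \<notin> K" for j
  proof (rule Einj)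
    have "E j \<noteq> 0" using that by (simp add: K_def)
    then have "E j \<in> \<real>" using E\<Gamma>[OF that(1)] by auto
    then show "E (\<sigma> j) = E j" using E\<sigma>[OF that(1)] by (simp add: Reals_cnj_iff)
    then show "E (\<sigma> j) \<noteq> 0" using \<open>E j \<noteq> 0\<close> by simp
  qed (use that \<sigma> in auto)
  \<comment> \<open>The same argument at \<open>b\<close>: a nonzero end would be real and simple,
    yet shared by two branches.\<close>
  have nonreal_end: "E' j = 0" if "j < n" "\<sigma> j \<noteq> j" for j
  proof (rule ccontr)
    assume ne: "E' j \<noteq> 0"
    then have "E' j \<in> \<real>" using E'\<Gamma>[OF that(1)] by auto
    then have "E' (\<sigma> j) = E' j" using E'\<sigma>[OF that(1)] by (simp add: Reals_cnj_iff)
    then show False using E'inj[of "\<sigma> j" j] that \<sigma>(1) ne by auto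
  qed
  have ReZ: "continuous_on {a<..<b} (\<lambda>t. Re (Z j t))" if "j < n" for j
    using Zc[OF that] unfolding I_def by (intro continuous_intros)
  have Re_ne: "Re (Z j t) \<noteq> 0" "Re (Z j t) \<noteq> -1" if "j < n" "\<sigma> j = j" "t \<in> I" for j t
    using zero_ne[OF that(3) Zroot[OF that(1,3)]] real_br[OF that] by (auto simp: complex_is_Real_iff complex_eq_iff)
  have ReL: "((\<lambda>t. Re (Z j t) / \<delta> t) \<longlongrightarrow> Re (L j)) (at_right a)" if "j \<in> K" for j
    using tendsto_Re[OF L(2)[of j]] that by (simp add: K_def)
  \<comment> \<open>A real branch cannot cross 0, so it keeps the sign with which it leaves the
    origin.\<close>
  have pos_br: "Re (Z j t) > 0" if "j \<in> K" "\<sigma> j = j" "Re (L j) > 0" "t \<in> I" for j t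
  proof -
    have j: "j < n" using that by (simp add: K_def)
    have "\<forall>\<^sub>F t in at_right a. Re (Z j t) / \<delta> t > 0"
      by (rule order_tendstoD(1)[OF ReL[OF that(1)] that(3)])
    then have "\<forall>\<^sub>F t in at_right a. Re (Z j t) > 0"
      using \<delta> by eventually_elim (simp add: zero_less_divide_iff)
    then show ?thesis
      using stays_above[OF ab(1) ReZ[OF j], of 0 t] Re_ne(1)[OF j that(2)] that(4) by (auto simp: I_def)
  qed
  have neg_br: "Re (Z j t) < 0" if "j < n" "\<sigma> j = j" "\<forall>\<^sub>F t in at_right a. Re (Z j t) < 0" "t \<in> I" for j t
  proof -
    have c: "continuous_on {a<..<b} (\<lambda>t. - Re (Z j t))" by (intro continuous_on_minus ReZ that)
    have "- Re (Z j t) > 0"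
      by (rule stays_above[OF ab(1) c]) (use Re_ne(1)[OF that(1,2)] that(3,4) in \<open>auto simp: I_def\<close>)
    then show ?thesis by simp
  qed
  have gt_br: "Re (Z j t) > -1" if "j < n" "\<sigma> j = j" "t \<in> I" for j t
  proof -
    have "Re (E j) > -1" using E\<Gamma>[OF that(1)] by (cases "E j = 0") auto
    then have "\<forall>\<^sub>F t in at_right a. Re (Z j t) > -1"
      by (rule order_tendstoD(1)[OF tendsto_Re[OF E(2)[OF that(1)]]])
    then show ?thesis
      using stays_above[OF ab(1) ReZ[OF that(1)], of "-1" t] Re_ne(2)[OF that(1,2)] that(3) by (auto simp: I_def)
  qed
  have in_unit: "Z j t \<in> complex_of_real ` {-1<..<0}" if "j < n" "\<sigma> j = j" "\<forall>\<^sub>F t in at_right a. Re (Z j t) < 0" "t \<in> I" for j t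
    using neg_br[OF that] gt_br[OF that(1,2,4)] real_br[OF that(1,2,4)]
    by (intro image_eqI[of _ _ "Re (Z j t)"]) (auto simp: complex_is_Real_iff complex_eq_iff)

  text \<open>Branch \<open>q j\<close> leaves the origin at angle \<open>burst_angle k j\<close> for \<open>j \<le> k + 1\<close>.\<close>
  define q1 where "q1 = (\<lambda>j. inv_into K L (w j))"
  have b1: "bij_betw q1 {1..k + 1} K"
    using bij_betw_trans[OF bw bij_betw_inv_into[of L K ?W]] Linj LW
    unfolding q1_def bij_betw_def[of L] by (auto simp: o_def)
  have Lq1: "L (q1 j) = w j" if "j \<in> {1..k + 1}" for j
  proof -
    have "w j \<in> L ` K" unfolding LW using bw that by (auto simp: bij_betw_def)
    then show ?thesis unfolding q1_def by (rule f_inv_into_f)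
  qed
  have Kn: "K \<subseteq> {..<n}" by (auto simp: K_def)
  have "card {k + 2..n} = card ({..<n} - K)" using card_Diff_subset[OF K(1) Kn] K(2) by simp
  then obtain q2 where b2: "bij_betw q2 {k + 2..n} ({..<n} - K)"
    using finite_same_card_bij[of "{k + 2..n}" "{..<n} - K"] by auto
  define q where "q = (\<lambda>j. if j \<in> {1..k + 1} then q1 j else q2 j)"
  have bq: "bij_betw q {1..n} {..<n}"
  proof -
    have "bij_betw q {1..k + 1} K" using b1 by (rule bij_betw_cong[THEN iffD1, rotated]) (simp add: q_def)
    moreover have "bij_betw q {k + 2..n} ({..<n} - K)"
      using b2 by (rule bij_betw_cong[THEN iffD1, rotated]) (simp add: q_def)
    ultimately have "bij_betw q ({1..k + 1} \<union> {k + 2..n}) (K \<union> ({..<n} - K))"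
      by (rule bij_betw_combine) auto
    moreover have "{1..k + 1} \<union> {k + 2..n} = {1..n}" using nk by auto
    moreover have "K \<union> ({..<n} - K) = {..<n}" using Kn by auto
    ultimately show ?thesis by simp
  qed
  have qn: "q j < n" if "j \<in> {1..n}" for j using bq that by (auto simp: bij_betw_def)
  have qK: "q j \<in> K" "L (q j) = w j" if "j \<in> {1..k + 1}" for j
    using b1 Lq1 that by (auto simp: q_def bij_betw_def)
  have qnK: "q j \<notin> K" if "j \<in> {k + 2..n}" for j
    using b2 that by (auto simp: q_def bij_betw_def)
  define Y where "Y = (\<lambda>j t. if t = a then E (q j) else if t = b then E' (q j) else Z (q j) t)"
  have YI: "Y j t = Z (q j) t" if "t \<in> I" for j t using that by (auto simp: Y_def I_def)
  have Ya: "Y j a = E (q j)" and Yb: "Y j b = E' (q j)" for j using ab by (auto simp: Y_def)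
  have Yc: "continuous_on {a..b} (Y j)" if "j \<in> {1..n}" for j
    unfolding Y_def using Zc[OF qn[OF that]] E(2)[OF qn[OF that]] E'(2)[OF qn[OF that]]
    by (intro tendsto_imp_continuous_on_closed ab) (simp_all add: I_def)
  have cases: "t = a \<or> t = b \<or> t \<in> I" if "t \<in> {a..b}" for t using that by (auto simp: I_def)
  have traj: "zero_trajectories n {a..b} Y"
    unfolding zero_trajectories_def
  proof (intro conjI ballI Yc)
    fix t assume w: "t \<in> {a..b}"
    have re: "(\<Prod>j = 1..n. [:- f (q j), 1:]) = (\<Prod>j<n. [:- f j, 1:])" for f :: "nat \<Rightarrow> complex"
      by (rule prod.reindex_bij_betw[OF bq])
    show "?S t = (\<Prod>j = 1..n. [:- Y j t, 1:])"
      using cases[OF w] Zprod[of t] prodE prodE' re[of E] re[of E'] re[of "\<lambda>j. Z j t"]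
      by (auto simp: Ya Yb YI)
  qed
  have Yne: "Y j t \<noteq> 0" if "j \<in> {1..n}" "t \<in> I" for j t
    using zero_ne(1)[OF that(2) Zroot[OF qn[OF that(1)] that(2)]] YI[OF that(2)] by simp
  \<comment> \<open>A real direction is positive or negative; the negative ray belongs to index
    \<open>k + 1\<close> and the directions are distinct.\<close>
  have wre: "w j \<in> \<real> \<Longrightarrow> cis (burst_angle k j) = 1" if "j \<in> {1..k}" for j
  proof -
    assume "w j \<in> \<real>"
    then have "sin (burst_angle k j) = 0" using r by (simp add: w_def complex_is_Real_iff)
    moreover have "w j \<noteq> w (k + 1)"
    proof
      assume "w j = w (k + 1)"
      then have "j = k + 1" using inj_onD[OF bij_betw_imp_inj_on[OF bw]] that nk by simp
      then show False using that by simp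
    qed
    then have "cis (burst_angle k j) \<noteq> cis (burst_angle k (k + 1))" by (auto simp: w_def)
    then have "cis (burst_angle k j) \<noteq> -1" unfolding cis_burst_angle[of k "k + 1"] by simp
    ultimately have "sin (burst_angle k j) = 0" "cos (burst_angle k j) \<noteq> -1" by (auto simp: complex_eq_iff)
    then show "cis (burst_angle k j) = 1"
      using sin_cos_squared_add[of "burst_angle k j"] by (auto simp: complex_eq_iff power2_eq_1_iff)
  qed
  have burst: "bursts_from_origin_at_angle (Y j) a (burst_angle k j)" if "j \<in> {1..k + 1}" for j
  proof (rule bursts_scaled[OF _ _ \<delta> _ r])
    have jn: "q j < n" "E (q j) = 0" using qK(1)[OF that] by (auto simp: K_def)
    show "Y j a = 0" using jn Ya by simp
    show "\<forall>\<^sub>F t in at_right a. Y j t \<noteq> 0"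
      using evI(1) by eventually_elim (rule Yne, use that nk in auto)
    have "((\<lambda>t. Z (q j) t / of_real (\<delta> t)) \<longlongrightarrow> w j) (at_right a)"
      using L(2)[OF jn] qK(2)[OF that] by simp
    then have "((\<lambda>t. Y j t / of_real (\<delta> t)) \<longlongrightarrow> w j) (at_right a)"
    proof (rule Lim_transform_eventually)
      show "\<forall>\<^sub>F t in at_right a. Z (q j) t / of_real (\<delta> t) = Y j t / of_real (\<delta> t)"
        using evI(1) by eventually_elim (simp add: YI)
    qed
    then show "((\<lambda>t. Y j t / of_real (\<delta> t)) \<longlongrightarrow> of_real r * cis (burst_angle k j)) (at_right a)"
      by (simp only: w_def)
  qed
  \<comment> \<open>An angle counts only modulo \<open>2 * pi\<close>: on the positive ray
    \<open>burst_angle\<close> equals \<open>2 * pi\<close>, not 0.\<close>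
  have burst0: "bursts_from_origin_at_angle (Y j) a 0 \<longleftrightarrow> cis (burst_angle k j) = 1" if "j \<in> {1..k + 1}" for j
  proof
    assume "bursts_from_origin_at_angle (Y j) a 0"
    then show "cis (burst_angle k j) = 1"
      using burst[OF that] tendsto_unique[OF trivial_limit_at_right_real]
      unfolding bursts_from_origin_at_angle_def by (metis cis_zero)
  next
    assume "cis (burst_angle k j) = 1"
    then show "bursts_from_origin_at_angle (Y j) a 0"
      using burst[OF that] unfolding bursts_from_origin_at_angle_def by simp
  qed
  \<comment> \<open>The positive number \<open>r ^ (k + 1)\<close> equals
    \<open>(-1) ^ (k + 1) * C\<close> with \<open>C > 0\<close>, which forces odd
    \<open>k\<close>.\<close>
  have pos: "\<sigma> (q j) = q j \<and> Re (L (q j)) > 0 \<and> odd k" if j: "j \<in> {1..k}" and c: "cis (burst_angle k j) = 1" for j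
  proof -
    have wj: "w j = of_real r" by (simp add: w_def c)
    have j1: "j \<in> {1..k + 1}" using j by simp
    have "w j ^ (k + 1) = of_real ((-1) ^ (k + 1) * C)" using bw j1 by (auto simp: bij_betw_def)
    then have "r ^ (k + 1) = (-1) ^ (k + 1) * C" unfolding wj by (metis of_real_eq_iff of_real_power)
    moreover have "r ^ (k + 1) > 0" using r by simp
    ultimately have "(-1) ^ (k + 1) * C > 0" by metis
    then have "(-1::real) ^ (k + 1) > 0" using C by (rule zero_less_mult_pos2)
    then have "odd k" by (cases "even k") auto
    then show ?thesis using \<sigma>_K[OF qK(1)[OF j1]] qK(2)[OF j1] wj r by simp
  qed
  \<comment> \<open>A self-conjugate loop branch is positive, so its limit is nonnegative, whereas
    nonzero limits at \<open>b\<close> lie in \<open>(-1, 0)\<close>.\<close>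
  have end0: "E' (q j) = 0" if j: "j \<in> {1..k}" for j
  proof (cases "\<sigma> (q j) = q j")
    case False
    then show ?thesis using nonreal_end qn[of j] j nk by simp
  next
    case True
    have j1: "j \<in> {1..k + 1}" and jn: "q j < n" using j nk qn[of j] by auto
    have "cis (burst_angle k j) = 1" using wre[OF j] \<sigma>_K[OF qK(1)[OF j1]] qK(2)[OF j1] True by simp
    then have Lpos: "Re (L (q j)) > 0" using pos[OF j] by simp
    have "Re (E' (q j)) \<ge> 0"
    proof (rule tendsto_lowerbound)
      show "((\<lambda>t. Re (Z (q j) t)) \<longlongrightarrow> Re (E' (q j))) (at_left b)" by (intro tendsto_Re E' jn)
      show "\<forall>\<^sub>F t in at_left b. 0 \<le> Re (Z (q j) t)"
        using evI(2) by eventually_elim (use pos_br[OF qK(1)[OF j1] True Lpos] in \<open>auto simp: less_imp_le\<close>)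
    qed simp
    then show ?thesis using E'\<Gamma>[OF jn] by (cases "E' (q j) = 0") auto
  qed
  have loop: "loop_at_origin (Y j) a b" if j: "j \<in> {1..k}" for j
    unfolding loop_at_origin_def
  proof (intro conjI ballI)
    have j1: "j \<in> {1..k + 1}" and jn: "j \<in> {1..n}" using j nk by auto
    show "continuous_on {a..b} (Y j)" by (rule Yc[OF jn])
    show "Y j a = 0" using qK(1)[OF j1] Ya by (simp add: K_def)
    show "Y j b = 0" using end0[OF j] Yb by simp
    show "Y j t \<noteq> 0" if "t \<in> {a<..<b}" for t
      using Yne[OF jn] that by (simp add: I_def)
  qed
  have flat: "flattened_loop (Y j) a b" if j: "j \<in> {1..k}" and c: "cis (burst_angle k j) = 1" for j
    unfolding flattened_loop_def
  proof (intro conjI ballI loop j)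
    have j1: "j \<in> {1..k + 1}" and jn: "j \<in> {1..n}" using j nk by auto
    note P = pos[OF j c]
    have YR: "Y j t = of_real (Re (Y j t))" "Re (Y j t) > 0" if "t \<in> I" for t
      using pos_br[OF qK(1)[OF j1], of t] real_br[OF qn[OF jn], of t] P that
      by (auto simp: YI complex_is_Real_iff complex_eq_iff)
    show "Y j t \<in> complex_of_real ` {0<..}" if "t \<in> {a<..<b}" for t
      using YR[of t] that by (auto simp: I_def)
    show "\<exists>\<tau>\<in>{a<..<b}. strict_mono_on {a..\<tau>} (\<lambda>t. Re (Y j t)) \<and> strict_antimono_on {\<tau>..b} (\<lambda>t. Re (Y j t))"
    proof (rule unimodal_if_levels_at_most_twice[OF ab(1)])
      show "continuous_on {a..b} (\<lambda>t. Re (Y j t))" by (intro continuous_intros Yc[OF jn])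
      show "Re (Y j a) = 0" "Re (Y j b) = 0" using loop[OF j] by (auto simp: loop_at_origin_def)
      show "Re (Y j t) > 0" if "a < t" "t < b" for t using YR(2)[of t] that by (simp add: I_def)
      fix s t u assume stu: "a < s" "s < t" "t < u" "u < b" "Re (Y j s) = Re (Y j t)" "Re (Y j t) = Re (Y j u)"
      define x where "x = Re (Y j t)"
      have sI: "s \<in> I" "t \<in> I" "u \<in> I" using stu by (auto simp: I_def)
      have root: "sky_num n t x = 0" if "t \<in> I" "Re (Y j t) = x" for t
      proof -
        have "poly (?S t) (Y j t) = 0" using Zroot[OF qn[OF jn] that(1)] YI[OF that(1)] by simp
        then have "poly (?S t) (of_real x) = 0" using YR(1)[OF that(1)] that(2) by simp
        then show ?thesis using poly_skyburst_of_real_eq_0[OF I1[OF that(1)]] by simp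
      qed
      show False
      proof (rule sky_num_no_three_zeros[of x "Suc p" n s t u])
        show "x > 0" using YR(2)[OF sI(2)] by (simp add: x_def)
        show "odd (n - Suc p)" using P by (simp add: k_def)
      qed (use stu pn root sI in \<open>auto simp: a_def b_def x_def\<close>)
    qed
  qed

  \<comment> \<open>The zeros in the unit interval\<close>
  have stay: "Y j t \<in> complex_of_real ` {-1<..<0} \<or> (t = a \<and> j = k + 1 \<and> Y j t = 0)"
    if j: "j \<in> {k + 1..n}" and t: "t \<in> {a..b}" for j t
  proof -
    have jn: "j \<in> {1..n}" using j nk by auto
    \<comment> \<open>Otherwise this branch and the \<open>k\<close> loops would be
      \<open>k + 1\<close> branches ending at a zero of order \<open>k\<close>.\<close>
    have E'ne: "E' (q j) \<noteq> 0"
    proof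
      assume e: "E' (q j) = 0"
      have inj: "inj_on q {1..n}" using bq by (simp add: bij_betw_def)
      have sub: "q ` ({1..k} \<union> {j}) \<subseteq> {i. i < n \<and> E' i = 0}" using end0 e qn jn nk by auto
      have "card (q ` ({1..k} \<union> {j})) = card ({1..k} \<union> {j})"
        by (rule card_image[OF inj_on_subset[OF inj]]) (use jn nk in auto)
      also have "\<dots> = k + 1" using j by (subst card_Un_disjoint) auto
      finally have "k + 1 \<le> card {i. i < n \<and> E' i = 0}" using card_mono[OF _ sub] by simp
      then show False using cardE'[of 0] by simp
    qed
    have main: "\<sigma> (q j) = q j \<and> (\<forall>\<^sub>F t in at_right a. Re (Z (q j) t) < 0)"
    proof (cases "j = k + 1")
      case True
      then have j1: "j \<in> {1..k + 1}" by simp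
      have wj: "w j = of_real (- r)" unfolding w_def cis_burst_angle True by simp
      then have "Re (L (q j)) < 0" using qK(2)[OF j1] r by simp
      then have "\<forall>\<^sub>F t in at_right a. Re (Z (q j) t) / \<delta> t < 0"
        by (rule order_tendstoD(2)[OF ReL[OF qK(1)[OF j1]]])
      then have "\<forall>\<^sub>F t in at_right a. Re (Z (q j) t) < 0"
        using \<delta> by eventually_elim (simp add: divide_less_0_iff)
      moreover have "\<sigma> (q j) = q j" using \<sigma>_K[OF qK(1)[OF j1]] qK(2)[OF j1] wj by simp
      ultimately show ?thesis by simp
    next
      case False
      then have nK: "q j \<notin> K" using qnK[of j] j by simp
      then have "Re (E (q j)) < 0" using E\<Gamma>[OF qn[OF jn]] qn[OF jn] by (auto simp: K_def)
      then have "\<forall>\<^sub>F t in at_right a. Re (Z (q j) t) < 0"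
        by (rule order_tendstoD(2)[OF tendsto_Re[OF E(2)[OF qn[OF jn]]]])
      then show ?thesis using \<sigma>_nK[OF qn[OF jn] nK] by simp
    qed
    consider "t = a" | "t = b" | "t \<in> I" using cases[OF t] by blast
    then show ?thesis
    proof cases
      case 1
      show ?thesis
      proof (cases "E (q j) = 0")
        case True
        then have "q j \<in> K" using qn[OF jn] by (simp add: K_def)
        then have "j = k + 1" using qnK[of j] j by (cases "j = k + 1") auto
        then show ?thesis using True 1 Ya by simp
      next
        case False
        then show ?thesis using E\<Gamma>[OF qn[OF jn]] 1 Ya by simp
      qed
    next
      case 2
      then show ?thesis using E'\<Gamma>[OF qn[OF jn] E'ne] Yb by simp
    next
      case 3
      then show ?thesis using in_unit[OF qn[OF jn], of t] main YI by simp
    qed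
  qed
  have nonreal: "Y j t \<notin> \<real>" if "j \<in> {1..k}" "cis (burst_angle k j) \<noteq> 1" "t \<in> {a<..<b}" for j t
  proof -
    have j1: "j \<in> {1..k + 1}" and jn: "j \<in> {1..n}" using that nk by auto
    have "\<sigma> (q j) \<noteq> q j" using wre[OF that(1)] that(2) \<sigma>_K[OF qK(1)[OF j1]] qK(2)[OF j1] by auto
    then show ?thesis using nonreal_br[OF qn[OF jn], of t] that(3) YI by (simp add: I_def)
  qed
  have odd: "\<exists>j\<in>{1..k}. bursts_from_origin_at_angle (Y j) a 0" if "odd k"
  proof -
    define j where "j = (k + 1) div 2"
    have j: "j \<in> {1..k}" "2 * j = k + 1" using that nk by (auto simp: j_def)
    have "real (k + 1) = 2 * real j" using j(2) by (metis of_nat_mult of_nat_numeral)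
    then have "cis (burst_angle k j) = 1" unfolding cis_burst_angle using j(1) by simp
    then show ?thesis using burst0[of j] j(1) by (intro bexI[of _ j]) auto
  qed
  show ?thesis
    unfolding a_def[symmetric] b_def[symmetric]
    by (intro exI[of _ Y] conjI ballI traj burst loop)
      (use burst burst0 flat nonreal odd stay in auto)
qed

lemma skyburst_zeros_in_unit:
  assumes w: "\<omega> > real n" and z: "poly (skyburst n \<omega>) z = 0"
  shows "z \<in> complex_of_real ` {-1<..<0}"
proof -
  have "real n \<ge> 0" by simp
  then have "\<omega> > real n - 1" "\<omega> > -1" using w by linarith+
  from skyburst_fizzle[OF this] obtain A where A: "finite A" "A \<subseteq> {-1<..<0}"
    "skyburst n \<omega> = (\<Prod>a\<in>A. [:- complex_of_real a, 1:])" by blast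
  then obtain a where "a \<in> A" "z = complex_of_real a"
    using z by (auto simp: poly_prod)
  then show ?thesis using A(2) by blast
qed

theorem mainTheorem2:
  fixes n :: nat
  assumes "n \<ge> 2"
  shows
    "(\<forall>m\<in>{1..n-1}. \<exists>Z. zero_trajectories n {real m - 1..real m} Z \<and>
        (\<forall>j\<in>{1..n-m}.
           bursts_from_origin_at_angle (Z j) (real m - 1) (burst_angle (n - m) j) \<and>
           loop_at_origin (Z j) (real m - 1) (real m) \<and>
           (if bursts_from_origin_at_angle (Z j) (real m - 1) 0
            then flattened_loop (Z j) (real m - 1) (real m)
            else \<forall>\<omega>\<in>{real m - 1<..<real m}. Z j \<omega> \<notin> \<real>)) \<and>
        (odd (n - m) \<longrightarrow>
           (\<exists>j\<in>{1..n-m}. bursts_from_origin_at_angle (Z j) (real m - 1) 0)) \<and>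
        (\<forall>j\<in>{n-m+1..n}. \<forall>\<omega>\<in>{real m - 1..real m}.
           Z j \<omega> \<in> complex_of_real ` {-1<..<0} \<or>
           (\<omega> = real m - 1 \<and> j = n - m + 1 \<and> Z j \<omega> = 0))) \<and>
     (\<forall>\<omega>>real n. \<forall>z. poly (skyburst n \<omega>) z = 0 \<longrightarrow> z \<in> complex_of_real ` {-1<..<0}) \<and>
     (\<forall>\<epsilon>>0. \<forall>\<^sub>F \<omega> in at_top. \<forall>z. poly (skyburst n \<omega>) z = 0 \<longrightarrow> dist z (-1) < \<epsilon>)"
proof (intro conjI ballI, goal_cases)
  case (1 m)
  define p where "p = m - 1"
  have m: "m = Suc p" and pn: "Suc p < n" using 1 by (auto simp: p_def)
  have p: "real (Suc p) - 1 = real p" by simp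
  show ?case unfolding m p by (rule skyburst_burst[OF pn])
next
  case 2
  show ?case using skyburst_zeros_in_unit by blast
next
  case 3
  show ?case
  proof (intro allI impI)
    fix \<epsilon> :: real assume \<epsilon>: "\<epsilon> > 0"
    \<comment> \<open>A quotient of two products of \<open>n\<close> factors, each \<omega> plus a
      constant; the limit polynomial is \<open>(1 + z) ^ n\<close>.\<close>
    have lim1: "((\<lambda>\<omega>. sky_coeff n j \<omega>) \<longlongrightarrow> real (n choose j)) at_top" for j
    proof -
      have g: "((\<lambda>\<omega>::real. ((\<omega> + c) gchoose n) / ((\<omega> + d) gchoose n)) \<longlongrightarrow> 1) at_top" for c d :: real
      proof -
        have "((\<lambda>\<omega>. \<Prod>i = 0..<n. (\<omega> + c - real i) / (\<omega> + d - real i)) \<longlongrightarrow> (\<Prod>i = 0..<n. 1)) at_top"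
        proof (rule tendsto_prod)
          fix i
          have "filterlim (\<lambda>\<omega>. (d - real i) + \<omega>) at_infinity at_top"
            by (intro filterlim_at_top_imp_at_infinity filterlim_tendsto_add_at_top[OF tendsto_const filterlim_ident])
          then have "((\<lambda>\<omega>. 1 + (c - d) / ((d - real i) + \<omega>)) \<longlongrightarrow> 1 + 0) at_top"
            by (intro tendsto_add tendsto_const tendsto_divide_0[OF tendsto_const])
          then have "((\<lambda>\<omega>. 1 + (c - d) / ((d - real i) + \<omega>)) \<longlongrightarrow> 1) at_top" by simp
          then show "((\<lambda>\<omega>. (\<omega> + c - real i) / (\<omega> + d - real i)) \<longlongrightarrow> 1) at_top"
          proof (rule Lim_transform_eventually)
            show "\<forall>\<^sub>F \<omega> in at_top. 1 + (c - d) / ((d - real i) + \<omega>) = (\<omega> + c - real i) / (\<omega> + d - real i)"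
              using eventually_gt_at_top[of "real i - d"] by eventually_elim (simp add: field_simps)
          qed
        qed
        then show ?thesis by (simp add: gbinomial_prod_rev prod_dividef)
      qed
      show ?thesis
        using tendsto_mult[OF tendsto_const[of "real (n choose j)"] g[of "real j" "real n"]]
        unfolding sky_coeff_def by simp
    qed
    have "((\<lambda>\<omega>. \<Sum>j\<le>n. \<bar>real (n choose j) - sky_coeff n j \<omega>\<bar>) \<longlongrightarrow> (\<Sum>j\<le>n. \<bar>real (n choose j) - real (n choose j)\<bar>)) at_top"
      by (intro tendsto_intros lim1)
    then have "((\<lambda>\<omega>. \<Sum>j\<le>n. \<bar>real (n choose j) - sky_coeff n j \<omega>\<bar>) \<longlongrightarrow> 0) at_top" by simp
    then have "\<forall>\<^sub>F \<omega> in at_top. (\<Sum>j\<le>n. \<bar>real (n choose j) - sky_coeff n j \<omega>\<bar>) < \<epsilon> ^ n"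
      using \<epsilon> by (intro order_tendstoD(2)) auto
    then show "\<forall>\<^sub>F \<omega> in at_top. \<forall>z. poly (skyburst n \<omega>) z = 0 \<longrightarrow> dist z (-1) < \<epsilon>"
      using eventually_gt_at_top[of "real n"]
    proof eventually_elim
      case (elim \<omega>)
      have w: "\<omega> > -1" using elim(2) by (meson less_trans neg_less_0_iff_less of_nat_0_le_iff order_less_le_trans zero_less_one)
      show ?case
      proof (intro allI impI)
        fix z assume z: "poly (skyburst n \<omega>) z = 0"
        obtain x where x: "z = complex_of_real x" "-1 < x" "x < 0" using skyburst_zeros_in_unit[OF elim(2) z] by auto
        have "(\<Sum>j\<le>n. complex_of_real (sky_coeff n j \<omega>) * z ^ j) = 0"
          using z unfolding poly_altdef coeff_skyburst_top(2)[OF w] coeff_skyburst'[OF w] .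
        then have s0: "(\<Sum>j\<le>n. sky_coeff n j \<omega> * x ^ j) = 0"
          unfolding x(1) by (metis (mono_tags, lifting) of_real_eq_0_iff of_real_mult of_real_power of_real_sum sum.cong)
        \<comment> \<open>At the zero \<open>x\<close> this is the error of approximating
          \<open>(1 + z) ^ n\<close>, which the coefficient errors bound since
          \<open>\<bar>x\<bar> < 1\<close>; comparing \<open>n\<close>-th powers gives the distance
          to -1.\<close>
        have "(x + 1) ^ n = (\<Sum>j\<le>n. real (n choose j) * x ^ j)"
          by (simp add: binomial_ring)
        also have "\<dots> = (\<Sum>j\<le>n. (real (n choose j) - sky_coeff n j \<omega>) * x ^ j)"
          using s0 by (simp add: left_diff_distrib sum_subtractf)
        also have "\<dots> \<le> (\<Sum>j\<le>n. \<bar>real (n choose j) - sky_coeff n j \<omega>\<bar>)"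
        proof (rule sum_mono)
          fix j
          have "(real (n choose j) - sky_coeff n j \<omega>) * x ^ j \<le> \<bar>real (n choose j) - sky_coeff n j \<omega>\<bar> * \<bar>x\<bar> ^ j"
            by (metis abs_ge_self abs_mult power_abs)
          also have "\<dots> \<le> \<bar>real (n choose j) - sky_coeff n j \<omega>\<bar> * 1"
            using x by (intro mult_left_mono power_le_one) auto
          finally show "(real (n choose j) - sky_coeff n j \<omega>) * x ^ j \<le> \<bar>real (n choose j) - sky_coeff n j \<omega>\<bar>" by simp
        qed
        also have "\<dots> < \<epsilon> ^ n" by (rule elim(1))
        finally have "x + 1 < \<epsilon>" using \<epsilon> by (metis less_imp_le power_less_imp_less_base)
        then have "dist x (-1) < \<epsilon>" using x by (simp add: dist_real_def)
        then show "dist z (-1) < \<epsilon>" unfolding x(1)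
          by (metis dist_of_real of_real_1 of_real_minus)
      qed
    qed
  qed
qed

end
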